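(* Let $f:\mathbb{C}\to\mathbb{C}$ be a polynomial map of degree $d\geq2$ and let $\nu$ be a PB probability measure on $\mathbb{P}^1$. Then $$\lim_{n\to\infty}\frac{1}{d^n-1}\left((f^n)'\right)^*(\nu)=\mu_f$$ in the sense of measures.
   Context: $f^n$ is the $n$-th iterate of $f$, and its derivative $(f^n)'$, a polynomial of degree $d^n-1$, is viewed as a map $\mathbb{P}^1\to\mathbb{P}^1$. For a nonconstant rational map $h:\mathbb{P}^1\to\mathbb{P}^1$ and a measure $\nu$, the measure $h^*\nu$ is defined by $\langle h^*\nu,\phi\rangle=\int\big(\sum_{h(z)=w}\phi(z)\big)\,d\nu(w)$ for continuous $\phi$, preimages counted with multiplicity. The equilibrium measure is the probability measure $\mu_f=dd^c g_f$, where $g_f(z)=\lim_{n\to\infty}d^{-n}\log\max\{1,|f^n(z)|\}$ and $dd^c$ is normalized so that $dd^c\log|z|=\delta_0$ on $\mathbb{C}$. A probability measure $\nu$ on $\mathbb{P}^1$ is PB (has bounded quasi-potentials) if $\nu=\omega_{\mathbb{P}^1}+dd^c\eta$ with $\eta$ bounded on $\mathbb{P}^1$, where $\omega_{\mathbb{P}^1}$ is the normalized Fubini–Study form. *)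

theory Defs
  imports "HOL-Probability.Probability" "HOL-Computational_Algebra.Polynomial"
begin

section \<open>The projective line\<close>

text \<open>The complex projective line is the one-point compactification of the plane:
  \<^term>\<open>Some z\<close> is the finite point \<open>z\<close> and \<^term>\<open>None\<close> is the point at infinity.\<close>

abbreviation P1 :: "complex option topology" where
  "P1 \<equiv> Alexandroff_compactification euclidean"

definition P1_borel :: "complex option measure" where
  "P1_borel = sigma (topspace P1) {U. openin P1 U}"

lemma measurable_Some_P1: "Some \<in> borel \<rightarrow>\<^sub>M P1_borel"
  unfolding P1_borel_def
proof (rule measurable_measure_of)
  show "{U. openin P1 U} \<subseteq> Pow (topspace P1)"
    by (auto dest: openin_subset simp del: topspace_Alexandroff_compactification)
  show "Some \<in> space borel \<rightarrow> topspace P1"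
    by auto
  fix U assume "U \<in> {U. openin P1 U}"
  then have "open (Some -` U)"
    by (auto simp: openin_Alexandroff_compactification inj_vimage_image_eq vimage_def
        image_iff open_closed Collect_neg_eq)
  then show "Some -` U \<inter> space borel \<in> sets borel"
    by auto
qed


section \<open>Smooth functions and \<open>dd\<^sup>c\<close>\<close>

text \<open>\<open>C\<^sup>k\<close> functions on the plane, regarded as a real vector space.\<close>

fun Ck :: "nat \<Rightarrow> (complex \<Rightarrow> real) \<Rightarrow> bool" where
  "Ck 0 u \<longleftrightarrow> continuous_on UNIV u"
| "Ck (Suc k) u \<longleftrightarrow>
     (\<forall>z. u differentiable at z) \<and> (\<forall>v. Ck k (\<lambda>z. frechet_derivative u (at z) v))"

definition smooth :: "(complex \<Rightarrow> real) \<Rightarrow> bool" where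
  "smooth u \<longleftrightarrow> (\<forall>k. Ck k u)"

text \<open>Smoothness on the projective line, tested in the two charts \<open>z\<close> and \<open>1/z\<close>.\<close>

definition P1_smooth :: "(complex option \<Rightarrow> real) \<Rightarrow> bool" where
  "P1_smooth \<phi> \<longleftrightarrow>
     smooth (\<lambda>z. \<phi> (Some z)) \<and>
     smooth (\<lambda>z. \<phi> (if z = 0 then None else Some (1 / z)))"

definition laplacian :: "(complex \<Rightarrow> real) \<Rightarrow> complex \<Rightarrow> real" where
  "laplacian u z =
     (\<Sum>b\<in>Basis. frechet_derivative (\<lambda>w. frechet_derivative u (at w) b) (at z) b)"

text \<open>Density of \<open>dd\<^sup>c u\<close> with respect to Lebesgue measure. Since the distributional Laplacian of
  \<open>log |z|\<close> is \<open>2\<pi>\<close> times the Dirac mass at \<open>0\<close>, the factor \<open>1/(2\<pi>)\<close> is the normalization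
  for which \<open>dd\<^sup>c log |z|\<close> is the Dirac mass at \<open>0\<close>.\<close>

definition ddc :: "(complex \<Rightarrow> real) \<Rightarrow> complex \<Rightarrow> real" where
  "ddc u z = laplacian u z / (2 * pi)"


section \<open>PB measures\<close>

text \<open>The normalized Fubini--Study form. On the plane it is \<open>dd\<^sup>c\<close> of \<open>log (1 + |z|\<^sup>2) / 2\<close>, and it
  does not charge the point at infinity.\<close>

definition fubini_study :: "complex option measure" where
  "fubini_study =
     distr (density lborel (\<lambda>z. ennreal (1 / (pi * (1 + (norm z)\<^sup>2)\<^sup>2)))) P1_borel Some"

text \<open>The equation \<open>\<nu> = \<omega> + dd\<^sup>c \<eta>\<close> is an equality of currents on the projective line, i.e. it is
  tested against smooth functions \<open>\<phi>\<close>. The pairing of \<open>dd\<^sup>c \<eta>\<close> with \<open>\<phi>\<close> is the integral of \<open>\<eta>\<close>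
  against the smooth form \<open>dd\<^sup>c \<phi>\<close>; as that form does not charge the point at infinity, the
  integral may be computed in the plane.\<close>

definition PB :: "complex option measure \<Rightarrow> bool" where
  "PB \<nu> \<longleftrightarrow>
     (\<exists>\<eta>. \<eta> \<in> borel_measurable P1_borel \<and> bounded (range \<eta>) \<and>
        (\<forall>\<phi>. P1_smooth \<phi> \<longrightarrow>
           (\<integral>x. \<phi> x \<partial>\<nu>) = (\<integral>x. \<phi> x \<partial>fubini_study)
             + (\<integral>z. \<eta> (Some z) * ddc (\<lambda>w. \<phi> (Some w)) z \<partial>lborel)))"


section \<open>Polynomial maps\<close>

definition poly_iterate :: "complex poly \<Rightarrow> nat \<Rightarrow> complex poly" where
  "poly_iterate f n = (pcompose f ^^ n) [:0, 1:]"

lemma poly_poly_iterate: "poly (poly_iterate f n) = poly f ^^ n"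
  by (induction n) (auto simp: poly_iterate_def poly_pcompose)

text \<open>A nonconstant polynomial as a self-map of the projective line.\<close>

definition P1_map :: "complex poly \<Rightarrow> complex option \<Rightarrow> complex option" where
  "P1_map p = map_option (poly p)"

text \<open>Multiplicity of a point as a preimage of its own image. At infinity, which is a totally
  invariant point, it is the order of vanishing of \<open>1 / p(1/z)\<close> at \<open>0\<close>, that is, the degree.\<close>

fun P1_mult :: "complex poly \<Rightarrow> complex option \<Rightarrow> nat" where
  "P1_mult p (Some z) = order z (p - [:poly p z:])"
| "P1_mult p None = degree p"

text \<open>The measure \<open>p\<^sup>*\<nu>\<close>, given by its pairing with functions \<open>\<phi>\<close>. It is meant for nonconstant \<open>p\<close>,
  where the fibres are finite.\<close>

definition pullback :: "complex poly \<Rightarrow> complex option measure \<Rightarrow> (complex option \<Rightarrow> real) \<Rightarrow> real" where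
  "pullback p \<nu> \<phi> =
     (\<integral>w. (\<Sum>z | P1_map p z = w. real (P1_mult p z) * \<phi> z) \<partial>\<nu>)"


section \<open>The equilibrium measure\<close>

definition green :: "complex poly \<Rightarrow> complex \<Rightarrow> real" where
  "green f z = lim (\<lambda>n. ln (max 1 (norm ((poly f ^^ n) z))) / real (degree f) ^ n)"

text \<open>The Borel probability measure on the plane that equals \<open>dd\<^sup>c\<close> of the Green function in the
  sense of distributions.\<close>

definition equilibrium_measure_plane :: "complex poly \<Rightarrow> complex measure" where
  "equilibrium_measure_plane f =
     (THE \<mu>. sets \<mu> = sets borel \<and> prob_space \<mu> \<and>
        (\<forall>u. smooth u \<and> compact (closure {z. u z \<noteq> 0}) \<longrightarrow>
           (\<integral>z. u z \<partial>\<mu>) = (\<integral>z. green f z * ddc u z \<partial>lborel)))"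

text \<open>The same measure on the projective line, without mass at infinity.\<close>

definition equilibrium_measure :: "complex poly \<Rightarrow> complex option measure" where
  "equilibrium_measure f = distr (equilibrium_measure_plane f) P1_borel Some"

end

theory Submission
  imports Defs "HOL-Computational_Algebra.Fundamental_Theorem_Algebra"
    "HOL-Real_Asymp.Real_Asymp"
begin

text \<open>Write \<open>h\<close> for the derivative of the \<open>n\<close>-th iterate and let \<open>u\<close> be a test function on the plane.
  Since \<open>dd\<^sup>c log |z|\<close> is the Dirac mass at \<open>0\<close>, summing \<open>u\<close> over the fibre of \<open>h\<close> at \<open>a\<close> gives the
  logarithmic potential \<open>T(a) = \<integral> log |a - h(z)| dd\<^sup>c u(z)\<close>. Replacing \<open>log |w|\<close> by
  \<open>log (|w|\<^sup>2 + e\<^sup>2) / 2\<close> makes \<open>T\<close> smooth on the projective line, also at infinity because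
  \<open>\<integral> dd\<^sup>c u = 0\<close>, and \<open>\<integral> |dd\<^sup>c T| \<le> \<integral> |dd\<^sup>c u|\<close> independently of \<open>h\<close>. The bounded quasi-potential therefore
  shows that \<open>\<integral> T d\<nu>\<close> differs from the Fubini--Study average of \<open>T\<close>, and that in turn from
  \<open>\<integral> log\<^sup>+ |h| dd\<^sup>c u\<close>, by a quantity bounded uniformly in \<open>n\<close>. After division by \<open>d\<^sup>n - 1\<close> the claim reduces
  to \<open>log\<^sup>+ |h| / (d\<^sup>n - 1) \<rightarrow> g\<close> in \<open>L\<^sup>1\<^sub>l\<^sub>o\<^sub>c\<close>. The upper bound follows from the chain rule and
  \<open>log\<^sup>+ |f\<^sup>j| = d\<^sup>j g + O(1)\<close>; off the countably many zeros of these derivatives the chain rule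
  also gives the matching lower bound where \<open>g > 0\<close>, and where \<open>g = 0\<close> the upper bound alone suffices.

  The equilibrium measure is obtained in the same way, as a weak limit of the fibres of \<open>h\<close> averaged over
  the unit disc.\<close>

section \<open>Smooth kernels and parameter integrals\<close>

text \<open>The potential T is in general not smooth at critical values of h, while the PB equation
  accepts only functions smooth on the whole sphere; hence the parameter e. Two kinds of bounds must
  be kept apart. Those depending on h, such as \<open>fiber_bound\<close>, only justify e -> 0 for a
  fixed n. Those that survive to n -> infinity must not see h: after exchanging the integrals, the
  inner integral over a is taken with w = h(z) fixed, and translation invariance of Lebesgue measure
  disposes of w. Fubini-Study and disc averages are two instances of one estimate, which asks of the
  averaging density only values in [0, 1], mass 1 and a finite \<open>log_plus\<close> moment. Since
  the equilibrium measure is a definite description, existence and uniqueness have to be proved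
  before anything can be said about it. Positivity comes from its being a limit of measures.
  Averaging is essential there: for z^2 the fibre of h over 0 is the point 0 alone, far from the
  unit circle, whereas a bounded density smears out the logarithmic singularity. At infinity only
  the constant \<phi>(\<open>None\<close>) matters; it is split off, which leaves test functions on
  the plane.\<close>

definition Cc :: "(complex \<Rightarrow> real) \<Rightarrow> bool" where
  "Cc \<psi> \<longleftrightarrow> continuous_on UNIV \<psi> \<and> (\<exists>R. \<forall>z. R < norm z \<longrightarrow> \<psi> z = 0)"

text \<open>Bridge to the support condition in the definition of
  \<open>equilibrium_measure_plane\<close>.\<close>

lemma Cc_iff: "Cc \<psi> \<longleftrightarrow> continuous_on UNIV \<psi> \<and> compact (closure {z. \<psi> z \<noteq> 0})"
proof -
  have "compact (closure {z. \<psi> z \<noteq> 0}) \<longleftrightarrow> (\<exists>R. \<forall>z. R < norm z \<longrightarrow> \<psi> z = 0)"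
    unfolding compact_closure bounded_iff mem_Collect_eq Ball_def by (meson not_le)
  then show ?thesis by (simp add: Cc_def)
qed

lemma Cc_obtain_cbox:
  assumes "Cc \<psi>"
  obtains b where "\<And>z. z \<notin> cbox (-b) b \<Longrightarrow> \<psi> z = 0"
proof -
  obtain R where R: "\<And>z. R < norm z \<Longrightarrow> \<psi> z = 0" using assms by (auto simp: Cc_def)
  obtain b where "cball 0 R \<subseteq> cbox (-b) (b::complex)"
    using bounded_subset_cbox_symmetric[OF bounded_cball] by metis
  with R have "\<psi> z = 0" if "z \<notin> cbox (-b) b" for z
    using that by (metis subsetD mem_cball_0 not_le)
  then show ?thesis using that by blast
qed

lemma Cc_mult:
  assumes "Cc \<psi>" "continuous_on UNIV k"
  shows "Cc (\<lambda>z. k z * \<psi> z)"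
  using assms unfolding Cc_def by (metis continuous_on_mult mult_zero_right)

lemma Cc_abs: "Cc \<psi> \<Longrightarrow> Cc (\<lambda>z. \<bar>\<psi> z\<bar>)"
  unfolding Cc_def by (metis continuous_on_rabs abs_zero)

lemma Cc_bounded:
  assumes "Cc \<psi>"
  obtains B where "B \<ge> 0" "\<And>z. \<bar>\<psi> z\<bar> \<le> B"
proof -
  obtain b where b: "\<And>z. z \<notin> cbox (-b) b \<Longrightarrow> \<psi> z = 0" using Cc_obtain_cbox[OF assms] by blast
  have "compact (\<psi> ` cbox (-b) b)"
    using assms by (intro compact_continuous_image) (auto simp: Cc_def intro: continuous_on_subset)
  then obtain B where B: "\<And>z. z \<in> cbox (-b) b \<Longrightarrow> \<bar>\<psi> z\<bar> \<le> B"
    using compact_imp_bounded bounded_iff by (metis imageI real_norm_def)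
  show ?thesis
  proof (rule that[of "max B 0"])
    show "\<bar>\<psi> z\<bar> \<le> max B 0" for z
      using B[of z] b[of z] by (cases "z \<in> cbox (-b) b") auto
  qed simp
qed

lemma Cc_lborel:
  assumes "Cc \<psi>" "\<And>z. z \<notin> cbox p q \<Longrightarrow> \<psi> z = 0"
  shows Cc_integrable_cbox: "integrable lborel \<psi>"
    and Cc_integral_eq: "integral\<^sup>L lborel \<psi> = integral (cbox p q) \<psi>"
proof -
  have eq: "\<psi> = (\<lambda>z. indicator (cbox p q) z *\<^sub>R \<psi> z)"
    using assms(2) by (force simp: indicator_def)
  have c: "continuous_on (cbox p q) \<psi>" using assms(1) continuous_on_subset by (auto simp: Cc_def)
  then have "integrable lborel (\<lambda>z. indicator (cbox p q) z *\<^sub>R \<psi> z)"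
    by (intro borel_integrable_compact) auto
  then show "integrable lborel \<psi>" using eq by simp
  have "set_integrable lborel (cbox p q) \<psi>"
    unfolding set_integrable_def using \<open>integrable lborel (\<lambda>z. indicator _ z *\<^sub>R _ z)\<close> .
  from set_borel_integral_eq_integral(2)[OF this] show "integral\<^sup>L lborel \<psi> = integral (cbox p q) \<psi>"
    unfolding set_lebesgue_integral_def using eq by simp
qed

lemma Cc_integrable: "Cc \<psi> \<Longrightarrow> integrable lborel \<psi>"
  using Cc_obtain_cbox Cc_integrable_cbox by metis

text \<open>The weight vanishes outside a box, so this is the Leibniz rule on a compact domain. That
  rule wants the derivative as a continuous family of bounded linear maps; in finite dimension joint
  continuity of each directional derivative \<open>k' v\<close> is enough.\<close>

lemma has_derivative_integral_param:
  fixes k :: "complex \<Rightarrow> complex \<Rightarrow> real"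
  assumes k: "continuous_on UNIV (\<lambda>(z, a). k z a)"
    and k': "\<And>v. continuous_on UNIV (\<lambda>(z, a). k' v z a)"
    and d: "\<And>z a. (k z has_derivative (\<lambda>v. k' v z a)) (at a)"
    and \<psi>: "Cc \<psi>"
  shows "((\<lambda>a. LBINT z. k z a * \<psi> z) has_derivative (\<lambda>v. LBINT z. k' v z a * \<psi> z)) (at a)"
proof -
  obtain b where b: "\<And>z. z \<notin> cbox (-b) b \<Longrightarrow> \<psi> z = 0" using Cc_obtain_cbox[OF \<psi>] by blast
  have c1: "continuous_on UNIV (\<lambda>z. k z a)" for a
    using continuous_on_compose2[OF k continuous_on_Pair[OF continuous_on_id continuous_on_const]] by simp
  have c2: "continuous_on UNIV (\<lambda>z. k' v z a)" for a v
    using continuous_on_compose2[OF k' continuous_on_Pair[OF continuous_on_id continuous_on_const]] by simp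
  define fx where "fx a z = Blinfun (\<lambda>v. k' v z a * \<psi> z)" for a z
  have fx: "blinfun_apply (fx a z) = (\<lambda>v. k' v z a * \<psi> z)" for a z
    unfolding fx_def
    by (rule bounded_linear_Blinfun_apply)
       (intro bounded_linear_mult_const has_derivative_bounded_linear[OF d])
  have i: "(\<lambda>z. k z a * \<psi> z) integrable_on cbox (-b) b" for a
    by (intro integrable_continuous continuous_on_mult continuous_on_subset[OF c1])
       (use \<psi> in \<open>auto simp: Cc_def intro: continuous_on_subset\<close>)
  have cont: "continuous_on UNIV (\<lambda>(a, z). fx a z)"
  proof (rule continuous_on_blinfun_componentwise)
    fix i :: complex
    have "continuous_on UNIV \<psi>" using \<psi> by (simp add: Cc_def)
    from continuous_on_compose2[OF this continuous_on_snd[OF continuous_on_id]]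
    have "continuous_on UNIV (\<lambda>x::complex \<times> complex. \<psi> (snd x))" by simp
    with continuous_on_compose2[OF k' continuous_on_Pair[OF continuous_on_snd continuous_on_fst],
        OF continuous_on_id continuous_on_id, of _ i]
    have "continuous_on UNIV (\<lambda>x. k' i (snd x) (fst x) * \<psi> (snd x))"
      by (intro continuous_on_mult) auto
    then show "continuous_on UNIV (\<lambda>x. blinfun_apply (case x of (a, z) \<Rightarrow> fx a z) i)"
      by (simp add: split_beta fx)
  qed
  have D: "((\<lambda>a. integral (cbox (-b) b) (\<lambda>z. k z a * \<psi> z)) has_derivative
      blinfun_apply (integral (cbox (-b) b) (fx a))) (at a)"
    using leibniz_rule[of UNIV "-b" b "\<lambda>a z. k z a * \<psi> z" fx a] i
      has_derivative_mult_left[OF d] continuous_on_subset[OF cont]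
    by (simp add: fx)
  have ifx: "fx a integrable_on cbox (-b) b"
    using continuous_on_compose2[OF cont continuous_on_Pair[OF continuous_on_const continuous_on_id]]
    by (intro integrable_continuous) simp
  have "blinfun_apply (integral (cbox (-b) b) (fx a)) v = integral (cbox (-b) b) (\<lambda>z. k' v z a * \<psi> z)" for v
    using integral_linear[OF ifx blinfun.bounded_linear_left, of v] unfolding o_def fx by simp
  moreover have "integral (cbox (-b) b) (\<lambda>z. g z * \<psi> z) = (LBINT z. g z * \<psi> z)"
    if "continuous_on UNIV g" for g
    using Cc_integral_eq[OF Cc_mult[OF \<psi> that], of "-b" b] b by simp
  ultimately have "blinfun_apply (integral (cbox (-b) b) (fx a)) = (\<lambda>v. LBINT z. k' v z a * \<psi> z)"
    and "(\<lambda>a. integral (cbox (-b) b) (\<lambda>z. k z a * \<psi> z)) = (\<lambda>a. LBINT z. k z a * \<psi> z)"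
    by (simp_all add: fun_eq_iff c1 c2)
  with D show ?thesis by simp
qed

lemma frechet_derivative_eqI: "(f has_derivative D) (at a) \<Longrightarrow> frechet_derivative f (at a) = D"
  using frechet_derivative_at by metis


text \<open>For \<open>q = 1\<close> this is the classical exp(-e/x), smooth but not analytic at 0;
  the polynomial in 1/x is what its derivatives bring out. The scale \<open>e\<close> stays free
  because e -> 0 yields the indicator of the positive half-line.\<close>

definition flat :: "real poly \<Rightarrow> real \<Rightarrow> real \<Rightarrow> real" where
  "flat q e x = (if x > 0 then poly q (1 / x) * exp (- e / x) else 0)"

lemma tendsto_poly_mult_exp:
  fixes q :: "real poly"
  assumes "e > 0"
  shows "((\<lambda>t. t ^ k * poly q t * exp (- e * t)) \<longlongrightarrow> 0) at_top"
proof (induction q arbitrary: k)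
  case 0
  then show ?case by simp
next
  case (pCons c q)
  \<comment> \<open>The polynomial c + t q(t) splits into this monomial and a term whose extra t is
    absorbed by passing from k to k + 1.\<close>
  have "((\<lambda>t. c * t ^ k * exp (- e * t)) \<longlongrightarrow> 0) at_top"
    using assms by real_asymp
  from tendsto_add[OF this pCons.IH[of "Suc k"]] show ?case
    by (simp add: algebra_simps)
qed

text \<open>Off 0 this is the chain rule with t = 1/x, whose factor t^2 is \<open>monom 1 2\<close>.
  At 0 the right difference quotient becomes t q(t) exp(-e t) for t -> infinity, and the left one is
  zero.\<close>

lemma flat_has_derivative:
  assumes "e > 0"
  shows "(flat q e has_real_derivative flat (monom 1 2 * (smult e q - pderiv q)) e x) (at x)"
proof -
  consider "x > 0" | "x < 0" | "x = 0" by linarith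
  then show ?thesis
  proof cases
    case 1
    have "((\<lambda>x. poly q (1 / x) * exp (- e / x)) has_real_derivative
        flat (monom 1 2 * (smult e q - pderiv q)) e x) (at x)"
      using 1 by (auto intro!: derivative_eq_intros DERIV_chain2[OF poly_DERIV]
          simp: flat_def poly_monom field_simps power2_eq_square)
    then show ?thesis
      by (rule has_field_derivative_transform_within_open[of _ _ _ "{0<..}"])
         (use 1 in \<open>auto simp: flat_def\<close>)
  next
    case 2
    have "((\<lambda>x. 0) has_real_derivative flat (monom 1 2 * (smult e q - pderiv q)) e x) (at x)"
      using 2 by (simp add: flat_def)
    then show ?thesis
      by (rule has_field_derivative_transform_within_open[of _ _ _ "{..<0}"])
         (use 2 in \<open>auto simp: flat_def\<close>)
  next
    case 3
    have "((\<lambda>h. inverse h * poly q (inverse h) * exp (- e * inverse h)) \<longlongrightarrow> 0) (at_right 0)"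
      using filterlim_compose[OF tendsto_poly_mult_exp[OF assms, of 1 q] filterlim_inverse_at_top_right]
      by simp
    then have r: "((\<lambda>h. flat q e h / h) \<longlongrightarrow> 0) (at_right 0)"
      by (rule Lim_transform_eventually)
         (auto simp: flat_def eventually_at_filter field_simps)
    have l: "((\<lambda>h. flat q e h / h) \<longlongrightarrow> 0) (at_left 0)"
      by (rule tendsto_eventually) (auto simp: flat_def eventually_at_filter)
    have "((\<lambda>h. (flat q e h - flat q e 0) / (h - 0)) \<longlongrightarrow> 0) (at 0)"
      using filterlim_split_at[OF l r] by (simp add: flat_def)
    then show ?thesis using 3 by (simp add: has_field_derivative_iff flat_def)
  qed
qed

text \<open>Kernels \<open>k(z, a)\<close> in a class that is closed under differentiation in \<open>a\<close>, so that the smoothness of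
  \<open>\<integral> k(z, a) \<psi>(z) dz\<close> follows by induction on the order of the derivative. The functions
  \<open>flat q e\<close>, which are closed under differentiation as well, provide the cut-offs.\<close>

inductive smooth_kernel :: "(complex \<Rightarrow> complex \<Rightarrow> real) \<Rightarrow> bool" where
  const: "continuous_on UNIV c \<Longrightarrow> smooth_kernel (\<lambda>z a. c z)"
| linear: "bounded_linear l \<Longrightarrow> smooth_kernel (\<lambda>z a. l a)"
| add: "smooth_kernel k \<Longrightarrow> smooth_kernel m \<Longrightarrow> smooth_kernel (\<lambda>z a. k z a + m z a)"
| mult: "smooth_kernel k \<Longrightarrow> smooth_kernel m \<Longrightarrow> smooth_kernel (\<lambda>z a. k z a * m z a)"
| inverse: "smooth_kernel k \<Longrightarrow> (\<And>z a. k z a > 0) \<Longrightarrow> smooth_kernel (\<lambda>z a. inverse (k z a))"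
| ln: "smooth_kernel k \<Longrightarrow> (\<And>z a. k z a > 0) \<Longrightarrow> smooth_kernel (\<lambda>z a. ln (k z a))"
| flat: "smooth_kernel k \<Longrightarrow> e > 0 \<Longrightarrow> smooth_kernel (\<lambda>z a. flat q e (k z a))"

lemma smooth_kernel_continuous: "smooth_kernel k \<Longrightarrow> continuous_on UNIV (\<lambda>(z, a). k z a)"
proof (induction rule: smooth_kernel.induct)
  case (const c)
  then show ?case
    unfolding split_beta by (rule continuous_on_compose2) (auto intro: continuous_on_fst continuous_on_id)
next
  case (linear l)
  then show ?case
    unfolding split_beta by (rule bounded_linear.continuous_on) (intro continuous_on_snd continuous_on_id)
next
  case (flat k e q)
  have "continuous_on UNIV (flat q e)"
    by (rule DERIV_continuous_on[OF has_field_derivative_at_within[OF flat_has_derivative[OF flat(2)]]])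
  then show ?case
    using continuous_on_compose2[of UNIV "flat q e" UNIV "\<lambda>(z, a). k z a"] flat by (simp add: split_beta)
next
  case (inverse k)
  then show ?case unfolding split_beta by (intro continuous_on_inverse) (auto, metis less_irrefl)
next
  case (ln k)
  then show ?case unfolding split_beta by (intro continuous_on_ln) (auto, metis less_irrefl)
qed (auto simp: split_beta intro: continuous_on_add continuous_on_mult)

lemma smooth_kernel_has_derivative:
  "smooth_kernel k \<Longrightarrow> \<exists>k'. (\<forall>v. smooth_kernel (k' v)) \<and> (\<forall>z a. (k z has_derivative (\<lambda>v. k' v z a)) (at a))"
proof (induction rule: smooth_kernel.induct)
  case (const c)
  then show ?case
    by (intro exI[of _ "\<lambda>v z a. 0"]) (auto intro: smooth_kernel.const)
next
  case (linear l)
  then show ?case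
    by (intro exI[of _ "\<lambda>v z a. l v"]) (auto intro: smooth_kernel.const bounded_linear.has_derivative[OF _ has_derivative_ident, simplified])
next
  case (add k m)
  then obtain k' m' where *: "\<forall>v. smooth_kernel (k' v)" "\<forall>z a. (k z has_derivative (\<lambda>v. k' v z a)) (at a)"
    "\<forall>v. smooth_kernel (m' v)" "\<forall>z a. (m z has_derivative (\<lambda>v. m' v z a)) (at a)" by blast
  then show ?case
    by (intro exI[of _ "\<lambda>v z a. k' v z a + m' v z a"]) (auto intro: smooth_kernel.add has_derivative_add)
next
  case (mult k m)
  then obtain k' m' where *: "\<forall>v. smooth_kernel (k' v)" "\<forall>z a. (k z has_derivative (\<lambda>v. k' v z a)) (at a)"
    "\<forall>v. smooth_kernel (m' v)" "\<forall>z a. (m z has_derivative (\<lambda>v. m' v z a)) (at a)" by blast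
  with mult show ?case
    by (intro exI[of _ "\<lambda>v z a. k z a * m' v z a + k' v z a * m z a"])
       (auto intro!: smooth_kernel.add smooth_kernel.mult has_derivative_mult)
next
  case (inverse k)
  then obtain k' where *: "\<forall>v. smooth_kernel (k' v)" "\<forall>z a. (k z has_derivative (\<lambda>v. k' v z a)) (at a)" by blast
  \<comment> \<open>The sign is written as a factor -1 because the class is generated by sums and
    products.\<close>
  have "((\<lambda>a. inverse (k z a)) has_derivative (\<lambda>v. (- 1) * (inverse (k z a) * k' v z a * inverse (k z a)))) (at a)" for z a
    using * inverse(2)[of z a] by (auto intro!: derivative_eq_intros)
  with inverse * show ?case
    by (intro exI[of _ "\<lambda>v z a. (- 1) * (inverse (k z a) * k' v z a * inverse (k z a))"])
       (intro conjI allI smooth_kernel.mult smooth_kernel.inverse smooth_kernel.const, auto)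
next
  case (ln k)
  then obtain k' where *: "\<forall>v. smooth_kernel (k' v)" "\<forall>z a. (k z has_derivative (\<lambda>v. k' v z a)) (at a)" by blast
  have "((\<lambda>a. ln (k z a)) has_derivative (\<lambda>v. k' v z a * inverse (k z a))) (at a)" for z a
    using * ln(2)[of z a] by (auto intro!: derivative_eq_intros simp: field_simps)
  with ln * show ?case
    by (intro exI[of _ "\<lambda>v z a. k' v z a * inverse (k z a)"])
       (auto intro!: smooth_kernel.mult smooth_kernel.inverse)
next
  case (flat k e q)
  then obtain k' where *: "\<forall>v. smooth_kernel (k' v)" "\<forall>z a. (k z has_derivative (\<lambda>v. k' v z a)) (at a)" by blast
  have "((\<lambda>a. flat q e (k z a)) has_derivative
      (\<lambda>v. flat (monom 1 2 * (smult e q - pderiv q)) e (k z a) * k' v z a)) (at a)" for z a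
    using has_derivative_compose[OF *(2)[rule_format]
        flat_has_derivative[OF flat(2), unfolded has_field_derivative_def]] by (simp add: mult.commute)
  with flat * show ?case
    by (intro exI[of _ "\<lambda>v z a. flat (monom 1 2 * (smult e q - pderiv q)) e (k z a) * k' v z a"])
       (auto intro!: smooth_kernel.mult smooth_kernel.flat)
qed

text \<open>A directional derivative of such an integral is again one, with another kernel of the
  class; hence the induction on the order with \<open>k\<close> arbitrary.\<close>

lemma smooth_kernel_smooth_integral:
  assumes "smooth_kernel k" "Cc \<psi>"
  shows "smooth (\<lambda>a. LBINT z. k z a * \<psi> z)"
  unfolding smooth_def
proof
  fix n show "Ck n (\<lambda>a. LBINT z. k z a * \<psi> z)"
    using assms(1)
  proof (induction n arbitrary: k)
    case 0
    obtain k' where k': "\<forall>v. smooth_kernel (k' v)" "\<forall>z a. (k z has_derivative (\<lambda>v. k' v z a)) (at a)"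
      using smooth_kernel_has_derivative[OF 0] by blast
    have "((\<lambda>a. LBINT z. k z a * \<psi> z) has_derivative (\<lambda>v. LBINT z. k' v z a * \<psi> z)) (at a)" for a
      using has_derivative_integral_param[OF smooth_kernel_continuous smooth_kernel_continuous _ assms(2)] 0 k' by blast
    then show ?case
      by (auto intro!: continuous_at_imp_continuous_on has_derivative_continuous)
  next
    case (Suc n)
    obtain k' where k': "\<forall>v. smooth_kernel (k' v)" "\<forall>z a. (k z has_derivative (\<lambda>v. k' v z a)) (at a)"
      using smooth_kernel_has_derivative[OF Suc(2)] by blast
    have D: "((\<lambda>a. LBINT z. k z a * \<psi> z) has_derivative (\<lambda>v. LBINT z. k' v z a * \<psi> z)) (at a)" for a
      using has_derivative_integral_param[OF smooth_kernel_continuous smooth_kernel_continuous _ assms(2)] Suc k' by blast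
    then show ?case
      using Suc.IH k'(1) by (auto simp: frechet_derivative_eqI[OF D] intro: differentiableI)
  qed
qed

text \<open>Applied to kernels that ignore z, this is how explicit functions (constants, bumps,
  \<open>reg_log\<close>) are shown to be smooth.\<close>

lemma smooth_kernel_smooth:
  assumes "smooth_kernel k"
  shows "smooth (k z)"
  unfolding smooth_def
proof
  fix n show "Ck n (k z)"
    using assms
  proof (induction n arbitrary: k)
    case 0
    have "continuous_on UNIV (\<lambda>a. (z, a))" by (intro continuous_intros)
    from continuous_on_compose2[OF smooth_kernel_continuous[OF 0] this] show ?case by simp
  next
    case (Suc n)
    obtain k' where k': "\<forall>v. smooth_kernel (k' v)" "\<forall>z a. (k z has_derivative (\<lambda>v. k' v z a)) (at a)"
      using smooth_kernel_has_derivative[OF Suc(2)] by blast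
    then have D: "(k z has_derivative (\<lambda>v. k' v z a)) (at a)" for a by blast
    show ?case
      using Suc.IH k'(1) D by (auto simp: frechet_derivative_eqI[OF D] intro: differentiableI)
  qed
qed


section \<open>Integration by parts and the regularised logarithm\<close>

lemma smooth_has_derivative:
  assumes "smooth u"
  shows "(u has_derivative frechet_derivative u (at z)) (at z)"
proof -
  have "Ck (Suc 0) u" using assms unfolding smooth_def ..
  then show ?thesis by (simp add: frechet_derivative_works)
qed

lemma smooth_frechet_derivative:
  assumes "smooth u"
  shows "smooth (\<lambda>z. frechet_derivative u (at z) v)"
  unfolding smooth_def
proof
  fix k
  have "Ck (Suc k) u" using assms unfolding smooth_def ..
  then show "Ck k (\<lambda>z. frechet_derivative u (at z) v)" by simp
qed

lemma smooth_continuous: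
  assumes "smooth u"
  shows "continuous_on UNIV u"
proof -
  have "Ck 0 u" using assms unfolding smooth_def ..
  then show ?thesis by simp
qed

lemma smooth_laplacian_continuous: "smooth u \<Longrightarrow> continuous_on UNIV (laplacian u)"
  unfolding laplacian_def
  by (intro continuous_on_sum smooth_continuous smooth_frechet_derivative)

lemma has_derivative_outside_support:
  fixes F :: "complex \<Rightarrow> real"
  assumes "\<And>z. R < norm z \<Longrightarrow> F z = 0" "R < norm z"
  shows "(F has_derivative (\<lambda>_. 0)) (at z)"
proof -
  have "open {z::complex. R < norm z}" by (intro open_Collect_less continuous_intros)
  then show ?thesis
    using assms by (intro has_derivative_transform_within_open[OF has_derivative_const[of 0]]) auto
qed

lemma Cc_frechet_derivative:
  assumes "smooth u" "Cc u"
  shows "Cc (\<lambda>z. frechet_derivative u (at z) v)"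
proof -
  obtain R where R: "\<And>z. R < norm z \<Longrightarrow> u z = 0" using assms by (auto simp: Cc_def)
  have "frechet_derivative u (at z) v = 0" if "R < norm z" for z
    using has_derivative_outside_support[where F = u, OF R that] by (simp add: frechet_derivative_eqI)
  then show ?thesis
    using smooth_continuous[OF smooth_frechet_derivative[OF assms(1)]] by (auto simp: Cc_def)
qed

lemma Cc_laplacian:
  assumes "smooth u" "Cc u"
  shows "Cc (laplacian u)"
proof -
  have "Cc (\<lambda>z. frechet_derivative (\<lambda>w. frechet_derivative u (at w) b) (at z) b)" for b
    using assms by (intro Cc_frechet_derivative smooth_frechet_derivative)
  then obtain R where "\<And>b z. R b < norm z \<Longrightarrow> frechet_derivative (\<lambda>w. frechet_derivative u (at w) b) (at z) b = 0"
    unfolding Cc_def by metis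
  then have "laplacian u z = 0" if "max (R 1) (R \<i>) < norm z" for z
    using that by (simp add: laplacian_def Basis_complex_def)
  with smooth_laplacian_continuous[OF assms(1)] show ?thesis unfolding Cc_def by blast
qed

lemma Cc_ddc: "smooth u \<Longrightarrow> Cc u \<Longrightarrow> Cc (ddc u)"
  using Cc_mult[OF Cc_laplacian, of u "\<lambda>z. 1 / (2 * pi)"] by (simp add: ddc_def[abs_def])

lemma integral_lborel_shift:
  fixes F :: "complex \<Rightarrow> real"
  assumes "F \<in> borel_measurable borel"
  shows "(LBINT z. F (z + c)) = (LBINT z. F z)"
proof -
  have "(LBINT z. F z) = (\<integral>z. F z \<partial>distr lborel borel ((+) c))"
    by (simp add: lborel_distr_plus)
  also have "\<dots> = (LBINT z. F (c + z))"
    by (subst integral_distr) (use assms in auto)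
  finally show ?thesis by (simp add: add.commute)
qed

text \<open>By translation invariance every difference quotient of \<open>F\<close> in direction
  \<open>v\<close> has integral 0, and dominated convergence passes this on to the
  derivative.\<close>

lemma integral_directional_derivative_eq_0:
  fixes F :: "complex \<Rightarrow> real"
  assumes F: "Cc F" and D: "\<And>z. (F has_derivative D z) (at z)" and c: "continuous_on UNIV (\<lambda>z. D z v)"
  shows "(LBINT z. D z v) = 0"
proof -
  obtain R where R: "\<And>z. R < norm z \<Longrightarrow> F z = 0" using F by (auto simp: Cc_def)
  have "D z v = 0" if "R < norm z" for z
    using has_derivative_unique[OF D has_derivative_outside_support[where F = F, OF R that]] by simp
  with c have "Cc (\<lambda>z. D z v)" by (auto simp: Cc_def)
  then obtain B where B: "B \<ge> 0" "\<And>z. \<bar>D z v\<bar> \<le> B" using Cc_bounded by blast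
  have line: "((\<lambda>s. F (z + of_real s * v)) has_real_derivative D (z + of_real s * v) v) (at s)" for z s
  proof -
    have "((\<lambda>s. z + of_real s * v) has_derivative (\<lambda>h. of_real h * v)) (at s)"
      by (auto intro!: derivative_eq_intros)
    moreover have "D (z + of_real s * v) (of_real h * v) = D (z + of_real s * v) v * h" for h
      using linear_cmul[OF has_derivative_linear[OF D], of "z + of_real s * v" h v]
      by (simp add: scaleR_conv_of_real)
    ultimately show ?thesis
      using has_derivative_compose[OF _ D] by (fastforce simp: has_field_derivative_def)
  qed
  \<comment> \<open>Steps of size at most 1 keep the supports of all quotients in the ball of radius
    R + norm v, where the mean value theorem bounds them by \<open>B\<close>.\<close>
  define t :: "nat \<Rightarrow> real" where "t n = 1 / real (Suc n)" for n
  have t: "0 < t n" "t n \<le> 1" for n by (auto simp: t_def)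
  define s where "s n z = (F (z + of_real (t n) * v) - F z) / t n" for n z
  have meas: "F \<in> borel_measurable borel"
    using F by (auto simp: Cc_def intro: borel_measurable_continuous_onI)
  have "(\<lambda>n. LBINT z. s n z) \<longlonglongrightarrow> (LBINT z. D z v)"
  proof (rule integral_dominated_convergence[where w = "\<lambda>z. indicator (cball 0 (R + norm v)) z *\<^sub>R B"])
    show "(\<lambda>z. D z v) \<in> borel_measurable lborel"
      using borel_measurable_continuous_onI[OF c] by simp
    show "s n \<in> borel_measurable lborel" for n
      unfolding s_def using meas by measurable
    show "integrable lborel (\<lambda>z. indicator (cball 0 (R + norm v)) z *\<^sub>R B)"
      by (intro borel_integrable_compact) auto
    show "AE z in lborel. (\<lambda>n. s n z) \<longlonglongrightarrow> D z v"
    proof (rule AE_I2)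
      fix z
      have "((\<lambda>h. (F (z + of_real h * v) - F z) / h) \<longlongrightarrow> D z v) (at 0)"
        using line[of z 0] by (simp add: has_field_derivative_iff)
      moreover have "t \<longlonglongrightarrow> 0"
        using LIMSEQ_inverse_real_of_nat by (simp add: t_def[abs_def] inverse_eq_divide)
      then have "filterlim t (at 0) sequentially"
        unfolding filterlim_at using t(1) by (auto intro!: always_eventually) (metis less_irrefl)
      ultimately show "(\<lambda>n. s n z) \<longlonglongrightarrow> D z v"
        unfolding s_def by (rule filterlim_compose[where f = t and g = "\<lambda>h. (F (z + of_real h * v) - F z) / h"])
    qed
    show "AE z in lborel. norm (s n z) \<le> indicator (cball 0 (R + norm v)) z *\<^sub>R B" for n
    proof (rule AE_I2)
      fix z
      show "norm (s n z) \<le> indicator (cball 0 (R + norm v)) z *\<^sub>R B"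
      proof (cases "norm z \<le> R + norm v")
        case True
        obtain x where "F (z + of_real (t n) * v) - F (z + of_real 0 * v) = (t n - 0) * D (z + of_real x * v) v"
          using MVT2[OF t(1)[of n], of "\<lambda>s. F (z + of_real s * v)" "\<lambda>s. D (z + of_real s * v) v"] line
          by meson
        then have "s n z = D (z + of_real x * v) v" using t[of n] by (simp add: s_def)
        with B True show ?thesis by simp
      next
        case False
        have "norm z - norm (of_real (t n) * v) \<le> norm (z + of_real (t n) * v)"
          by (metis diff_minus_eq_add norm_minus_cancel norm_triangle_ineq2)
        moreover have "norm (of_real (t n) * v) \<le> norm v"
          using t[of n] by (simp add: norm_mult mult_left_le_one_le)
        ultimately have "R < norm (z + of_real (t n) * v)" "R < norm z"
          using False norm_ge_zero[of v] by linarith+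
        then show ?thesis using R B by (simp add: s_def)
      qed
    qed
  qed
  moreover have "(LBINT z. s n z) = 0" for n
  proof -
    have i: "integrable lborel F" by (rule Cc_integrable[OF F])
    have F': "Cc (\<lambda>z. F (z + c))" for c :: complex
      using F R unfolding Cc_def
    proof (intro conjI exI[of _ "R + norm c"] allI impI)
      show "continuous_on UNIV (\<lambda>z. F (z + c))"
        using F by (auto simp: Cc_def intro!: continuous_on_compose2[of UNIV F] continuous_intros)
      fix z :: complex assume "R + norm c < norm z"
      moreover have "norm z - norm c \<le> norm (z + c)"
        by (metis diff_minus_eq_add norm_minus_cancel norm_triangle_ineq2)
      ultimately show "F (z + c) = 0" using R by simp
    qed
    show ?thesis
      unfolding s_def using Cc_integrable[OF F'] i by (simp add: integral_lborel_shift[OF meas])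
  qed
  ultimately show ?thesis using LIMSEQ_unique[OF _ tendsto_const] by fastforce
qed

text \<open>Green's second identity without boundary term: in each basis direction b, the difference
  of the two integrands is the b-derivative of the compactly supported function \<open>F\<close>
  below.\<close>

lemma integral_laplacian_by_parts:
  assumes G: "smooth G" and u: "smooth u" "Cc u"
  shows "(LBINT z. G z * laplacian u z) = (LBINT z. laplacian G z * u z)"
proof -
  let ?D = "\<lambda>u z. frechet_derivative u (at z)"
  have cont: "continuous_on UNIV g" if "smooth g" for g using smooth_continuous[OF that] .
  have i1: "integrable lborel (\<lambda>z. G z * ?D (\<lambda>w. ?D u w b) z b)" for b
    by (intro Cc_integrable Cc_mult Cc_frechet_derivative smooth_frechet_derivative cont assms)
  have i2: "integrable lborel (\<lambda>z. ?D (\<lambda>w. ?D G w b) z b * u z)" for b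
    by (intro Cc_integrable Cc_mult smooth_frechet_derivative cont assms)
  have eq: "(LBINT z. G z * ?D (\<lambda>w. ?D u w b) z b) = (LBINT z. ?D (\<lambda>w. ?D G w b) z b * u z)" for b
  proof -
    define F where "F z = G z * ?D u z b - ?D G z b * u z" for z
    define DF where "DF z v = (G z * ?D (\<lambda>w. ?D u w b) z v + ?D G z v * ?D u z b)
        - (?D G z b * ?D u z v + ?D (\<lambda>w. ?D G w b) z v * u z)" for z v
    have "(F has_derivative DF z) (at z)" for z
      unfolding F_def DF_def
      by (intro has_derivative_diff has_derivative_mult smooth_has_derivative smooth_frechet_derivative assms)
    moreover have "Cc F"
    proof -
      obtain R1 where R1: "\<And>z. R1 < norm z \<Longrightarrow> u z = 0" using u by (auto simp: Cc_def)
      obtain R2 where R2: "\<And>z. R2 < norm z \<Longrightarrow> ?D u z b = 0"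
        using Cc_frechet_derivative[OF u, of b] by (auto simp: Cc_def)
      have "continuous_on UNIV F" unfolding F_def
        by (intro continuous_intros cont smooth_frechet_derivative assms)
      then show ?thesis unfolding Cc_def using R1 R2
        by (intro conjI exI[of _ "max R1 R2"]) (auto simp: F_def)
    qed
    moreover have "continuous_on UNIV (\<lambda>z. DF z b)" unfolding DF_def
      by (intro continuous_intros cont smooth_frechet_derivative assms)
    ultimately have "(LBINT z. DF z b) = 0" by (intro integral_directional_derivative_eq_0)
    moreover have "DF z b = G z * ?D (\<lambda>w. ?D u w b) z b - ?D (\<lambda>w. ?D G w b) z b * u z" for z
      by (simp add: DF_def)
    ultimately show ?thesis using i1 i2 by simp
  qed
  show ?thesis
    unfolding laplacian_def sum_distrib_left sum_distrib_right using i1 i2 eq by simp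
qed

section \<open>The regularised logarithm, its derivatives and its kernels\<close>

definition reg_log :: "real \<Rightarrow> complex \<Rightarrow> real" where
  "reg_log e w = ln ((norm w)\<^sup>2 + e\<^sup>2) / 2"

text \<open>The density of dd^c of \<open>reg_log e\<close>: the Fubini-Study density for
  \<open>e = 1\<close> and its dilation by the factor e in general, hence always of mass one and
  concentrating at 0 as e -> 0.\<close>

definition fs_density :: "real \<Rightarrow> complex \<Rightarrow> real" where
  "fs_density e w = e\<^sup>2 / (pi * ((norm w)\<^sup>2 + e\<^sup>2)\<^sup>2)"

lemma norm2_inner: "(norm (w::complex))\<^sup>2 = w \<bullet> w" by (simp add: dot_square_norm)

lemma smooth_kernel_const: "smooth_kernel (\<lambda>z a. c)" by (rule smooth_kernel.const) simp

lemma smooth_kernel_diff: "smooth_kernel k \<Longrightarrow> smooth_kernel m \<Longrightarrow> smooth_kernel (\<lambda>z a. k z a - m z a)"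
  using smooth_kernel.add[OF _ smooth_kernel.mult[OF smooth_kernel_const[of "-1"]], of k m] by simp

lemma smooth_kernel_power2: "smooth_kernel k \<Longrightarrow> smooth_kernel (\<lambda>z a. (k z a)\<^sup>2)"
  unfolding power2_eq_square by (rule smooth_kernel.mult)

lemmas smooth_kernel_intros = smooth_kernel_const smooth_kernel.const smooth_kernel.add smooth_kernel.mult smooth_kernel_diff smooth_kernel_power2
  smooth_kernel.linear[OF bounded_linear_Re] smooth_kernel.linear[OF bounded_linear_Im]

context
  fixes e :: real assumes e: "e > 0"
begin

lemma norm2_add_pos: "(norm (w::complex))\<^sup>2 + e\<^sup>2 > 0"
  using e by (simp add: add_nonneg_pos)

definition reg_log_deriv :: "complex \<Rightarrow> complex \<Rightarrow> real" where
  "reg_log_deriv w v = (w \<bullet> v) * inverse ((norm w)\<^sup>2 + e\<^sup>2)"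

definition reg_log_deriv2 :: "complex \<Rightarrow> complex \<Rightarrow> complex \<Rightarrow> real" where
  "reg_log_deriv2 w b v = (v \<bullet> b) * inverse ((norm w)\<^sup>2 + e\<^sup>2)
     - 2 * (w \<bullet> b) * (w \<bullet> v) * (inverse ((norm w)\<^sup>2 + e\<^sup>2))\<^sup>2"

lemma reg_log_has_derivative:
  "((\<lambda>a. reg_log e (a - c)) has_derivative reg_log_deriv (a - c)) (at a)"
proof -
  have "(a - c) \<bullet> (a - c) + e\<^sup>2 > 0" using norm2_add_pos[of "a - c"] by (simp add: norm2_inner)
  then show ?thesis
    unfolding reg_log_def reg_log_deriv_def[abs_def] norm2_inner
    by (auto intro!: derivative_eq_intros simp: inner_commute field_simps fun_eq_iff)
qed

lemma reg_log_deriv_has_derivative: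
  "((\<lambda>a. reg_log_deriv (a - c) b) has_derivative reg_log_deriv2 (a - c) b) (at a)"
proof -
  have "(a - c) \<bullet> (a - c) + e\<^sup>2 > 0" using norm2_add_pos[of "a - c"] by (simp add: norm2_inner)
  then show ?thesis
    unfolding reg_log_deriv_def reg_log_deriv2_def[abs_def] norm2_inner
    by (auto intro!: derivative_eq_intros simp: inner_commute algebra_simps fun_eq_iff power2_eq_square)
qed

lemma sum_reg_log_deriv2: "(\<Sum>b\<in>Basis. reg_log_deriv2 w b b) = 2 * pi * fs_density e w"
proof -
  define Q where "Q = (norm w)\<^sup>2 + e\<^sup>2"
  have Q: "Q > 0" using norm2_add_pos by (simp add: Q_def)
  have "(\<Sum>b\<in>Basis. reg_log_deriv2 w b b) = 2 * inverse Q - 2 * (norm w)\<^sup>2 * (inverse Q)\<^sup>2"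
    unfolding reg_log_deriv2_def Basis_complex_def Q_def[symmetric] cmod_power2[of w, symmetric]
    unfolding cmod_power2[of w] by (simp add: inner_complex_def algebra_simps power2_eq_square)
  also have "\<dots> = (2 * Q - 2 * (norm w)\<^sup>2) / Q\<^sup>2"
    using Q by (simp add: field_simps power2_eq_square)
  also have "\<dots> = 2 * pi * fs_density e w"
    unfolding fs_density_def Q_def[symmetric] using Q by (simp add: Q_def)
  finally show ?thesis .
qed

lemma reg_log_continuous: "continuous_on S g \<Longrightarrow> continuous_on S (\<lambda>x. reg_log e (g x))"
  unfolding reg_log_def using e by (intro continuous_intros) auto

lemma reg_log_deriv_continuous: "continuous_on S g \<Longrightarrow> continuous_on S (\<lambda>x. reg_log_deriv (g x) v)"
  unfolding reg_log_deriv_def using e by (intro continuous_intros) auto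

lemma reg_log_deriv2_continuous: "continuous_on S g \<Longrightarrow> continuous_on S (\<lambda>x. reg_log_deriv2 (g x) b v)"
  unfolding reg_log_deriv2_def using e by (intro continuous_intros) auto

lemma fs_density_continuous: "continuous_on S g \<Longrightarrow> continuous_on S (\<lambda>x. fs_density e (g x))"
  unfolding fs_density_def using e by (intro continuous_intros) auto

lemma laplacian_reg_log: "laplacian (\<lambda>z. reg_log e (z - c)) z = 2 * pi * fs_density e (z - c)"
  unfolding laplacian_def
  by (simp add: frechet_derivative_eqI[OF reg_log_has_derivative]
      frechet_derivative_eqI[OF reg_log_deriv_has_derivative] sum_reg_log_deriv2)

text \<open>Two differentiations under the integral sign. They use the explicit derivatives above,
  since \<open>smooth_kernel_has_derivative\<close> only asserts that some derivative kernel
  exists.\<close>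

lemma ddc_integral_reg_log:
  assumes h: "continuous_on UNIV h" and \<psi>: "Cc \<psi>"
  shows "ddc (\<lambda>a. LBINT z. reg_log e (a - h z) * \<psi> z) a = (LBINT z. fs_density e (a - h z) * \<psi> z)"
proof -
  have c: "continuous_on UNIV (\<lambda>(z, a). a - h z)"
    unfolding split_beta using continuous_on_compose2[OF h continuous_on_fst[OF continuous_on_id]]
    by (intro continuous_intros) auto
  have D1: "((\<lambda>a. LBINT z. reg_log e (a - h z) * \<psi> z) has_derivative
      (\<lambda>v. LBINT z. reg_log_deriv (a - h z) v * \<psi> z)) (at a)" for a
    using reg_log_continuous[OF c] reg_log_deriv_continuous[OF c]
    by (intro has_derivative_integral_param[OF _ _ reg_log_has_derivative \<psi>]) (simp_all add: split_beta)
  have D2: "((\<lambda>a. LBINT z. reg_log_deriv (a - h z) b * \<psi> z) has_derivative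
      (\<lambda>v. LBINT z. reg_log_deriv2 (a - h z) b v * \<psi> z)) (at a)" for a b
    using reg_log_deriv2_continuous[OF c] reg_log_deriv_continuous[OF c]
    by (intro has_derivative_integral_param[OF _ _ reg_log_deriv_has_derivative \<psi>]) (simp_all add: split_beta)
  have ah: "continuous_on UNIV (\<lambda>z. a - h z)" using h by (intro continuous_intros)
  have "integrable lborel (\<lambda>z. reg_log_deriv2 (a - h z) b v * \<psi> z)" for b v
    by (intro Cc_integrable Cc_mult[OF \<psi>] reg_log_deriv2_continuous ah)
  then have "(\<Sum>b\<in>Basis. LBINT z. reg_log_deriv2 (a - h z) b b * \<psi> z)
      = (LBINT z. 2 * pi * (fs_density e (a - h z) * \<psi> z))"
    by (subst Bochner_Integration.integral_sum[symmetric])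
       (auto simp: sum_distrib_right[symmetric] sum_reg_log_deriv2 mult.assoc)
  then show ?thesis
    unfolding ddc_def laplacian_def
    by (simp add: frechet_derivative_eqI[OF D1] frechet_derivative_eqI[OF D2])
qed

lemma smooth_kernel_reg_log:
  assumes "continuous_on UNIV h"
  shows "smooth_kernel (\<lambda>z a. reg_log e (a - h z))"
proof -
  have "smooth_kernel (\<lambda>z a. (norm (a - h z))\<^sup>2 + e\<^sup>2)"
    unfolding cmod_power2 minus_complex.sel
    by (intro smooth_kernel_intros continuous_intros assms)
  from smooth_kernel.mult[OF smooth_kernel.ln[OF this norm2_add_pos] smooth_kernel_const[of "1/2"]] show ?thesis
    by (simp add: reg_log_def)
qed

text \<open>The regularised kernel in the chart b = 1/a, multiplied inside the logarithm by |b|^2 to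
  remove the pole. The argument stays positive: at b = 0 the first square equals 1, elsewhere the
  second summand is positive.\<close>

lemma smooth_kernel_reg_log_infinity:
  assumes "continuous_on UNIV h"
  shows "smooth_kernel (\<lambda>z b. ln ((norm (h z * b - 1))\<^sup>2 + e\<^sup>2 * (norm b)\<^sup>2) / 2)"
proof -
  have "smooth_kernel (\<lambda>z b. (norm (h z * b - 1))\<^sup>2 + e\<^sup>2 * (norm b)\<^sup>2)"
    unfolding cmod_power2 minus_complex.sel times_complex.sel one_complex.sel
    by (intro smooth_kernel_intros continuous_intros assms)
  moreover have "(norm (h z * b - 1))\<^sup>2 + e\<^sup>2 * (norm b)\<^sup>2 > 0" for z b
    using e by (cases "b = 0") (auto simp: add_nonneg_pos)
  ultimately have "smooth_kernel (\<lambda>z b. ln ((norm (h z * b - 1))\<^sup>2 + e\<^sup>2 * (norm b)\<^sup>2))" by (rule smooth_kernel.ln)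
  from smooth_kernel.mult[OF this smooth_kernel_const[of "1/2"]] show ?thesis by simp
qed

end


section \<open>The total mass of the Fubini--Study density\<close>

lemma measurable_Complex: "(\<lambda>(x, y). Complex x y) \<in> (lborel \<Otimes>\<^sub>M lborel) \<rightarrow>\<^sub>M borel"
proof -
  have "continuous_on UNIV (\<lambda>p. Complex (fst p) (snd p))" by (intro continuous_intros)
  from borel_measurable_continuous_onI[OF this] show ?thesis by (simp add: split_beta lborel_prod)
qed

lemma lborel_complex: "(lborel :: complex measure) = distr (lborel \<Otimes>\<^sub>M lborel) borel (\<lambda>(x, y). Complex x y)"
proof (rule lborel_eqI)
  fix l u :: complex assume le: "\<And>b. b \<in> Basis \<Longrightarrow> l \<bullet> b \<le> u \<bullet> b"
  have "(\<lambda>(x, y). Complex x y) -` box l u = {Re l<..<Re u} \<times> {Im l<..<Im u}"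
    by (auto simp: in_box_complex_iff)
  then show "emeasure (distr (lborel \<Otimes>\<^sub>M lborel) borel (\<lambda>(x, y). Complex x y)) (box l u)
      = ennreal (\<Prod>b\<in>Basis. (u - l) \<bullet> b)"
    using le[of 1] le[of \<i>] measurable_Complex
    by (simp add: emeasure_distr lborel.emeasure_pair_measure_Times Basis_complex_def
        space_pair_measure ennreal_mult inner_complex_def)
qed simp

lemma nn_integral_lborel_complex:
  assumes [measurable]: "f \<in> borel_measurable borel"
  shows "(\<integral>\<^sup>+z. f z \<partial>lborel) = (\<integral>\<^sup>+x. \<integral>\<^sup>+y. f (Complex x y) \<partial>lborel \<partial>lborel)"
proof -
  note m [measurable] = measurable_Complex
  have "(\<integral>\<^sup>+z. f z \<partial>lborel) = (\<integral>\<^sup>+p. f (Complex (fst p) (snd p)) \<partial>(lborel \<Otimes>\<^sub>M lborel))"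
    by (subst lborel_complex, subst nn_integral_distr) (auto simp: split_beta)
  also have "\<dots> = (\<integral>\<^sup>+x. \<integral>\<^sup>+y. f (Complex x y) \<partial>lborel \<partial>lborel)"
    using m measurable_compose[OF m assms]
    by (subst lborel.nn_integral_fst[symmetric]) (auto simp: split_beta)
  finally show ?thesis .
qed

lemma nn_integral_FTC_UNIV:
  fixes F f :: "real \<Rightarrow> real"
  assumes "\<And>x. (F has_real_derivative f x) (at x)" "\<And>x. isCont f x" "\<And>x. 0 \<le> f x"
    and "(F \<longlongrightarrow> A) at_bot" "(F \<longlongrightarrow> B) at_top"
  shows "(\<integral>\<^sup>+x. ennreal (f x) \<partial>lborel) = ennreal (B - A)"
proof -
  have s: "set_integrable lborel (einterval (-\<infinity>) \<infinity>) f" "(LBINT x=-\<infinity>..\<infinity>. f x) = B - A"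
    by (rule interval_integral_FTC_nonneg[of _ _ F f A B]; use assms in \<open>simp add: ereal_tendsto_simps\<close>)+
  have "einterval (-\<infinity>) \<infinity> = UNIV" by (auto simp: einterval_def)
  with s have "integrable lborel f" "(LBINT x. f x) = B - A"
    by (simp_all add: set_integrable_def interval_lebesgue_integral_def set_lebesgue_integral_def)
  then show ?thesis using nn_integral_eq_integral[of lborel f] assms(3) by simp
qed

text \<open>Iterated integration in Cartesian coordinates, with an explicit antiderivative for each
  variable.\<close>

lemma nn_integral_fs_density:
  assumes "e > 0"
  shows "(\<integral>\<^sup>+z. ennreal (fs_density e z) \<partial>lborel) = 1"
proof -
  have m: "(\<lambda>z. ennreal (fs_density e z)) \<in> borel_measurable borel"
    by (intro measurable_compose[OF _ measurable_ennreal] borel_measurable_continuous_onI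
        fs_density_continuous[OF assms] continuous_on_id)
  have inner: "(\<integral>\<^sup>+y. ennreal (fs_density e (Complex x y)) \<partial>lborel)
      = ennreal (e\<^sup>2 / (2 * (x\<^sup>2 + e\<^sup>2) * sqrt (x\<^sup>2 + e\<^sup>2)))" for x
  proof -
    define A where "A = sqrt (x\<^sup>2 + e\<^sup>2)"
    have "x\<^sup>2 + e\<^sup>2 > 0" using assms by (simp add: add_nonneg_pos)
    then have A: "A > 0" "A\<^sup>2 = x\<^sup>2 + e\<^sup>2" by (simp_all add: A_def)
    have pos: "y\<^sup>2 + A\<^sup>2 > 0" for y using A(1) by (simp add: add_nonneg_pos)
    \<comment> \<open>The textbook antiderivative of 1/(y^2 + A^2)^2, where A collects x and e. Only
      the arctan term contributes to the limits at infinity.\<close>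
    define F where "F y = e\<^sup>2 / pi * (y / (2 * A\<^sup>2 * (y\<^sup>2 + A\<^sup>2)) + arctan (y / A) / (2 * A ^ 3))" for y
    have "(\<integral>\<^sup>+y. ennreal (e\<^sup>2 / (pi * (y\<^sup>2 + A\<^sup>2)\<^sup>2)) \<partial>lborel)
        = ennreal (e\<^sup>2 / (4 * A ^ 3) - (- (e\<^sup>2 / (4 * A ^ 3))))"
    proof (rule nn_integral_FTC_UNIV[of F])
      fix y
      have *: "((\<lambda>y. arctan (y / A)) has_real_derivative A / (y\<^sup>2 + A\<^sup>2)) (at y)"
        using A(1) pos[of y] by (auto intro!: derivative_eq_intros simp: field_simps power2_eq_square)
      have **: "((\<lambda>y. y / (2 * A\<^sup>2 * (y\<^sup>2 + A\<^sup>2))) has_real_derivative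
          (A\<^sup>2 - y\<^sup>2) / (2 * A\<^sup>2 * (y\<^sup>2 + A\<^sup>2)\<^sup>2)) (at y)"
        using A(1) less_imp_neq[OF pos[of y]]
        by (auto intro!: derivative_eq_intros simp: divide_simps) (simp add: algebra_simps power2_eq_square)
      define Q where "Q = y\<^sup>2 + A\<^sup>2"
      have Q: "Q > 0" "y\<^sup>2 = Q - A\<^sup>2" using pos by (simp_all add: Q_def)
      have "e\<^sup>2 / pi * ((A\<^sup>2 - y\<^sup>2) / (2 * A\<^sup>2 * Q\<^sup>2) + A / Q / (2 * A ^ 3)) = e\<^sup>2 / (pi * Q\<^sup>2)"
        unfolding Q(2) using A(1) Q(1) by (simp add: field_simps power2_eq_square power3_eq_cube)
      moreover have "(F has_real_derivative e\<^sup>2 / pi * ((A\<^sup>2 - y\<^sup>2) / (2 * A\<^sup>2 * (y\<^sup>2 + A\<^sup>2)\<^sup>2)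
          + A / (y\<^sup>2 + A\<^sup>2) / (2 * A ^ 3))) (at y)"
        unfolding F_def by (rule DERIV_cmult[OF DERIV_add[OF ** DERIV_cdivide[OF *]]])
      ultimately show "(F has_real_derivative e\<^sup>2 / (pi * (y\<^sup>2 + A\<^sup>2)\<^sup>2)) (at y)"
        unfolding Q_def by (simp only:)
      show "isCont (\<lambda>y. e\<^sup>2 / (pi * (y\<^sup>2 + A\<^sup>2)\<^sup>2)) y"
        using less_imp_neq[OF pos[of y]] by (intro continuous_intros) auto
      show "0 \<le> e\<^sup>2 / (pi * (y\<^sup>2 + A\<^sup>2)\<^sup>2)" by simp
    next
      show "(F \<longlongrightarrow> e\<^sup>2 / (4 * A ^ 3)) at_top" "(F \<longlongrightarrow> - (e\<^sup>2 / (4 * A ^ 3))) at_bot"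
        unfolding F_def using A(1) by (real_asymp simp: field_simps)+
    qed
    moreover have "fs_density e (Complex x y) = e\<^sup>2 / (pi * (y\<^sup>2 + A\<^sup>2)\<^sup>2)" for y
      unfolding fs_density_def A(2) by (simp add: cmod_power2 algebra_simps)
    moreover have "e\<^sup>2 / (4 * A ^ 3) - (- (e\<^sup>2 / (4 * A ^ 3))) = e\<^sup>2 / (2 * (x\<^sup>2 + e\<^sup>2) * A)"
      unfolding A(2)[symmetric] using A(1) by (simp add: field_simps power2_eq_square power3_eq_cube)
    ultimately show ?thesis unfolding A_def by simp
  qed
  have "(\<integral>\<^sup>+x. ennreal (e\<^sup>2 / (2 * (x\<^sup>2 + e\<^sup>2) * sqrt (x\<^sup>2 + e\<^sup>2))) \<partial>lborel) = ennreal (1 / 2 - (- (1 / 2)))"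
  proof (rule nn_integral_FTC_UNIV[of "\<lambda>x. x / (2 * sqrt (x\<^sup>2 + e\<^sup>2))"])
    fix x :: real
    have pos: "x\<^sup>2 + e\<^sup>2 > 0" using assms by (simp add: add_nonneg_pos)
    define s where "s = sqrt (x\<^sup>2 + e\<^sup>2)"
    have s: "s > 0" "x\<^sup>2 + e\<^sup>2 = s\<^sup>2" using pos by (simp_all add: s_def)
    have "((\<lambda>x. sqrt (x\<^sup>2 + e\<^sup>2)) has_real_derivative x / s) (at x)"
      using pos s by (auto intro!: derivative_eq_intros simp: s_def field_simps)
    then have "((\<lambda>x. x / (2 * sqrt (x\<^sup>2 + e\<^sup>2))) has_real_derivative (1 * (2 * s) - x * (2 * (x / s))) / (2 * s * (2 * s))) (at x)"
      using s(1) unfolding s_def by (intro DERIV_divide DERIV_cmult DERIV_ident) auto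
    moreover have "(1 * (2 * s) - x * (2 * (x / s))) / (2 * s * (2 * s)) = (s\<^sup>2 - x\<^sup>2) / (2 * s\<^sup>2 * s)"
      using s(1) by (simp add: field_simps power2_eq_square)
    moreover have "(s\<^sup>2 - x\<^sup>2) / (2 * s\<^sup>2 * s) = e\<^sup>2 / (2 * (x\<^sup>2 + e\<^sup>2) * sqrt (x\<^sup>2 + e\<^sup>2))"
      unfolding s(2)[symmetric] s_def[symmetric] by simp
    ultimately show "((\<lambda>x. x / (2 * sqrt (x\<^sup>2 + e\<^sup>2))) has_real_derivative
        e\<^sup>2 / (2 * (x\<^sup>2 + e\<^sup>2) * sqrt (x\<^sup>2 + e\<^sup>2))) (at x)"
      by (simp only:)
    show "isCont (\<lambda>x. e\<^sup>2 / (2 * (x\<^sup>2 + e\<^sup>2) * sqrt (x\<^sup>2 + e\<^sup>2))) x"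
      using pos by (intro continuous_intros) auto
    show "0 \<le> e\<^sup>2 / (2 * (x\<^sup>2 + e\<^sup>2) * sqrt (x\<^sup>2 + e\<^sup>2))" by simp
  next
    show "((\<lambda>x. x / (2 * sqrt (x\<^sup>2 + e\<^sup>2))) \<longlongrightarrow> 1 / 2) at_top"
      "((\<lambda>x. x / (2 * sqrt (x\<^sup>2 + e\<^sup>2))) \<longlongrightarrow> - (1 / 2)) at_bot"
      by real_asymp+
  qed
  then show ?thesis by (simp add: nn_integral_lborel_complex[OF m] inner)
qed

lemma fs_density_nonneg: "fs_density e z \<ge> 0"
  by (simp add: fs_density_def)

lemma integrable_fs_density: "e > 0 \<Longrightarrow> integrable lborel (fs_density e)"
  and integral_fs_density: "e > 0 \<Longrightarrow> (LBINT z. fs_density e z) = 1"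
proof -
  assume e: "e > 0"
  have m: "fs_density e \<in> borel_measurable lborel"
    using borel_measurable_continuous_onI[OF fs_density_continuous[OF e continuous_on_id]] by simp
  show "integrable lborel (fs_density e)"
    using nn_integral_fs_density[OF e] m by (intro integrableI_nonneg) (auto simp: fs_density_nonneg)
  show "(LBINT z. fs_density e z) = 1"
    using nn_integral_fs_density[OF e] m
    by (subst integral_eq_nn_integral) (auto simp: fs_density_nonneg)
qed


section \<open>The logarithm as fundamental solution\<close>

definition log_plus :: "complex \<Rightarrow> real" where
  "log_plus w = ln (max 1 (norm w))"

definition log_minus :: "complex \<Rightarrow> real" where
  "log_minus w = max 0 (- ln (norm w))"

text \<open>Since \<^term>\<open>ln (0::real) = 0\<close>, both functions vanish at \<open>0\<close>, and \<open>log |w|\<close> is their difference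
  for every \<open>w\<close>.\<close>

lemma log_plus_nonneg: "log_plus w \<ge> 0"
  by (simp add: log_plus_def)

lemma log_minus_nonneg: "log_minus w \<ge> 0"
  by (simp add: log_minus_def)

lemma log_plus_uminus [simp]: "log_plus (- w) = log_plus w"
  by (simp add: log_plus_def)

lemma log_plus_add: "log_plus (x + y) \<le> log_plus x + log_plus y + ln 2"
proof -
  have "norm (x + y) \<le> norm x * 1 + 1 * norm y" using norm_triangle_ineq[of x y] by simp
  also have "\<dots> \<le> max 1 (norm x) * max 1 (norm y) + max 1 (norm x) * max 1 (norm y)"
    by (intro add_mono mult_mono) auto
  finally have "norm (x + y) \<le> max 1 (norm x) * max 1 (norm y) * 2" by simp
  moreover have "1 * 1 \<le> max 1 (norm x) * max 1 (norm y)"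
    by (intro mult_mono) auto
  ultimately have "ln (max 1 (norm (x + y))) \<le> ln (max 1 (norm x) * max 1 (norm y) * 2)"
    by (subst ln_le_cancel_iff) auto
  moreover have "ln (A * B * 2) = ln A + ln B + ln 2" if "A > 0" "B > 0" for A B :: real
    using that by (simp add: ln_mult_pos)
  ultimately show ?thesis by (simp add: log_plus_def less_max_iff_disj)
qed

lemma log_plus_diff: "\<bar>log_plus (x - y) - log_plus x\<bar> \<le> log_plus y + ln 2"
  using log_plus_add[of x "- y"] log_plus_add[of "x - y" y] by simp

lemma log_plus_minus_commute: "log_plus (x - y) = log_plus (y - x)"
  using log_plus_uminus[of "x - y"] by simp

lemma ln_norm_eq: "ln (norm w) = log_plus w - log_minus w"
proof (cases "norm w \<ge> 1")
  case True
  then have "ln (norm w) \<ge> 0" by simp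
  with True show ?thesis by (simp add: log_plus_def log_minus_def max_absorb2 max_absorb1)
next
  case False
  then have "ln (norm w) \<le> 0" by (cases "w = 0") auto
  with False show ?thesis by (simp add: log_plus_def log_minus_def max_def)
qed

lemma log_minus_mult: "log_minus (x * y) \<le> log_minus x + log_minus y"
proof (cases "x = 0 \<or> y = 0")
  case True
  then show ?thesis by (auto simp: log_minus_def)
next
  case False
  then show ?thesis by (simp add: log_minus_def norm_mult ln_mult)
qed

lemma log_plus_continuous: "continuous_on S g \<Longrightarrow> continuous_on S (\<lambda>x. log_plus (g x))"
  unfolding log_plus_def by (intro continuous_intros) auto

lemma log_plus_measurable [measurable]: "log_plus \<in> borel_measurable borel"
  by (intro borel_measurable_continuous_onI log_plus_continuous continuous_on_id)

lemma log_minus_measurable [measurable]: "log_minus \<in> borel_measurable borel"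
  unfolding log_minus_def by measurable

lemma reg_log_measurable [measurable]: "reg_log e \<in> borel_measurable borel"
  unfolding reg_log_def by measurable

lemma fs_density_measurable [measurable]: "fs_density e \<in> borel_measurable borel"
  unfolding fs_density_def by measurable

text \<open>The domination, uniform in e, behind every limit e -> 0. Below,
  \<open>reg_log e w\<close> is at least log |w|; above, |w|^2 + e^2 is at most twice the square of
  max(1, |w|). The point 0 is excluded: there \<open>log_minus\<close> is 0 by convention, while
  \<open>reg_log e 0\<close> is log e.\<close>

lemma reg_log_bound:
  assumes "0 < e" "e \<le> 1" "w \<noteq> 0"
  shows "\<bar>reg_log e w - log_plus w\<bar> \<le> log_minus w + ln 2"
proof -
  have "ln ((norm w)\<^sup>2) \<le> ln ((norm w)\<^sup>2 + e\<^sup>2)" using assms by (intro ln_mono) auto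
  then have l: "log_plus w - log_minus w \<le> reg_log e w"
    using assms by (simp add: reg_log_def ln_norm_eq[symmetric] ln_realpow)
  have "e\<^sup>2 \<le> 1" using assms by (simp add: power_le_one)
  have "(norm w)\<^sup>2 + e\<^sup>2 \<le> 2 * (max 1 (norm w))\<^sup>2"
  proof -
    have "(norm w)\<^sup>2 \<le> (max 1 (norm w))\<^sup>2" by (intro power_mono) auto
    moreover have "1 \<le> (max 1 (norm w))\<^sup>2" by (intro one_le_power) auto
    ultimately show ?thesis using \<open>e\<^sup>2 \<le> 1\<close> by linarith
  qed
  moreover have "(norm w)\<^sup>2 + e\<^sup>2 > 0" using assms by (simp add: add_pos_pos)
  ultimately have "ln ((norm w)\<^sup>2 + e\<^sup>2) \<le> ln (2 * (max 1 (norm w))\<^sup>2)"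
    by (subst ln_le_cancel_iff) auto
  also have "\<dots> = ln 2 + 2 * log_plus w" by (simp add: ln_mult ln_realpow log_plus_def)
  finally have "ln ((norm w)\<^sup>2 + e\<^sup>2) \<le> ln 2 + 2 * log_plus w" .
  moreover have ln2: "ln 2 > (0::real)" by simp
  ultimately have "reg_log e w \<le> log_plus w + ln 2" unfolding reg_log_def by linarith
  with l ln2 log_minus_nonneg[of w] show ?thesis unfolding abs_le_iff by linarith
qed

lemma reg_log_tendsto:
  assumes "w \<noteq> 0"
  shows "(\<lambda>n. reg_log (1 / real (Suc n)) w) \<longlonglongrightarrow> ln (norm w)"
proof -
  have "(\<lambda>n. 1 / real (Suc n)) \<longlonglongrightarrow> 0"
    using LIMSEQ_inverse_real_of_nat by (simp add: inverse_eq_divide)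
  then have "(\<lambda>n. reg_log (1 / real (Suc n)) w) \<longlonglongrightarrow> ln ((norm w)\<^sup>2 + 0\<^sup>2) / 2"
    unfolding reg_log_def using assms by (intro tendsto_intros) auto
  then show ?thesis using assms by (simp add: ln_realpow)
qed

section \<open>Integrability of the two halves of the logarithm\<close>

lemma nn_integral_le_suminf_emeasure:
  fixes g :: "'a \<Rightarrow> real"
  assumes [measurable]: "g \<in> borel_measurable M"
  shows "(\<integral>\<^sup>+x. ennreal (g x) \<partial>M) \<le> (\<Sum>n. emeasure M {x \<in> space M. g x > real n})"
proof -
  \<comment> \<open>Layer-cake argument: g(x) is at most the number of naturals n below it.\<close>
  have "ennreal (g x) \<le> (\<Sum>n. indicator {x \<in> space M. g x > real n} x)" if x: "x \<in> space M" for x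
  proof -
    define N where "N = nat \<lceil>g x\<rceil>"
    have "ennreal (g x) \<le> ennreal (real N)" unfolding N_def by (intro ennreal_leI) linarith
    also have "\<dots> = (\<Sum>n<N. indicator {x \<in> space M. g x > real n} x)"
    proof -
      have "g x > real n" if "n < N" for n using that unfolding N_def by linarith
      then have "(\<Sum>n<N. indicator {x \<in> space M. g x > real n} x) = (\<Sum>n<N. 1 :: ennreal)"
        using x by (intro sum.cong) auto
      then show ?thesis by (simp add: ennreal_of_nat_eq_real_of_nat)
    qed
    also have "\<dots> \<le> (\<Sum>n. indicator {x \<in> space M. g x > real n} x)"
      by (intro sum_le_suminf) auto
    finally show ?thesis .
  qed
  then have "(\<integral>\<^sup>+x. ennreal (g x) \<partial>M) \<le> (\<integral>\<^sup>+x. (\<Sum>n. indicator {x \<in> space M. g x > real n} x) \<partial>M)"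
    by (intro nn_integral_mono) auto
  also have "\<dots> = (\<Sum>n. emeasure M {x \<in> space M. g x > real n})"
    by (subst nn_integral_suminf) auto
  finally show ?thesis .
qed

lemma summable_exp_minus: "summable (\<lambda>n. C * (exp (- real n))\<^sup>2)"
proof -
  have "(exp (- real n))\<^sup>2 = (exp (- 2)) ^ n" for n
    by (simp add: exp_of_nat_mult[symmetric] power2_eq_square exp_add[symmetric])
  then show ?thesis by (simp add: summable_mult summable_geometric)
qed

text \<open>The set where \<open>log_minus\<close> exceeds n lies in a disc of radius exp(-n), so
  the layer-cake series is geometric.\<close>

lemma integrable_log_minus: "integrable lborel log_minus"
proof (rule integrableI_nonneg)
  have "(\<integral>\<^sup>+z. ennreal (log_minus z) \<partial>lborel) \<le> (\<Sum>n. emeasure lborel {z \<in> space lborel. log_minus z > real n})"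
    by (rule nn_integral_le_suminf_emeasure) simp
  also have "\<dots> \<le> (\<Sum>n. ennreal (unit_ball_vol 2 * (exp (- real n))\<^sup>2))"
  proof (rule suminf_le)
    fix n
    have "{z \<in> space lborel. log_minus z > real n} \<subseteq> ball 0 (exp (- real n))"
    proof
      fix z assume "z \<in> {z \<in> space lborel. log_minus z > real n}"
      then have "ln (norm z) < - real n" by (auto simp: log_minus_def max_def split: if_splits)
      then have "exp (ln (norm z)) < exp (- real n)" by simp
      then have "norm z < exp (- real n)" by (cases "z = 0") auto
      then show "z \<in> ball 0 (exp (- real n))" by simp
    qed
    then have "emeasure lborel {z \<in> space lborel. log_minus z > real n} \<le> emeasure lborel (ball (0::complex) (exp (- real n)))"
      by (intro emeasure_mono) auto
    then show "emeasure lborel {z \<in> space lborel. log_minus z > real n} \<le> ennreal (unit_ball_vol 2 * (exp (- real n))\<^sup>2)"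
      by (simp add: emeasure_ball)
  qed auto
  also have "\<dots> < \<infinity>"
    using ennreal_suminf_neq_top[OF summable_exp_minus] by (simp add: less_top)
  finally show "(\<integral>\<^sup>+z. ennreal (log_minus z) \<partial>lborel) < \<infinity>" .
qed (auto simp: log_minus_nonneg)

text \<open>Since \<open>fs_density R\<close> has mass one, this bounds the Fubini-Study mass
  outside the disc of radius R by 4/R^2 without computing any tail integral.\<close>

lemma fs_density_tail:
  assumes "norm z \<ge> R" "R > 0"
  shows "fs_density 1 z \<le> 4 / R\<^sup>2 * fs_density R z"
proof -
  have R: "R\<^sup>2 \<le> (norm z)\<^sup>2" using assms by simp
  have "((norm z)\<^sup>2 + R\<^sup>2)\<^sup>2 \<le> (2 * ((norm z)\<^sup>2 + 1))\<^sup>2" using R by (intro power_mono) auto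
  then have "((norm z)\<^sup>2 + R\<^sup>2)\<^sup>2 \<le> 4 * ((norm z)\<^sup>2 + 1)\<^sup>2" unfolding power_mult_distrib by simp
  then have "1 / (4 * ((norm z)\<^sup>2 + 1)\<^sup>2) \<le> 1 / ((norm z)\<^sup>2 + R\<^sup>2)\<^sup>2"
    using assms by (intro divide_left_mono mult_pos_pos) (auto simp: add_pos_pos add_nonneg_pos)
  then have "4 / pi * (1 / (4 * ((norm z)\<^sup>2 + 1)\<^sup>2)) \<le> 4 / pi * (1 / ((norm z)\<^sup>2 + R\<^sup>2)\<^sup>2)"
    by (intro mult_left_mono) auto
  then show ?thesis using assms by (simp add: fs_density_def)
qed

text \<open>Layer-cake again: where \<open>log_plus\<close> exceeds n the modulus exceeds R =
  exp(n), and the tail bound gives a geometric series.\<close>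

lemma integrable_log_plus_fs_density: "integrable lborel (\<lambda>a. log_plus a * fs_density 1 a)"
proof (rule integrableI_nonneg)
  let ?M = "density lborel (\<lambda>z. ennreal (fs_density 1 z))"
  have "(\<integral>\<^sup>+z. ennreal (log_plus z * fs_density 1 z) \<partial>lborel) = (\<integral>\<^sup>+z. ennreal (log_plus z) \<partial>?M)"
    by (subst nn_integral_density)
       (auto simp: ennreal_mult' fs_density_nonneg log_plus_nonneg mult.commute)
  also have "\<dots> \<le> (\<Sum>n. emeasure ?M {z \<in> space ?M. log_plus z > real n})"
    by (rule nn_integral_le_suminf_emeasure) simp
  also have "\<dots> \<le> (\<Sum>n. ennreal (4 * (exp (- real n))\<^sup>2))"
  proof (rule suminf_le)
    fix n
    have "emeasure ?M {z \<in> space ?M. log_plus z > real n}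
        = (\<integral>\<^sup>+z. ennreal (fs_density 1 z) * indicator {z. log_plus z > real n} z \<partial>lborel)"
      by (subst emeasure_density) auto
    also have "\<dots> \<le> (\<integral>\<^sup>+z. ennreal (4 * (exp (- real n))\<^sup>2) * ennreal (fs_density (exp (real n)) z) \<partial>lborel)"
    proof (intro nn_integral_mono)
      fix z
      show "ennreal (fs_density 1 z) * indicator {z. log_plus z > real n} z
          \<le> ennreal (4 * (exp (- real n))\<^sup>2) * ennreal (fs_density (exp (real n)) z)"
      proof (cases "log_plus z > real n")
        case True
        then have "exp (real n) < max 1 (norm z)"
          by (simp add: log_plus_def ln_ge_iff less_max_iff_disj flip: not_le)
             (smt (verit) exp_gt_zero ln_exp ln_less_cancel_iff ln_one of_nat_0_le_iff)
        then have "norm z \<ge> exp (real n)" by (auto simp: less_max_iff_disj)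
        from fs_density_tail[OF this exp_gt_zero]
        have "fs_density 1 z \<le> 4 * (exp (- real n))\<^sup>2 * fs_density (exp (real n)) z"
          by (simp add: exp_minus power_inverse divide_inverse)
        with True show ?thesis
          by (simp add: ennreal_mult[symmetric] fs_density_nonneg ennreal_leI)
      qed simp
    qed
    also have "\<dots> = ennreal (4 * (exp (- real n))\<^sup>2)"
      by (subst nn_integral_cmult) (auto simp: nn_integral_fs_density)
    finally show "emeasure ?M {z \<in> space ?M. log_plus z > real n} \<le> ennreal (4 * (exp (- real n))\<^sup>2)" .
  qed auto
  also have "\<dots> < \<infinity>"
    using ennreal_suminf_neq_top[OF summable_exp_minus] by (simp add: less_top)
  finally show "(\<integral>\<^sup>+z. ennreal (log_plus z * fs_density 1 z) \<partial>lborel) < \<infinity>" .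
qed (auto simp: log_plus_nonneg fs_density_nonneg)

section \<open>Changes of variable and dd^c log |z - a| as a Dirac mass\<close>

lemma integrable_lborel_shift:
  fixes F :: "complex \<Rightarrow> real"
  assumes "integrable lborel F"
  shows "integrable lborel (\<lambda>z. F (z + c))"
proof -
  have "integrable (distr lborel borel ((+) c)) F" using assms by (simp add: lborel_distr_plus)
  then have "integrable lborel (\<lambda>z. F (c + z))"
    using borel_measurable_integrable[OF assms] by (subst (asm) integrable_distr_eq) auto
  then show ?thesis by (simp add: add.commute)
qed

lemma integral_lborel_scale:
  fixes F :: "complex \<Rightarrow> real"
  assumes [measurable]: "F \<in> borel_measurable borel" and "e > 0"
  shows "(LBINT z. F z) = (LBINT z. e\<^sup>2 * F (of_real e * z))"
proof -
  have "(lborel :: complex measure) = density (distr lborel borel (\<lambda>x. 0 + e *\<^sub>R x)) (\<lambda>_. \<bar>e\<bar> ^ DIM(complex))"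
    using assms(2) by (intro lborel_affine) auto
  then have "(LBINT z. F z)
      = (\<integral>z. F z \<partial>density (distr lborel borel (\<lambda>x. 0 + e *\<^sub>R x)) (\<lambda>_. ennreal (\<bar>e\<bar> ^ DIM(complex))))"
    by simp
  also have "\<dots> = (LBINT z. e\<^sup>2 * F (of_real e * z))"
    by (subst integral_real_density) (auto simp: integral_distr scaleR_conv_of_real)
  finally show ?thesis .
qed

lemma integrable_log_minus_shift: "integrable lborel (\<lambda>z. log_minus (z - c))"
  using integrable_lborel_shift[OF integrable_log_minus, of "- c"] by simp

lemma integral_log_minus_shift: "(LBINT z. log_minus (z - c)) = (LBINT z. log_minus z)"
  using integral_lborel_shift[OF log_minus_measurable, of "- c"] by simp

lemma integrable_mult_Cc:
  assumes "integrable lborel g" "Cc \<psi>"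
  shows "integrable lborel (\<lambda>z. g z * \<psi> z)"
proof -
  obtain B where B: "\<And>z. \<bar>\<psi> z\<bar> \<le> B" using Cc_bounded[OF assms(2)] by metis
  have m: "\<psi> \<in> borel_measurable borel"
    using assms(2) by (auto simp: Cc_def intro: borel_measurable_continuous_onI)
  show ?thesis
  proof (rule Bochner_Integration.integrable_bound)
    show "integrable lborel (\<lambda>z. B * \<bar>g z\<bar>)" using assms(1) by auto
    show "(\<lambda>z. g z * \<psi> z) \<in> borel_measurable lborel"
      using borel_measurable_integrable[OF assms(1)] m by simp
    have "\<bar>g z\<bar> * \<bar>\<psi> z\<bar> \<le> \<bar>g z\<bar> * B" for z using B[of z] by (intro mult_left_mono) auto
    moreover have "B \<ge> 0" using B[of 0] by linarith
    ultimately show "AE z in lborel. norm (g z * \<psi> z) \<le> norm (B * \<bar>g z\<bar>)"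
      by (intro AE_I2) (simp add: abs_mult mult.commute)
  qed
qed

lemma Cc_log_plus: "Cc \<psi> \<Longrightarrow> continuous_on UNIV h \<Longrightarrow> integrable lborel (\<lambda>z. log_plus (h z) * \<psi> z)"
  by (intro Cc_integrable Cc_mult log_plus_continuous)

lemma integrable_ln_norm:
  assumes "Cc \<psi>"
  shows "integrable lborel (\<lambda>z. ln (norm (z - a)) * \<psi> z)"
  unfolding ln_norm_eq left_diff_distrib
  by (intro Bochner_Integration.integrable_diff integrable_mult_Cc integrable_log_minus_shift assms Cc_log_plus continuous_intros)

lemma AE_neq_lborel: "AE z in lborel. z \<noteq> (a::complex)"
  by (rule AE_I[of _ _ "{a}"]) auto

text \<open>The densities form an approximate identity. Rescaling by e moves the parameter into the
  argument of u, so that the weight is fixed and dominated convergence applies.\<close>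

lemma integral_fs_density_tendsto:
  assumes "Cc u"
  shows "(\<lambda>n. LBINT z. fs_density (1 / real (Suc n)) (z - a) * u z) \<longlonglongrightarrow> u a"
proof -
  obtain B where B: "\<And>z. \<bar>u z\<bar> \<le> B" using Cc_bounded[OF assms] by metis
  have c: "continuous_on UNIV u" using assms by (simp add: Cc_def)
  then have m [measurable]: "u \<in> borel_measurable borel" by (rule borel_measurable_continuous_onI)
  have eq: "(LBINT z. fs_density e (z - a) * u z) = (LBINT z. fs_density 1 z * u (of_real e * z + a))"
    if e: "e > 0" for e
  proof -
    have "(LBINT z. fs_density e (z - a) * u z) = (LBINT z. fs_density e z * u (z + a))"
      using integral_lborel_shift[of "\<lambda>z. fs_density e (z - a) * u z" a] by simp
    also have "\<dots> = (LBINT z. e\<^sup>2 * (fs_density e (of_real e * z) * u (of_real e * z + a)))"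
      using e by (subst integral_lborel_scale[OF _ e]) auto
    also have "\<dots> = (LBINT z. fs_density 1 z * u (of_real e * z + a))"
    proof (intro Bochner_Integration.integral_cong refl)
      fix z :: complex
      have "(norm (of_real e * z))\<^sup>2 + e\<^sup>2 = e\<^sup>2 * ((norm z)\<^sup>2 + 1)"
        by (simp add: norm_mult power_mult_distrib algebra_simps)
      then have "e\<^sup>2 * fs_density e (of_real e * z) = fs_density 1 z"
        unfolding fs_density_def using e by (simp add: power_mult_distrib power2_eq_square)
      then show "e\<^sup>2 * (fs_density e (of_real e * z) * u (of_real e * z + a)) = fs_density 1 z * u (of_real e * z + a)"
        by (simp add: mult.assoc[symmetric])
    qed
    finally show ?thesis .
  qed
  have "(\<lambda>n. LBINT z. fs_density 1 z * u (of_real (1 / real (Suc n)) * z + a))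
      \<longlonglongrightarrow> (LBINT z. fs_density 1 z * u a)"
  proof (rule integral_dominated_convergence[where w = "\<lambda>z. fs_density 1 z * B"])
    show "integrable lborel (\<lambda>z. fs_density 1 z * B)" using integrable_fs_density[of 1] by simp
    have "(\<lambda>n. of_real (1 / real (Suc n)) * z + a) \<longlonglongrightarrow> of_real 0 * z + a" for z
      using LIMSEQ_inverse_real_of_nat
      by (intro tendsto_intros) (simp add: inverse_eq_divide)
    then have lim: "(\<lambda>n. of_real (1 / real (Suc n)) * z + a) \<longlonglongrightarrow> a" for z by simp
    have "isCont u a" using c by (simp add: continuous_on_eq_continuous_at)
    then have "(\<lambda>n. u (of_real (1 / real (Suc n)) * z + a)) \<longlonglongrightarrow> u a" for z
      by (rule isCont_tendsto_compose) (rule lim)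
    then show "AE z in lborel. (\<lambda>n. fs_density 1 z * u (of_real (1 / real (Suc n)) * z + a)) \<longlonglongrightarrow> fs_density 1 z * u a"
      by (intro AE_I2 tendsto_intros)
    show "AE z in lborel. norm (fs_density 1 z * u (of_real (1 / real (Suc n)) * z + a)) \<le> fs_density 1 z * B" for n
      using B by (intro AE_I2) (auto simp: abs_mult fs_density_nonneg intro!: mult_left_mono)
  qed auto
  then show ?thesis by (simp add: eq integral_fs_density)
qed

text \<open>Integration by parts is legitimate for the smooth \<open>reg_log\<close>; letting e -> 0
  then turns one side into the logarithm and the other, by the approximate identity, into
  u(a).\<close>

lemma integral_ln_norm_ddc:
  assumes u: "smooth u" "Cc u"
  shows "(LBINT z. ln (norm (z - a)) * ddc u z) = u a"
proof -
  define e where "e n = 1 / real (Suc n)" for n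
  have e: "0 < e n" "e n \<le> 1" for n by (auto simp: e_def)
  let ?w = "\<lambda>z. log_minus (z - a) * \<bar>ddc u z\<bar> + (log_plus (z - a) * \<bar>ddc u z\<bar> + ln 2 * \<bar>ddc u z\<bar>)"
  have \<psi>: "Cc (ddc u)" using u by (rule Cc_ddc)
  then have m [measurable]: "ddc u \<in> borel_measurable borel"
    by (auto simp: Cc_def intro: borel_measurable_continuous_onI)
  have "(LBINT z. reg_log (e n) (z - a) * ddc u z) = (LBINT z. fs_density (e n) (z - a) * u z)" for n
  proof -
    have "smooth (\<lambda>z. reg_log (e n) (z - a))"
      using smooth_kernel_smooth[OF smooth_kernel_reg_log[where h = "\<lambda>_. a", OF e(1)[of n] continuous_on_const]] .
    from integral_laplacian_by_parts[OF this u]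
    have "(LBINT z. reg_log (e n) (z - a) * laplacian u z)
        = (LBINT z. 2 * pi * (fs_density (e n) (z - a) * u z))"
      by (simp add: laplacian_reg_log[OF e(1)] mult.assoc)
    then show ?thesis by (simp add: ddc_def)
  qed
  moreover have "(\<lambda>n. LBINT z. reg_log (e n) (z - a) * ddc u z) \<longlonglongrightarrow> (LBINT z. ln (norm (z - a)) * ddc u z)"
  proof (rule integral_dominated_convergence[where
        w = "?w"])
    show "integrable lborel (?w)"
      by (intro Bochner_Integration.integrable_add integrable_mult_Cc integrable_log_minus_shift Cc_abs \<psi>
          Cc_log_plus continuous_intros integrable_mult_right Cc_integrable)
    show "AE z in lborel. (\<lambda>n. reg_log (e n) (z - a) * ddc u z) \<longlonglongrightarrow> ln (norm (z - a)) * ddc u z"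
      using AE_neq_lborel[of a]
    proof eventually_elim
      case (elim z)
      then show ?case unfolding e_def by (intro tendsto_mult reg_log_tendsto tendsto_const) simp
    qed
    show "AE z in lborel. norm (reg_log (e n) (z - a) * ddc u z)
        \<le> ?w z" for n
      using AE_neq_lborel[of a]
    proof eventually_elim
      case (elim z)
      then have "\<bar>reg_log (e n) (z - a)\<bar> \<le> log_minus (z - a) + (log_plus (z - a) + ln 2)"
        using reg_log_bound[OF e(1)[of n] e(2)[of n], of "z - a"] log_plus_nonneg[of "z - a"] by simp
      from mult_right_mono[OF this, of "\<bar>ddc u z\<bar>"] show ?case
        by (simp add: abs_mult distrib_right)
    qed
  qed auto
  ultimately show ?thesis
    using integral_fs_density_tendsto[OF u(2), of a] LIMSEQ_unique unfolding e_def by auto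
qed


section \<open>Logarithmic potentials along polynomial fibres\<close>

lemma sum_mset_eq_sum_count:
  fixes f :: "'a \<Rightarrow> real"
  shows "(\<Sum>x\<in>#A. f x) = (\<Sum>x\<in>set_mset A. real (count A x) * f x)"
proof (induction A)
  case (add y A)
  let ?S = "insert y (set_mset A)"
  have "(\<Sum>x\<in>?S. real (count (add_mset y A) x) * f x)
      = (\<Sum>x\<in>?S. real (count A x) * f x + (if y = x then f x else 0))"
    by (intro sum.cong) (auto simp: algebra_simps)
  also have "\<dots> = (\<Sum>x\<in>?S. real (count A x) * f x) + f y"
    by (subst sum.distrib) simp
  also have "(\<Sum>x\<in>?S. real (count A x) * f x) = (\<Sum>x\<in>set_mset A. real (count A x) * f x)"
    by (intro sum.mono_neutral_right) (auto simp: not_in_iff)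
  finally show ?case using add by simp
qed simp

lemma poly_measurable [measurable]: "poly p \<in> borel_measurable (borel :: complex measure)"
  by (intro borel_measurable_continuous_onI continuous_on_poly continuous_on_id)

lemma AE_poly_neq_0:
  assumes "p \<noteq> (0 :: complex poly)"
  shows "AE z in lborel. poly p z \<noteq> 0"
  by (rule AE_I[of _ _ "{z. poly p z = 0}"])
     (use poly_roots_finite[OF assms] in \<open>auto intro: finite_imp_null_set_lborel[THEN null_setsD1]\<close>)

lemma Cc_measurable: "Cc \<psi> \<Longrightarrow> \<psi> \<in> borel_measurable borel"
  by (auto simp: Cc_def intro: borel_measurable_continuous_onI)

lemma integral_abs_bound_AE:
  fixes f g :: "'a \<Rightarrow> real"
  assumes "integrable M f" "integrable M g" "AE x in M. \<bar>f x\<bar> \<le> g x"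
  shows "\<bar>\<integral>x. f x \<partial>M\<bar> \<le> (\<integral>x. g x \<partial>M)"
proof -
  have "\<bar>\<integral>x. f x \<partial>M\<bar> \<le> (\<integral>x. \<bar>f x\<bar> \<partial>M)" by (rule integral_abs_bound)
  also have "\<dots> \<le> (\<integral>x. g x \<partial>M)" using assms by (intro integral_mono_AE) auto
  finally show ?thesis .
qed

text \<open>Minkowski's inequality in L^1. A bound on the inner integral over a that is uniform
  along the fibres becomes a bound free of the polynomial.\<close>

lemma integral_swap_bound:
  fixes f :: "complex \<Rightarrow> complex \<Rightarrow> real"
  assumes fm [measurable]: "(\<lambda>(z, a). f z a) \<in> borel_measurable (lborel \<Otimes>\<^sub>M lborel)"
    and f: "\<And>z. integrable lborel (f z)" and b: "\<And>z. (LBINT a. \<bar>f z a\<bar>) \<le> w z"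
    and w: "integrable lborel w"
  shows "integrable lborel (\<lambda>a. LBINT z. f z a)"
    and "(LBINT a. \<bar>LBINT z. f z a\<bar>) \<le> (LBINT z. w z)"
proof -
  have nn: "0 \<le> (LBINT a. \<bar>f z a\<bar>)" for z by simp
  have iw: "integrable lborel (\<lambda>z. LBINT a. \<bar>f z a\<bar>)"
    by (rule Bochner_Integration.integrable_bound[OF w])
       (measurable, use b nn in \<open>auto intro: order_trans[OF _ abs_ge_self]\<close>)
  have int: "integrable (lborel \<Otimes>\<^sub>M lborel) (\<lambda>(z, a). f z a)"
    using f iw by (intro lborel_pair.Fubini_integrable[OF fm]) auto
  then have int': "integrable (lborel \<Otimes>\<^sub>M lborel) (\<lambda>(z, a). \<bar>f z a\<bar>)"
    using integrable_norm[OF int] by (simp add: case_prod_unfold)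
  show I: "integrable lborel (\<lambda>a. LBINT z. f z a)"
    using lborel_pair.integrable_snd[OF int] .
  have "(LBINT a. \<bar>LBINT z. f z a\<bar>) \<le> (LBINT a. (LBINT z. \<bar>f z a\<bar>))"
    using I lborel_pair.integrable_snd[OF int'] by (intro integral_mono integral_abs_bound) auto
  also have "\<dots> = (LBINT z. (LBINT a. \<bar>f z a\<bar>))"
    by (rule lborel_pair.Fubini_integral[OF int'])
  also have "\<dots> \<le> (LBINT z. w z)" by (intro integral_mono iw w b)
  finally show "(LBINT a. \<bar>LBINT z. f z a\<bar>) \<le> (LBINT z. w z)" .
qed

text \<open>Integration by parts against the constant 1. It permits adding to a kernel any term that
  does not depend on z, which is used for leading coefficients and for the behaviour at
  infinity.\<close>

lemma integral_ddc_eq_0: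
  assumes u: "smooth u" "Cc u"
  shows "(LBINT z. ddc u z) = 0"
proof -
  have s: "smooth (\<lambda>_. 1)" using smooth_kernel_smooth[OF smooth_kernel_const[of 1]] by simp
  have "laplacian (\<lambda>_. 1) = (\<lambda>_. 0)"
    by (simp add: laplacian_def fun_eq_iff)
  with integral_laplacian_by_parts[OF s u] show ?thesis by (simp add: ddc_def)
qed

section \<open>Factorisation over the roots\<close>

definition poly_of_roots :: "complex multiset \<Rightarrow> complex poly" where
  "poly_of_roots A = (\<Prod>x\<in>#A. [:- x, 1:])"

lemma poly_of_roots_add: "poly (poly_of_roots (add_mset x A)) z = (z - x) * poly (poly_of_roots A) z"
  by (simp add: poly_of_roots_def algebra_simps)

lemma poly_of_roots_neq_0: "poly_of_roots A \<noteq> 0"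
  by (auto simp: poly_of_roots_def prod_mset_zero_iff)

lemma poly_eq_poly_of_roots: "poly p z = lead_coeff p * poly (poly_of_roots (proots p)) z"
  unfolding poly_of_roots_def by (metis complex_poly_decompose_multiset poly_smult)

lemma log_minus_poly_of_roots: "log_minus (poly (poly_of_roots A) z) \<le> (\<Sum>x\<in>#A. log_minus (z - x))"
proof (induction A)
  case (add x A)
  then show ?case
    using log_minus_mult[of "z - x" "poly (poly_of_roots A) z"] by (simp add: poly_of_roots_add)
qed (simp add: poly_of_roots_def log_minus_def)

lemma integral_sum_log_minus:
  assumes \<psi>: "Cc \<psi>" and B: "\<And>z. \<bar>\<psi> z\<bar> \<le> B"
  shows "integrable lborel (\<lambda>z. (\<Sum>x\<in>#A. log_minus (z - x)) * \<bar>\<psi> z\<bar>)"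
    and "(LBINT z. (\<Sum>x\<in>#A. log_minus (z - x)) * \<bar>\<psi> z\<bar>) \<le> size A * (B * (LBINT z. log_minus z))"
proof -
  have 1: "integrable lborel (\<lambda>z. log_minus (z - x) * \<bar>\<psi> z\<bar>)" for x
    by (intro integrable_mult_Cc integrable_log_minus_shift Cc_abs \<psi>)
  have 2: "(LBINT z. log_minus (z - x) * \<bar>\<psi> z\<bar>) \<le> B * (LBINT z. log_minus z)" for x
  proof -
    have "(LBINT z. log_minus (z - x) * \<bar>\<psi> z\<bar>) \<le> (LBINT z. B * log_minus (z - x))"
      using B log_minus_nonneg 1 integrable_log_minus_shift
      by (intro integral_mono) (auto intro: mult_right_mono simp: mult.commute)
    then show ?thesis by (simp add: integral_log_minus_shift)
  qed
  have "integrable lborel (\<lambda>z. (\<Sum>x\<in>#A. log_minus (z - x)) * \<bar>\<psi> z\<bar>) \<and>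
    (LBINT z. (\<Sum>x\<in>#A. log_minus (z - x)) * \<bar>\<psi> z\<bar>) \<le> size A * (B * (LBINT z. log_minus z))"
  proof (induction A)
    case (add x A)
    with 1[of x] 2[of x] show ?case by (simp add: distrib_right)
  qed simp
  then show "integrable lborel (\<lambda>z. (\<Sum>x\<in>#A. log_minus (z - x)) * \<bar>\<psi> z\<bar>)"
    "(LBINT z. (\<Sum>x\<in>#A. log_minus (z - x)) * \<bar>\<psi> z\<bar>) \<le> size A * (B * (LBINT z. log_minus z))"
    by auto
qed

text \<open>One linear factor at a time. The logarithm of the product splits only away from the
  roots, so the integrands agree merely almost everywhere.\<close>

lemma integral_ln_norm_poly_of_roots:
  assumes u: "smooth u" "Cc u"
  shows "integrable lborel (\<lambda>z. ln (norm (poly (poly_of_roots A) z)) * ddc u z) \<and>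
    (LBINT z. ln (norm (poly (poly_of_roots A) z)) * ddc u z) = (\<Sum>x\<in>#A. u x)"
proof (induction A)
  case empty
  show ?case by (simp add: poly_of_roots_def)
next
  case (add x A)
  note m [measurable] = Cc_measurable[OF Cc_ddc[OF u]]
  let ?f = "\<lambda>z. ln (norm (poly (poly_of_roots (add_mset x A)) z)) * ddc u z"
  let ?g = "\<lambda>z. ln (norm (z - x)) * ddc u z + ln (norm (poly (poly_of_roots A) z)) * ddc u z"
  have ae: "AE z in lborel. ?f z = ?g z"
    using AE_poly_neq_0[OF poly_of_roots_neq_0[of "add_mset x A"]]
  proof eventually_elim
    case (elim z)
    then show ?case by (simp add: poly_of_roots_add norm_mult ln_mult distrib_right)
  qed
  have i: "integrable lborel ?g"
    using add integrable_ln_norm[OF Cc_ddc[OF u], of x] by simp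
  have "integrable lborel ?f"
    using i ae by (subst integrable_cong_AE[where g = ?g]) auto
  moreover have "integral\<^sup>L lborel ?f = integral\<^sup>L lborel ?g"
    using ae by (intro integral_cong_AE) auto
  moreover have "integral\<^sup>L lborel ?g = (\<Sum>x\<in>#add_mset x A. u x)"
    using add integrable_ln_norm[OF Cc_ddc[OF u], of x] by (simp add: integral_ln_norm_ddc[OF u])
  ultimately show ?case by simp
qed

text \<open>The leading coefficient adds a constant to the logarithm, and dd^c u has integral
  zero.\<close>

lemma integral_ln_norm_poly:
  assumes u: "smooth u" "Cc u" and p: "p \<noteq> 0"
  shows "(LBINT z. ln (norm (poly p z)) * ddc u z) = (\<Sum>x\<in>#proots p. u x)"
proof -
  note m [measurable] = Cc_measurable[OF Cc_ddc[OF u]]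
  have ae: "AE z in lborel. ln (norm (poly p z)) * ddc u z
      = ln (norm (lead_coeff p)) * ddc u z + ln (norm (poly (poly_of_roots (proots p)) z)) * ddc u z"
    using AE_poly_neq_0[OF p]
  proof eventually_elim
    case (elim z)
    then show ?case by (simp add: poly_eq_poly_of_roots[of p z] norm_mult ln_mult distrib_right)
  qed
  then have "(LBINT z. ln (norm (poly p z)) * ddc u z)
      = (LBINT z. ln (norm (lead_coeff p)) * ddc u z + ln (norm (poly (poly_of_roots (proots p)) z)) * ddc u z)"
    by (intro integral_cong_AE) auto
  also have "\<dots> = (\<Sum>x\<in>#proots p. u x)"
    using integral_ln_norm_poly_of_roots[OF u, of "proots p"] Cc_integrable[OF Cc_ddc[OF u]]
    by (simp add: integral_ddc_eq_0[OF u])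
  finally show ?thesis .
qed

lemma degree_diff_const:
  fixes p :: "complex poly"
  assumes "degree p > 0"
  shows "degree (p - [:a:]) = degree p"
  unfolding diff_conv_add_uminus by (rule degree_add_eq_left) (use assms in simp)

text \<open>The error constant of averaging with density \<open>r\<close>; it involves neither a
  polynomial nor a test function. One ln 2 stems from \<open>reg_log_bound\<close>, the other from
  \<open>log_plus_diff\<close>.\<close>

definition average_error :: "(complex \<Rightarrow> real) \<Rightarrow> real" where
  "average_error r = (LBINT z. log_minus z) + 2 * ln 2 + (LBINT a. log_plus a * r a)"

section \<open>Potential estimates for one polynomial and one test function\<close>

locale fiber_test =
  fixes h :: "complex poly" and u :: "complex \<Rightarrow> real"
  assumes deg: "degree h > 0" and u: "smooth u" "Cc u"
begin

abbreviation "mass \<equiv> LBINT z. \<bar>ddc u z\<bar>"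

abbreviation "mean \<equiv> LBINT z. log_plus (poly h z) * ddc u z"

lemma \<psi>: "Cc (ddc u)" by (rule Cc_ddc[OF u])

lemma \<psi>_measurable [measurable]: "ddc u \<in> borel_measurable borel"
  by (rule Cc_measurable[OF \<psi>])

lemma h_cont: "continuous_on S (poly h)"
  by (intro continuous_on_poly continuous_on_id)

lemma degree_fiber: "degree (h - [:a:]) = degree h"
  by (rule degree_diff_const[OF deg])

lemma fiber_neq_0: "h - [:a:] \<noteq> 0"
  using degree_fiber[of a] deg by auto

lemma AE_fiber: "AE z in lborel. a - poly h z \<noteq> 0"
  using AE_poly_neq_0[OF fiber_neq_0[of a]] by eventually_elim auto

lemma lead_coeff_fiber: "lead_coeff (h - [:a:]) = lead_coeff h"
  unfolding degree_fiber using deg by (simp add: coeff_eq_0)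

text \<open>Uniform in the point a, because all h - a share degree and leading coefficient. The
  dependence on h is harmless, as this bound serves only the limit e -> 0 for fixed h.
  \<open>SOME\<close> merely fixes a bound for dd^c u.\<close>

definition "potential_bound = log_minus (lead_coeff h) * mass
  + degree h * ((SOME B. \<forall>z. \<bar>ddc u z\<bar> \<le> B) * (LBINT z. log_minus z))"

text \<open>\<open>log_minus\<close> is subadditive under products, so factoring h - a reduces
  everything to translates of one integrable function.\<close>

lemma log_minus_fiber:
  shows integrable_log_minus_fiber: "integrable lborel (\<lambda>z. log_minus (a - poly h z) * \<bar>ddc u z\<bar>)"
    and integral_log_minus_fiber: "(LBINT z. log_minus (a - poly h z) * \<bar>ddc u z\<bar>) \<le> potential_bound"
proof -
  let ?A = "proots (h - [:a:])"
  define B where "B = (SOME B. \<forall>z. \<bar>ddc u z\<bar> \<le> B)"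
  have "\<exists>B. \<forall>z. \<bar>ddc u z\<bar> \<le> B" using Cc_bounded[OF \<psi>] by metis
  then have "\<forall>z. \<bar>ddc u z\<bar> \<le> B" unfolding B_def by (rule someI_ex)
  then have B: "\<bar>ddc u z\<bar> \<le> B" for z ..
  have le: "log_minus (a - poly h z) \<le> log_minus (lead_coeff h) + (\<Sum>x\<in>#?A. log_minus (z - x))" for z
  proof -
    have "norm (a - poly h z) = norm (poly (h - [:a:]) z)" by (simp add: norm_minus_commute)
    then have "log_minus (a - poly h z) = log_minus (lead_coeff h * poly (poly_of_roots ?A) z)"
      unfolding poly_eq_poly_of_roots[of "h - [:a:]" z] lead_coeff_fiber by (simp add: log_minus_def)
    with log_minus_mult[of "lead_coeff h" "poly (poly_of_roots ?A) z"] log_minus_poly_of_roots[of ?A z]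
    show ?thesis by simp
  qed
  let ?g = "\<lambda>z. log_minus (lead_coeff h) * \<bar>ddc u z\<bar> + (\<Sum>x\<in>#?A. log_minus (z - x)) * \<bar>ddc u z\<bar>"
  note i = Cc_integrable[OF Cc_abs[OF \<psi>]] integral_sum_log_minus[OF \<psi> B, of ?A]
  have gi: "integrable lborel ?g" using i by auto
  have le': "log_minus (a - poly h z) * \<bar>ddc u z\<bar> \<le> ?g z" for z
    using mult_right_mono[OF le, of "\<bar>ddc u z\<bar>"] by (simp add: distrib_right)
  show int: "integrable lborel (\<lambda>z. log_minus (a - poly h z) * \<bar>ddc u z\<bar>)"
  proof (rule Bochner_Integration.integrable_bound[OF gi])
    show "AE z in lborel. norm (log_minus (a - poly h z) * \<bar>ddc u z\<bar>) \<le> norm (?g z)"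
    proof (rule AE_I2)
      fix z
      have "0 \<le> log_minus (a - poly h z) * \<bar>ddc u z\<bar>" by (simp add: log_minus_nonneg)
      with le'[of z] show "norm (log_minus (a - poly h z) * \<bar>ddc u z\<bar>) \<le> norm (?g z)"
        unfolding real_norm_def by linarith
    qed
  qed measurable
  have "(LBINT z. log_minus (a - poly h z) * \<bar>ddc u z\<bar>) \<le> (LBINT z. ?g z)"
    by (intro integral_mono int gi le')
  also have "\<dots> \<le> potential_bound"
    using i by (simp add: potential_bound_def B_def[symmetric] size_proots_complex degree_fiber)
  finally show "(LBINT z. log_minus (a - poly h z) * \<bar>ddc u z\<bar>) \<le> potential_bound" .
qed

definition reg_potential :: "real \<Rightarrow> complex \<Rightarrow> real" where
  "reg_potential e a = (LBINT z. reg_log e (a - poly h z) * ddc u z)"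

lemma fiber_sum_eq:
  "(\<Sum>z | poly h z = a. real (order z (h - [:a:])) * u z) = (LBINT z. ln (norm (a - poly h z)) * ddc u z)"
proof -
  have "(LBINT z. ln (norm (a - poly h z)) * ddc u z) = (LBINT z. ln (norm (poly (h - [:a:]) z)) * ddc u z)"
    by (simp add: norm_minus_commute)
  also have "\<dots> = (\<Sum>x\<in>#proots (h - [:a:]). u x)"
    by (rule integral_ln_norm_poly[OF u fiber_neq_0])
  also have "\<dots> = (\<Sum>z | poly h z = a. real (order z (h - [:a:])) * u z)"
    using fiber_neq_0[of a] by (simp add: sum_mset_eq_sum_count)
  finally show ?thesis by simp
qed

abbreviation "majorant a z \<equiv> log_minus (a - poly h z) * \<bar>ddc u z\<bar> + (log_plus (a - poly h z) * \<bar>ddc u z\<bar> + ln 2 * \<bar>ddc u z\<bar>)"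

lemma reg_log_dominated:
  assumes "0 < e" "e \<le> 1"
  shows "AE z in lborel. \<bar>reg_log e (a - poly h z) * ddc u z\<bar>
    \<le> majorant a z"
  using AE_fiber[of a]
proof eventually_elim
  case (elim z)
  then have "\<bar>reg_log e (a - poly h z)\<bar> \<le> log_minus (a - poly h z) + (log_plus (a - poly h z) + ln 2)"
    using reg_log_bound[OF assms elim] log_plus_nonneg[of "a - poly h z"] by simp
  from mult_right_mono[OF this, of "\<bar>ddc u z\<bar>"] show ?case
    by (simp add: abs_mult distrib_right)
qed

lemma integrable_reg_log: "0 < e \<Longrightarrow> integrable lborel (\<lambda>z. reg_log e (a - poly h z) * ddc u z)"
  by (intro Cc_integrable Cc_mult \<psi> reg_log_continuous continuous_intros h_cont)

lemma integrable_log_plus: "integrable lborel (\<lambda>z. log_plus (poly h z) * \<bar>ddc u z\<bar>)"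
  by (intro Cc_integrable Cc_mult Cc_abs \<psi> log_plus_continuous h_cont)

lemma reg_potential_tendsto:
  "(\<lambda>n. reg_potential (1 / real (Suc n)) a) \<longlonglongrightarrow> (\<Sum>z | poly h z = a. real (order z (h - [:a:])) * u z)"
  unfolding fiber_sum_eq reg_potential_def
proof (rule integral_dominated_convergence[where
      w = "majorant a"])
  show "integrable lborel (majorant a)"
    by (intro Bochner_Integration.integrable_add integrable_log_minus_fiber Cc_log_plus Cc_abs \<psi>
        continuous_intros h_cont integrable_mult_right Cc_integrable)
  show "AE z in lborel. (\<lambda>n. reg_log (1 / real (Suc n)) (a - poly h z) * ddc u z) \<longlonglongrightarrow> ln (norm (a - poly h z)) * ddc u z"
    using AE_fiber[of a]
  proof eventually_elim
    case (elim z)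
    then show ?case by (intro tendsto_mult reg_log_tendsto tendsto_const)
  qed
  show "AE z in lborel. norm (reg_log (1 / real (Suc n)) (a - poly h z) * ddc u z)
      \<le> majorant a z" for n
    using reg_log_dominated[of "1 / real (Suc n)" a] by simp
qed measurable

abbreviation "fiber_bound \<equiv> potential_bound + (LBINT z. (log_plus (poly h z) + 2 * ln 2) * \<bar>ddc u z\<bar>)"

text \<open>The kernel grows like log |a|. Subtracting \<open>log_plus a\<close> from it leaves the
  integral unchanged, since dd^c u has integral zero, and makes the bound uniform in a as well as in
  e.\<close>

lemma reg_potential_bounded:
  assumes "0 < e" "e \<le> 1"
  shows "\<bar>reg_potential e a\<bar> \<le> fiber_bound"
proof -
  have i0: "integrable lborel (\<lambda>z. log_plus a * ddc u z)"
    by (intro integrable_mult_right Cc_integrable \<psi>)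
  have i1: "integrable lborel (\<lambda>z. (log_plus (poly h z) + 2 * ln 2) * \<bar>ddc u z\<bar>)"
    unfolding distrib_right
    by (intro Bochner_Integration.integrable_add integrable_log_plus integrable_mult_right Cc_integrable Cc_abs \<psi>)
  have "reg_potential e a = (LBINT z. reg_log e (a - poly h z) * ddc u z - log_plus a * ddc u z)"
    using integrable_reg_log[OF assms(1)] i0 by (simp add: reg_potential_def integral_ddc_eq_0[OF u])
  also have "\<bar>\<dots>\<bar> \<le> (LBINT z. log_minus (a - poly h z) * \<bar>ddc u z\<bar> + (log_plus (poly h z) + 2 * ln 2) * \<bar>ddc u z\<bar>)"
  proof (rule integral_abs_bound_AE)
    show "integrable lborel (\<lambda>z. reg_log e (a - poly h z) * ddc u z - log_plus a * ddc u z)"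
      by (intro Bochner_Integration.integrable_diff integrable_reg_log assms i0)
    show i2: "integrable lborel (\<lambda>z. log_minus (a - poly h z) * \<bar>ddc u z\<bar> + (log_plus (poly h z) + 2 * ln 2) * \<bar>ddc u z\<bar>)"
      by (intro Bochner_Integration.integrable_add integrable_log_minus_fiber i1)
    show "AE z in lborel. \<bar>reg_log e (a - poly h z) * ddc u z - log_plus a * ddc u z\<bar>
        \<le> log_minus (a - poly h z) * \<bar>ddc u z\<bar> + (log_plus (poly h z) + 2 * ln 2) * \<bar>ddc u z\<bar>"
      using AE_fiber[of a]
    proof eventually_elim
      case (elim z)
      have "\<bar>reg_log e (a - poly h z) - log_plus a\<bar> \<le> log_minus (a - poly h z) + (log_plus (poly h z) + 2 * ln 2)"
        using reg_log_bound[OF assms elim] log_plus_diff[of a "poly h z"] by linarith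
      from mult_right_mono[OF this, of "\<bar>ddc u z\<bar>"] show ?case
        by (simp add: abs_mult[symmetric] algebra_simps)
    qed
  qed
  also have "\<dots> \<le> fiber_bound"
    using i1 integrable_log_minus_fiber integral_log_minus_fiber by simp
  finally show ?thesis .
qed

text \<open>For fixed w the average over a of |log |a - w| - \<open>log_plus w\<close>| is bounded
  independently of w. Taking w = h(z) and integrating against |dd^c u| leaves no trace of h, which
  is what makes the estimate uniform over the iterates.\<close>

lemma reg_potential_average:
  fixes r :: "complex \<Rightarrow> real"
  assumes e: "0 < e" "e \<le> 1"
    and r: "\<And>a. 0 \<le> r a" "\<And>a. r a \<le> 1" "integrable lborel r" "(LBINT a. r a) = 1"
      "integrable lborel (\<lambda>a. log_plus a * r a)"
  shows "\<bar>(LBINT a. reg_potential e a * r a) - mean\<bar>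
    \<le> average_error r * mass"
proof -
  note [measurable] = borel_measurable_integrable[OF r(3), simplified]
  let ?K = "average_error r"
  have le: "AE a in lborel. \<bar>r a * (reg_log e (a - w) - log_plus w)\<bar>
      \<le> log_minus (a - w) + (2 * ln 2 * r a + log_plus a * r a)" for w
    using AE_neq_lborel[of w]
  proof eventually_elim
    case (elim a)
    have "\<bar>reg_log e (a - w) - log_plus w\<bar> \<le> log_minus (a - w) + (2 * ln 2 + log_plus a)"
      using reg_log_bound[OF e, of "a - w"] elim log_plus_diff[of w a] log_plus_minus_commute[of a w] by simp
    from mult_left_mono[OF this r(1)[of a]]
    have "r a * \<bar>reg_log e (a - w) - log_plus w\<bar> \<le> r a * log_minus (a - w) + (2 * ln 2 * r a + log_plus a * r a)"
      by (simp add: algebra_simps)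
    moreover have "\<bar>r a * (reg_log e (a - w) - log_plus w)\<bar> = r a * \<bar>reg_log e (a - w) - log_plus w\<bar>"
      using r(1) by (simp add: abs_mult)
    \<comment> \<open>Boundedness of the density enters here: the singular term loses its weight,
      and its integral is then invariant under the shift by w.\<close>
    moreover have "r a * log_minus (a - w) \<le> log_minus (a - w)"
      using mult_right_mono[OF r(2) log_minus_nonneg] by simp
    ultimately show ?case by simp
  qed
  have i: "integrable lborel (\<lambda>a. log_minus (a - w) + (2 * ln 2 * r a + log_plus a * r a))" for w
    using integrable_log_minus_shift r by auto
  have m1: "(\<lambda>a. r a * (reg_log e (a - w) - log_plus w)) \<in> borel_measurable lborel" for w
    by measurable
  have i1: "integrable lborel (\<lambda>a. r a * (reg_log e (a - w) - log_plus w))" for w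
  proof (rule Bochner_Integration.integrable_bound[OF i[of w] m1])
    show "AE a in lborel. norm (r a * (reg_log e (a - w) - log_plus w))
        \<le> norm (log_minus (a - w) + (2 * ln 2 * r a + log_plus a * r a))"
      using le[of w] by eventually_elim simp
  qed
  have b1: "(LBINT a. \<bar>r a * (reg_log e (a - w) - log_plus w)\<bar>) \<le> ?K" for w
  proof -
    have "(LBINT a. \<bar>r a * (reg_log e (a - w) - log_plus w)\<bar>)
        \<le> (LBINT a. log_minus (a - w) + (2 * ln 2 * r a + log_plus a * r a))"
      using i1 le by (intro integral_mono_AE i) auto
    also have "\<dots> = ?K"
      using integrable_log_minus_shift r by (simp add: average_error_def integral_log_minus_shift)
    finally show ?thesis .
  qed
  define f where "f z a = r a * (reg_log e (a - poly h z) - log_plus (poly h z)) * ddc u z" for z a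
  have fm [measurable]: "(\<lambda>(z, a). f z a) \<in> borel_measurable (lborel \<Otimes>\<^sub>M lborel)"
    unfolding f_def by measurable
  have fi: "integrable lborel (f z)" for z
    unfolding f_def[abs_def] using i1 by simp
  have fb: "(LBINT a. \<bar>f z a\<bar>) \<le> ?K * \<bar>ddc u z\<bar>" for z
    using mult_right_mono[OF b1[of "poly h z"], of "\<bar>ddc u z\<bar>"] by (simp add: f_def abs_mult)
  have Ki: "integrable lborel (\<lambda>z. ?K * \<bar>ddc u z\<bar>)"
    by (intro integrable_mult_right Cc_integrable Cc_abs \<psi>)
  note swap = integral_swap_bound[OF fm fi fb Ki]
  have i2: "integrable lborel (\<lambda>z. log_plus (poly h z) * ddc u z)"
    by (intro Cc_integrable Cc_mult \<psi> log_plus_continuous h_cont)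
  have eq: "(LBINT z. f z a) = r a * reg_potential e a - r a * mean" for a
  proof -
    have "(LBINT z. f z a) = (LBINT z. r a * (reg_log e (a - poly h z) * ddc u z - log_plus (poly h z) * ddc u z))"
      by (simp add: f_def algebra_simps)
    then show ?thesis
      using integrable_reg_log[OF e(1), of a] i2 by (simp add: reg_potential_def right_diff_distrib)
  qed
  have "integrable lborel (\<lambda>a. (LBINT z. f z a) + r a * mean)"
    using swap(1) r by auto
  then have "integrable lborel (\<lambda>a. r a * reg_potential e a)" by (simp add: eq)
  then have "(LBINT a. reg_potential e a * r a) - mean
      = (LBINT a. (LBINT z. f z a))"
    using r by (simp add: eq mult.commute)
  also have "\<bar>\<dots>\<bar> \<le> (LBINT a. \<bar>LBINT z. f z a\<bar>)" by (rule integral_abs_bound)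
  also note swap(2)
  finally show ?thesis by simp
qed

end


section \<open>Comparison of PB measures with the logarithmic potential\<close>

lemma topspace_P1: "topspace P1 = UNIV"
  by (auto simp: notin_range_Some)

lemma space_P1_borel [simp]: "space P1_borel = UNIV"
  unfolding P1_borel_def topspace_P1 by (simp add: space_measure_of_conv)

lemma openin_P1_sets: "openin P1 U \<Longrightarrow> U \<in> sets P1_borel"
  unfolding P1_borel_def topspace_P1 by simp

lemma openin_P1_Some: "open U \<Longrightarrow> openin P1 (Some ` U)"
  unfolding openin_Alexandroff_compactification by auto

text \<open>The singleton of \<open>None\<close> is a Borel set, so the value at infinity imposes no
  condition. The proof sends \<open>None\<close> to 0 by a measurable map and then corrects the
  value at that single point.\<close>

lemma measurable_P1I:
  fixes G :: "complex option \<Rightarrow> real"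
  assumes "(\<lambda>z. G (Some z)) \<in> borel_measurable borel"
  shows "G \<in> borel_measurable P1_borel"
proof -
  have S: "Some ` U \<in> sets P1_borel" if "open U" for U
    using openin_P1_sets[OF openin_P1_Some[OF that]] .
  have "UNIV - range (Some :: complex \<Rightarrow> _) = {None}" by (auto simp: notin_range_Some)
  with sets.compl_sets[OF S[OF open_UNIV]] have N: "{None} \<in> sets P1_borel" by simp
  have t: "(\<lambda>x. case x of None \<Rightarrow> 0 | Some z \<Rightarrow> z) \<in> P1_borel \<rightarrow>\<^sub>M (borel :: complex measure)"
  proof (rule borel_measurableI)
    fix U :: "complex set" assume U: "open U"
    have "(\<lambda>x. case x of None \<Rightarrow> 0 | Some z \<Rightarrow> z) -` U = Some ` U \<union> (if 0 \<in> U then {None} else {})"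
      by (auto split: option.splits)
    then show "(\<lambda>x. case x of None \<Rightarrow> 0 | Some z \<Rightarrow> z) -` U \<inter> space P1_borel \<in> sets P1_borel"
      using S[OF U] sets.Un[OF N S[OF U]] by auto
  qed
  have "G = (\<lambda>x. if x \<in> {None} then G None else G (Some (case x of None \<Rightarrow> 0 | Some z \<Rightarrow> z)))"
    by (auto split: option.splits)
  moreover have "\<dots> \<in> borel_measurable P1_borel"
    by (rule measurable_If_set[OF _ measurable_compose[OF t assms]]) (use N in auto)
  ultimately show ?thesis by simp
qed

definition fiber_sum :: "complex poly \<Rightarrow> (complex option \<Rightarrow> real) \<Rightarrow> complex option \<Rightarrow> real" where
  "fiber_sum p \<phi> w = (\<Sum>z | P1_map p z = w. real (P1_mult p z) * \<phi> z)"

lemma pullback_eq: "pullback p \<nu> \<phi> = (\<integral>w. fiber_sum p \<phi> w \<partial>\<nu>)"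
  by (simp add: pullback_def fiber_sum_def)

lemma fiber_sum_None: "fiber_sum p \<phi> None = real (degree p) * \<phi> None"
proof -
  have "{z. P1_map p z = None} = {None}" by (auto simp: P1_map_def)
  then show ?thesis by (simp add: fiber_sum_def)
qed

lemma fiber_sum_Some:
  "fiber_sum p \<phi> (Some a) = (\<Sum>z | poly p z = a. real (order z (p - [:a:])) * \<phi> (Some z))"
proof -
  have "{z. P1_map p z = Some a} = Some ` {z. poly p z = a}" by (auto simp: P1_map_def)
  then show ?thesis by (simp add: fiber_sum_def sum.reindex)
qed

text \<open>By the fundamental theorem of algebra every fibre, including the one at infinity, has
  total multiplicity equal to the degree. So constants pass exactly through the normalised
  pullback.\<close>

lemma fiber_sum_const:
  assumes "degree p > 0"
  shows "fiber_sum p (\<lambda>_. c) w = real (degree p) * c"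
proof (cases w)
  case (Some a)
  have deg: "degree (p - [:a:]) = degree p"
    by (rule degree_diff_const[OF assms])
  then have "p - [:a:] \<noteq> 0" using assms by auto
  then have "fiber_sum p (\<lambda>_. c) (Some a) = (\<Sum>x\<in>#proots (p - [:a:]). c)"
    unfolding sum_mset_eq_sum_count by (simp add: fiber_sum_Some)
  then show ?thesis using Some deg by (simp add: size_proots_complex)
qed (simp add: fiber_sum_None)

lemma fiber_sum_diff: "fiber_sum p \<phi> w - fiber_sum p \<xi> w = fiber_sum p (\<lambda>x. \<phi> x - \<xi> x) w"
  by (simp add: fiber_sum_def sum_subtractf right_diff_distrib)

lemma fiber_sum_abs_le:
  assumes "degree p > 0" "\<And>x. \<bar>\<phi> x\<bar> \<le> c"
  shows "\<bar>fiber_sum p \<phi> w\<bar> \<le> real (degree p) * c"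
proof -
  have "\<bar>fiber_sum p \<phi> w\<bar> \<le> fiber_sum p (\<lambda>_. c) w"
    unfolding fiber_sum_def
    by (rule order_trans[OF sum_abs sum_mono]) (use assms(2) in \<open>auto simp: abs_mult intro: mult_left_mono\<close>)
  then show ?thesis by (simp add: fiber_sum_const[OF assms(1)])
qed

lemma fs_density_le_1: "fs_density 1 a \<le> 1"
proof -
  have "1 * 1 \<le> pi * ((norm a)\<^sup>2 + 1\<^sup>2)\<^sup>2"
    using pi_gt3 by (intro mult_mono one_le_power) auto
  then show ?thesis by (simp add: fs_density_def divide_le_eq)
qed

lemma integral_fubini_study:
  assumes "(\<lambda>z. G (Some z)) \<in> borel_measurable borel"
  shows "(\<integral>x. G x \<partial>fubini_study) = (LBINT a. G (Some a) * fs_density 1 a)"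
proof -
  have "(\<lambda>z. ennreal (1 / (pi * (1 + (norm z)\<^sup>2)\<^sup>2))) = (\<lambda>z. ennreal (fs_density 1 z))"
    by (simp add: fs_density_def add.commute)
  then have "(\<integral>x. G x \<partial>fubini_study) = (\<integral>a. G (Some a) \<partial>density lborel (\<lambda>z. ennreal (fs_density 1 z)))"
    unfolding fubini_study_def
    using measurable_P1I[OF assms] measurable_Some_P1 by (subst integral_distr) auto
  also have "\<dots> = (LBINT a. G (Some a) * fs_density 1 a)"
    using assms by (subst integral_real_density) (auto simp: fs_density_nonneg mult.commute)
  finally show ?thesis .
qed

section \<open>Potentials as test functions on the projective line\<close>

context fiber_test
begin

text \<open>The value 0 is the continuous extension of the potential to infinity, and it also
  matches \<open>u1\<close>, which vanishes there.\<close>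

abbreviation "P1_potential e \<equiv> case_option 0 (reg_potential e)"

abbreviation "u1 \<equiv> case_option 0 u"

lemma reg_potential_measurable [measurable]: "reg_potential e \<in> borel_measurable borel"
  unfolding reg_potential_def[abs_def] by measurable

lemma P1_potential_measurable: "P1_potential e \<in> borel_measurable P1_borel"
  by (intro measurable_P1I) simp

lemma fiber_sum_u1: "fiber_sum h u1 (Some a) = (LBINT z. ln (norm (a - poly h z)) * ddc u z)"
  by (simp add: fiber_sum_Some fiber_sum_eq)

lemma fiber_sum_u1_measurable [measurable]: "(\<lambda>a. fiber_sum h u1 (Some a)) \<in> borel_measurable borel"
  unfolding fiber_sum_u1 by measurable

text \<open>In the chart b = 1/a the kernel differs from the one of
  \<open>smooth_kernel_reg_log_infinity\<close> by -log |b|, which does not depend on z and is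
  cancelled by the vanishing integral of dd^c u. At b = 0 the remaining kernel is log 1 = 0.\<close>

lemma P1_smooth_potential:
  assumes e: "e > 0"
  shows "P1_smooth (P1_potential e)"
  unfolding P1_smooth_def
proof
  have "smooth (reg_potential e)"
    unfolding reg_potential_def[abs_def] by (rule smooth_kernel_smooth_integral[OF smooth_kernel_reg_log[OF e h_cont] \<psi>])
  then show "smooth (\<lambda>z. P1_potential e (Some z))" by (simp add: eta_contract_eq)
  let ?k = "\<lambda>z b. ln ((norm (poly h z * b - 1))\<^sup>2 + e\<^sup>2 * (norm b)\<^sup>2) / 2"
  have "P1_potential e (if b = 0 then None else Some (1 / b)) = (LBINT z. ?k z b * ddc u z)" for b
  proof (cases "b = 0")
    case False
    have "(norm (1 / b - poly h z))\<^sup>2 + e\<^sup>2 = ((norm (poly h z * b - 1))\<^sup>2 + e\<^sup>2 * (norm b)\<^sup>2) / (norm b)\<^sup>2" for z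
    proof -
      have "1 / b - poly h z = (1 - poly h z * b) / b" using False by (simp add: field_simps)
      then have "norm (1 / b - poly h z) = norm (poly h z * b - 1) / norm b"
        by (simp add: norm_divide norm_minus_commute)
      then show ?thesis using False by (simp add: power_divide add_divide_distrib)
    qed
    moreover have pos: "(norm (poly h z * b - 1))\<^sup>2 + e\<^sup>2 * (norm b)\<^sup>2 > 0" for z
      using e False by (intro add_nonneg_pos) auto
    ultimately have eq: "reg_log e (1 / b - poly h z) = ?k z b - ln (norm b)" for z
      using False less_imp_neq[OF pos[of z], symmetric] by (simp add: reg_log_def ln_div ln_realpow diff_divide_distrib)
    have "Cc (\<lambda>z. ?k z b * ddc u z)"
      by (intro Cc_mult[OF \<psi>] continuous_intros h_cont) (use pos in \<open>auto simp: less_imp_neq[THEN not_sym]\<close>)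
    from Cc_integrable[OF this] Cc_integrable[OF \<psi>] show ?thesis
      using False by (simp add: reg_potential_def eq left_diff_distrib integral_ddc_eq_0[OF u])
  qed simp
  then have "(\<lambda>b. P1_potential e (if b = 0 then None else Some (1 / b))) = (\<lambda>b. LBINT z. ?k z b * ddc u z)"
    by (rule ext)
  with smooth_kernel_smooth_integral[OF smooth_kernel_reg_log_infinity[OF e h_cont] \<psi>]
  show "smooth (\<lambda>z. P1_potential e (if z = 0 then None else Some (1 / z)))" by (simp only:)
qed

lemma ddc_reg_potential:
  assumes e: "e > 0"
  shows "ddc (reg_potential e) a = (LBINT z. fs_density e (a - poly h z) * ddc u z)"
  unfolding reg_potential_def[abs_def] by (rule ddc_integral_reg_log[OF e h_cont \<psi>])

text \<open>dd^c of the potential superposes translates of the probability density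
  \<open>fs_density e\<close> by the points h(z), with weights dd^c u(z). Each translate has L^1
  norm one whatever h and e are.\<close>

lemma integral_ddc_reg_potential:
  assumes e: "e > 0"
  shows "integrable lborel (ddc (reg_potential e))"
    and "(LBINT a. \<bar>ddc (reg_potential e) a\<bar>) \<le> mass"
proof -
  define f where "f z a = fs_density e (a - poly h z) * ddc u z" for z a
  have fm [measurable]: "(\<lambda>(z, a). f z a) \<in> borel_measurable (lborel \<Otimes>\<^sub>M lborel)"
    unfolding f_def by measurable
  have i: "integrable lborel (\<lambda>a. fs_density e (a - w))" "(LBINT a. fs_density e (a - w)) = 1" for w
    using integrable_lborel_shift[OF integrable_fs_density[OF e], of "- w"]
      integral_lborel_shift[OF fs_density_measurable, of e "- w"] integral_fs_density[OF e] by simp_all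
  have fb: "(LBINT a. \<bar>f z a\<bar>) \<le> \<bar>ddc u z\<bar>" and fi: "integrable lborel (f z)" for z
    using i by (simp_all add: f_def[abs_def] abs_mult fs_density_nonneg)
  have "ddc (reg_potential e) = (\<lambda>a. LBINT z. f z a)"
    by (simp add: fun_eq_iff ddc_reg_potential[OF e] f_def)
  with integral_swap_bound[OF fm fi fb Cc_integrable[OF Cc_abs[OF \<psi>]]]
  show "integrable lborel (ddc (reg_potential e))"
    "(LBINT a. \<bar>ddc (reg_potential e) a\<bar>) \<le> mass"
    by simp_all
qed

lemma fiber_sum_tendsto:
  "(\<lambda>n. P1_potential (1 / real (Suc n)) w) \<longlonglongrightarrow> fiber_sum h u1 w"
  using reg_potential_tendsto by (cases w) (auto simp: fiber_sum_None fiber_sum_Some)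

text \<open>Removes the regularisation: a bound uniform in e survives because the potentials are
  dominated by a constant, integrable for a probability measure. Used for the PB measure and for the
  disc.\<close>

lemma integral_fiber_sum_bound:
  assumes "prob_space M" and m: "\<And>e. P1_potential e \<in> borel_measurable M" "fiber_sum h u1 \<in> borel_measurable M"
    and bound: "\<And>e. 0 < e \<Longrightarrow> e \<le> 1 \<Longrightarrow> \<bar>(\<integral>w. P1_potential e w \<partial>M) - c\<bar> \<le> C"
  shows "\<bar>(\<integral>w. fiber_sum h u1 w \<partial>M) - c\<bar> \<le> C"
proof -
  interpret prob_space M by fact
  let ?B = "\<bar>fiber_bound\<bar>"
  have "(\<lambda>n. \<integral>w. P1_potential (1 / real (Suc n)) w \<partial>M) \<longlonglongrightarrow> (\<integral>w. fiber_sum h u1 w \<partial>M)"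
  proof (rule integral_dominated_convergence[where w = "\<lambda>_. ?B"])
    show "AE w in M. norm (P1_potential (1 / real (Suc n)) w) \<le> ?B" for n
    proof (rule AE_I2)
      fix w
      show "norm (P1_potential (1 / real (Suc n)) w) \<le> ?B"
        using reg_potential_bounded[of "1 / real (Suc n)"] by (cases w) (auto intro: order_trans[OF _ abs_ge_self])
    qed
  qed (use m fiber_sum_tendsto in auto)
  from tendsto_rabs[OF tendsto_diff[OF this tendsto_const[of c]]] show ?thesis
    by (rule LIMSEQ_le_const2) (use bound in auto)
qed

end

text \<open>The order of quantifiers is the point: \<open>C\<close> is chosen before h and u. Its
  part \<open>K\<close> compares the Fubini-Study average with the integral of
  \<open>log_plus\<close>, and \<open>H\<close> bounds the quasi-potential, paired with dd^c of the
  potential.\<close>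

lemma PB_integral_fiber_sum:
  assumes s: "sets \<nu> = sets P1_borel" and p: "prob_space \<nu>" and "PB \<nu>"
  obtains C where "\<And>h u. fiber_test h u \<Longrightarrow>
    \<bar>(\<integral>w. fiber_sum h (case_option 0 u) w \<partial>\<nu>) - (LBINT z. log_plus (poly h z) * ddc u z)\<bar>
      \<le> C * (LBINT z. \<bar>ddc u z\<bar>)"
proof -
  obtain \<eta> where \<eta>: "\<eta> \<in> borel_measurable P1_borel" "bounded (range \<eta>)"
    and PB: "\<And>\<phi>. P1_smooth \<phi> \<Longrightarrow> (\<integral>x. \<phi> x \<partial>\<nu>) = (\<integral>x. \<phi> x \<partial>fubini_study)
             + (LBINT z. \<eta> (Some z) * ddc (\<lambda>w. \<phi> (Some w)) z)"
    using \<open>PB \<nu>\<close> unfolding PB_def by blast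
  obtain H where H: "\<And>x. \<bar>\<eta> x\<bar> \<le> H" using \<eta>(2) by (auto simp: bounded_iff)
  have \<eta>m [measurable]: "(\<lambda>z. \<eta> (Some z)) \<in> borel_measurable borel"
    using measurable_compose[OF measurable_Some_P1 \<eta>(1)] .
  define K where "K = average_error (fs_density 1)"
  show ?thesis
  proof (rule that[of "K + H"])
    fix h u assume "fiber_test h u"
    then interpret fiber_test h u .
    have mnu: "borel_measurable \<nu> = (borel_measurable P1_borel :: (complex option \<Rightarrow> real) set)"
      by (rule measurable_cong_sets[OF s refl])
    show "\<bar>(\<integral>w. fiber_sum h u1 w \<partial>\<nu>) - mean\<bar> \<le> (K + H) * mass"
    proof (rule integral_fiber_sum_bound[OF p])
      show "P1_potential e \<in> borel_measurable \<nu>" for e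
        unfolding mnu by (rule P1_potential_measurable)
      show "fiber_sum h u1 \<in> borel_measurable \<nu>"
        unfolding mnu by (rule measurable_P1I) measurable
      fix e :: real assume e: "0 < e" "e \<le> 1"
      have "\<bar>LBINT z. \<eta> (Some z) * ddc (reg_potential e) z\<bar> \<le> (LBINT z. H * \<bar>ddc (reg_potential e) z\<bar>)"
      proof (rule integral_abs_bound_AE)
        have i: "integrable lborel (\<lambda>z. H * \<bar>ddc (reg_potential e) z\<bar>)"
          using integral_ddc_reg_potential(1)[OF e(1)] by auto
        have le: "\<bar>\<eta> (Some z) * ddc (reg_potential e) z\<bar> \<le> H * \<bar>ddc (reg_potential e) z\<bar>" for z
          using H by (simp add: abs_mult mult_right_mono)
        show "integrable lborel (\<lambda>z. H * \<bar>ddc (reg_potential e) z\<bar>)" by (rule i)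
        show "integrable lborel (\<lambda>z. \<eta> (Some z) * ddc (reg_potential e) z)"
          using borel_measurable_integrable[OF integral_ddc_reg_potential(1)[OF e(1)]] le
          by (intro Bochner_Integration.integrable_bound[OF i] AE_I2) (auto intro: order_trans[OF _ abs_ge_self])
        show "AE z in lborel. \<bar>\<eta> (Some z) * ddc (reg_potential e) z\<bar> \<le> H * \<bar>ddc (reg_potential e) z\<bar>"
          using le by simp
      qed
      also have "\<dots> \<le> H * mass"
        using integral_ddc_reg_potential(2)[OF e(1)] H[of None] by (simp add: mult_left_mono)
      finally have 1: "\<bar>LBINT z. \<eta> (Some z) * ddc (reg_potential e) z\<bar> \<le> H * mass" .
      have 2: "(\<integral>w. P1_potential e w \<partial>fubini_study) = (LBINT a. reg_potential e a * fs_density 1 a)"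
        by (subst integral_fubini_study) auto
      have 3: "\<bar>(LBINT a. reg_potential e a * fs_density 1 a) - mean\<bar> \<le> K * mass"
        unfolding K_def
        by (rule reg_potential_average[OF e fs_density_nonneg fs_density_le_1])
           (auto intro: integrable_fs_density integral_fs_density integrable_log_plus_fs_density)
      have "(\<integral>w. P1_potential e w \<partial>\<nu>) = (LBINT a. reg_potential e a * fs_density 1 a)
          + (LBINT z. \<eta> (Some z) * ddc (reg_potential e) z)"
        using PB[OF P1_smooth_potential[OF e(1)]] 2 by (simp add: eta_contract_eq)
      with 1 3 show "\<bar>(\<integral>w. P1_potential e w \<partial>\<nu>) - mean\<bar> \<le> (K + H) * mass"
        unfolding distrib_right by linarith
    qed
  qed
qed


section \<open>Growth of the derivatives of iterates\<close>

lemma log_plus_mult: "log_plus (x * y) \<le> log_plus x + log_plus y"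
proof -
  have "norm x * norm y \<le> max 1 (norm x) * max 1 (norm y)" by (intro mult_mono) auto
  moreover have "1 * 1 \<le> max 1 (norm x) * max 1 (norm y)" by (intro mult_mono) auto
  ultimately have "max 1 (norm (x * y)) \<le> max 1 (norm x) * max 1 (norm y)" by (simp add: norm_mult)
  then have "ln (max 1 (norm (x * y))) \<le> ln (max 1 (norm x) * max 1 (norm y))" by (intro ln_mono) auto
  moreover have "ln (A * B) = ln A + ln B" if "A > 0" "B > 0" for A B :: real
    using that by (simp add: ln_mult_pos)
  ultimately show ?thesis by (simp add: log_plus_def less_max_iff_disj)
qed

lemma log_plus_poly_le:
  obtains C where "\<And>w. log_plus (poly p w) \<le> real (degree p) * log_plus w + C"
proof -
  have "\<exists>C. \<forall>w. log_plus (poly p w) \<le> real (degree p) * log_plus w + C"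
  proof (induction p)
    case 0
    show ?case by (auto simp: log_plus_def intro: exI[of _ 0])
  next
    case (pCons a q)
    then obtain C where C: "\<And>w. log_plus (poly q w) \<le> real (degree q) * log_plus w + C" by blast
    show ?case
    proof (cases "q = 0")
      case True
      then show ?thesis by (intro exI[of _ "log_plus a"]) simp
    next
      case False
      have "log_plus (poly (pCons a q) w) \<le> real (degree (pCons a q)) * log_plus w + (C + log_plus a + ln 2)" for w
        using log_plus_add[of a "w * poly q w"] log_plus_mult[of w "poly q w"] C[of w] False
        by (simp add: algebra_simps)
      then show ?thesis by blast
    qed
  qed
  then show ?thesis using that by blast
qed

lemma poly_growth:
  assumes "p \<noteq> (0 :: complex poly)"
  obtains c R where "c > 0" "R \<ge> 1" "\<And>w. norm w \<ge> R \<Longrightarrow> norm (poly p w) \<ge> c * norm w ^ degree p"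
proof -
  have "\<exists>c>0. \<exists>R\<ge>1. \<forall>w. norm w \<ge> R \<longrightarrow> norm (poly p w) \<ge> c * norm w ^ degree p"
    using assms
  proof (induction p)
    case (pCons a q)
    show ?case
    proof (cases "q = 0")
      case True
      with pCons have "a \<noteq> 0" by simp
      then show ?thesis using True by (intro exI[of _ "norm a"] conjI exI[of _ 1]) auto
    next
      case False
      then obtain c R where c: "c > 0" "R \<ge> 1" "\<And>w. norm w \<ge> R \<Longrightarrow> norm (poly q w) \<ge> c * norm w ^ degree q"
        using pCons by blast
      have "norm (poly (pCons a q) w) \<ge> c / 2 * norm w ^ degree (pCons a q)"
        \<comment> \<open>Beyond this radius the constant coefficient costs at most half of the
          leading term.\<close>
        if w: "norm w \<ge> max R (2 * norm a / c)" for w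
      proof -
        have "norm w * (c * norm w ^ degree q) \<le> norm w * norm (poly q w)"
          using c(3)[of w] w by (intro mult_left_mono) auto
        moreover have "norm a \<le> c / 2 * norm w" using w c(1) by (simp add: field_simps)
        moreover have "c / 2 * norm w * 1 \<le> c / 2 * norm w * norm w ^ degree q"
          using c w by (intro mult_left_mono one_le_power) auto
        moreover have "norm (w * poly q w) \<le> norm (a + w * poly q w) + norm a"
          by (metis add.commute norm_add_leD norm_triangle_sub order_refl add_diff_cancel_left')
        ultimately show ?thesis using False by (simp add: norm_mult algebra_simps)
      qed
      then show ?thesis using c by (intro exI[of _ "c / 2"] conjI exI[of _ "max R (2 * norm a / c)"]) auto
    qed
  qed simp
  then show ?thesis using that by blast
qed

lemma ln_norm_poly_ge:
  assumes "p \<noteq> 0"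
  obtains C R where "R \<ge> 1" "\<And>w. norm w \<ge> R \<Longrightarrow> poly p w \<noteq> 0 \<and> ln (norm (poly p w)) \<ge> real (degree p) * log_plus w - C"
proof -
  obtain c R where c: "c > 0" "R \<ge> 1" "\<And>w. norm w \<ge> R \<Longrightarrow> norm (poly p w) \<ge> c * norm w ^ degree p"
    using poly_growth[OF assms] by blast
  have "poly p w \<noteq> 0 \<and> ln (norm (poly p w)) \<ge> real (degree p) * log_plus w - (- ln c)" if w: "norm w \<ge> R" for w
  proof -
    have "norm w > 0" using w c(2) by linarith
    then have pos: "c * norm w ^ degree p > 0" using c(1) by simp
    then have "ln (c * norm w ^ degree p) \<le> ln (norm (poly p w))" using c(3)[OF w] by (intro ln_mono) auto
    moreover have "ln (c * norm w ^ degree p) = ln c + real (degree p) * log_plus w"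
      using \<open>norm w > 0\<close> w c(1,2) by (simp add: ln_mult ln_realpow log_plus_def max_absorb2)
    ultimately show ?thesis using pos c(3)[OF w] by auto
  qed
  then show ?thesis using that c(2) by blast
qed

lemma log_plus_poly_ge:
  assumes "p \<noteq> 0"
  obtains C where "\<And>w. log_plus (poly p w) \<ge> real (degree p) * log_plus w - C"
proof -
  obtain C R where R: "R \<ge> 1" "\<And>w. norm w \<ge> R \<Longrightarrow> poly p w \<noteq> 0 \<and> ln (norm (poly p w)) \<ge> real (degree p) * log_plus w - C"
    by (rule ln_norm_poly_ge[OF assms]) blast
  have "log_plus (poly p w) \<ge> real (degree p) * log_plus w - (\<bar>C\<bar> + real (degree p) * ln R)" for w
  proof (cases "norm w \<ge> R")
    case True
    have "0 \<le> real (degree p) * ln R" using R by simp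
    then show ?thesis using R(2)[OF True] ln_norm_eq[of "poly p w"] log_minus_nonneg[of "poly p w"] by linarith
  next
    case False
    then have "log_plus w \<le> ln R" unfolding log_plus_def using R by (intro ln_mono) auto
    then have "real (degree p) * log_plus w \<le> real (degree p) * ln R" by (intro mult_left_mono) auto
    then show ?thesis using log_plus_nonneg[of "poly p w"] by linarith
  qed
  then show ?thesis using that by blast
qed

section \<open>Escape to infinity, the Green function and the chain rule\<close>

locale dynamics =
  fixes f :: "complex poly"
  assumes degree_f: "degree f \<ge> 2"
begin

definition "d = real (degree f)"

lemma d: "d \<ge> 2" using degree_f by (simp add: d_def)

lemma degree_poly_iterate: "degree (poly_iterate f n) = degree f ^ n"
  by (induction n) (auto simp: poly_iterate_def degree_pcompose)

abbreviation "df n \<equiv> pderiv (poly_iterate f n)"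

lemma degree_df: "degree (df n) = degree f ^ n - 1"
  by (simp add: degree_pderiv degree_poly_iterate)

lemma df_neq_0: "df n \<noteq> 0"
  unfolding pderiv_eq_0_iff degree_poly_iterate using degree_f by simp

lemma poly_df_Suc: "poly (df (Suc n)) z = poly (pderiv f) ((poly f ^^ n) z) * poly (df n) z"
proof -
  have "poly_iterate f (Suc n) = pcompose f (poly_iterate f n)" by (simp add: poly_iterate_def)
  then show ?thesis by (simp add: pderiv_pcompose poly_pcompose poly_poly_iterate)
qed

lemma poly_df_0: "poly (df 0) z = 1"
  by (simp add: poly_iterate_def pderiv_pCons)

text \<open>Confines all fibres of the derivatives over the unit disc to one fixed disc, the
  compactness needed for a weak limit. Far out, f does not decrease the modulus and f' has modulus
  at least 2, so the chain rule gives at least 2^n.\<close>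

lemma escape_radius:
  obtains R where "\<And>n z. n > 0 \<Longrightarrow> norm z \<ge> R \<Longrightarrow> norm (poly (df n) z) \<ge> 2"
proof -
  \<comment> \<open>Giving up one degree buys an arbitrary constant K, as soon as |w| is at least
    K/c.\<close>
  have growth: "\<exists>R\<ge>1. \<forall>w. norm w \<ge> R \<longrightarrow> norm (poly p w) \<ge> K * norm w ^ (degree p - 1)"
    if p: "degree p > 0" for p :: "complex poly" and K
  proof -
    have "p \<noteq> 0" using p by auto
    then obtain c R where c: "c > 0" "R \<ge> 1" "\<And>w. norm w \<ge> R \<Longrightarrow> norm (poly p w) \<ge> c * norm w ^ degree p"
      using poly_growth by blast
    have "norm (poly p w) \<ge> K * norm w ^ (degree p - 1)" if w: "norm w \<ge> max R (K / c)" for w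
    proof -
      have "K \<le> c * norm w" using w c by (simp add: field_simps)
      then have "K * norm w ^ (degree p - 1) \<le> c * norm w * norm w ^ (degree p - 1)"
        by (intro mult_right_mono) auto
      also have "\<dots> = c * norm w ^ degree p" using p by (simp add: power_eq_if)
      finally show ?thesis using c(3)[of w] w by linarith
    qed
    then show ?thesis using c(2) by (intro exI[of _ "max R (K / c)"]) auto
  qed
  obtain R1 where R1: "R1 \<ge> 1" "\<And>w. norm w \<ge> R1 \<Longrightarrow> norm (poly f w) \<ge> 1 * norm w ^ (degree f - 1)"
    using growth[of f 1] degree_f by auto
  obtain R2 where R2: "R2 \<ge> 1" "\<And>w. norm w \<ge> R2 \<Longrightarrow> norm (poly (pderiv f) w) \<ge> 2 * norm w ^ (degree (pderiv f) - 1)"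
    using growth[of "pderiv f" 2] degree_f by (auto simp: degree_pderiv)
  define R where "R = max R1 R2"
  have f: "norm (poly f w) \<ge> R" if "norm w \<ge> R" for w
  proof -
    have "norm w ^ 1 \<le> norm w ^ (degree f - 1)"
      using that R1 degree_f by (intro power_increasing) (auto simp: R_def)
    then show ?thesis using R1(2)[of w] that by (simp add: R_def)
  qed
  have f': "norm (poly (pderiv f) w) \<ge> 2" if "norm w \<ge> R" for w
  proof -
    have "1 \<le> norm w ^ (degree (pderiv f) - 1)"
      using that R2 by (intro one_le_power) (auto simp: R_def)
    then show ?thesis using R2(2)[of w] that by (simp add: R_def)
  qed
  have "norm ((poly f ^^ n) z) \<ge> R \<and> norm (poly (df n) z) \<ge> 2 ^ n" if "norm z \<ge> R" for n z
    using that
  proof (induction n)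
    case (Suc n)
    then show ?case
      using f[of "(poly f ^^ n) z"] mult_mono[OF f' , of "(poly f ^^ n) z" "2 ^ n" "norm (poly (df n) z)"]
      by (auto simp: poly_df_Suc norm_mult)
  qed (simp add: poly_df_0)
  moreover have "(2::real) ^ 1 \<le> 2 ^ n" if "n > 0" for n :: nat
    using that by (intro power_increasing) auto
  ultimately show ?thesis by (intro that[of R]) (metis order_trans power_one_right)
qed

definition "g n z = log_plus ((poly f ^^ n) z) / d ^ n"

text \<open>A single application of f changes \<open>log_plus\<close> from d times its value by a
  bounded error. After division by powers of d the errors telescope, and adding or subtracting C/d^n
  makes the sequence monotone, which gives the limit and its rate together.\<close>

lemma green_estimate:
  obtains C where "C \<ge> 0" "\<And>z. (\<lambda>n. g n z) \<longlonglongrightarrow> green f z"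
    "\<And>n z. \<bar>log_plus ((poly f ^^ n) z) - d ^ n * green f z\<bar> \<le> C"
proof -
  obtain C1 where C1: "\<And>w. log_plus (poly f w) \<le> d * log_plus w + C1"
    using log_plus_poly_le[of f] unfolding d_def by blast
  have "f \<noteq> 0" using degree_f by auto
  then obtain C2 where C2: "\<And>w. log_plus (poly f w) \<ge> d * log_plus w - C2"
    using log_plus_poly_ge[of f] unfolding d_def by blast
  define C where "C = max \<bar>C1\<bar> \<bar>C2\<bar>"
  have C: "C \<ge> 0" "\<bar>log_plus (poly f w) - d * log_plus w\<bar> \<le> C" for w
    using C1[of w] C2[of w] by (auto simp: C_def)
  have dn: "d ^ n > 0" for n using d by simp
  have step: "\<bar>g (Suc n) z - g n z\<bar> \<le> C / d ^ n - C / d ^ Suc n" for n z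
  proof -
    have "g (Suc n) z - g n z = (log_plus (poly f ((poly f ^^ n) z)) - d * log_plus ((poly f ^^ n) z)) / d ^ Suc n"
      using d by (simp add: g_def field_simps)
    then have "\<bar>g (Suc n) z - g n z\<bar> \<le> C / d ^ Suc n"
      using C(2) d by (simp add: abs_divide divide_right_mono del: power_Suc)
    \<comment> \<open>Here d at least 2 is used, to put the error into telescoping form.\<close>
    also have "\<dots> \<le> C / d ^ n - C / d ^ Suc n"
    proof -
      have "C * 2 \<le> C * d" using C(1) d by (intro mult_left_mono) auto
      then show ?thesis using d dn[of n] by (simp add: field_simps)
    qed
    finally show ?thesis .
  qed
  have lim0: "(\<lambda>n. C / d ^ n) \<longlonglongrightarrow> 0"
    using d by real_asymp
  have conv: "\<exists>L. (\<lambda>n. g n z) \<longlonglongrightarrow> L \<and> (\<forall>n. \<bar>g n z - L\<bar> \<le> C / d ^ n)" for z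
  proof -
    have "decseq (\<lambda>n. g n z + C / d ^ n)"
      using step[of _ z] unfolding decseq_Suc_iff abs_le_iff by (simp add: algebra_simps)
    moreover have "0 \<le> g n z + C / d ^ n" for n
      using C(1) dn[of n] log_plus_nonneg by (simp add: g_def)
    ultimately obtain L where L: "(\<lambda>n. g n z + C / d ^ n) \<longlonglongrightarrow> L" "\<And>n. L \<le> g n z + C / d ^ n"
      using decseq_convergent[of "\<lambda>n. g n z + C / d ^ n" 0] by blast
    from tendsto_diff[OF L(1) lim0] have gL: "(\<lambda>n. g n z) \<longlonglongrightarrow> L" by simp
    have "incseq (\<lambda>n. g n z - C / d ^ n)"
      using step[of _ z] unfolding incseq_Suc_iff abs_le_iff by (simp add: algebra_simps)
    moreover have "(\<lambda>n. g n z - C / d ^ n) \<longlonglongrightarrow> L" using tendsto_diff[OF gL lim0] by simp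
    ultimately have "g n z - C / d ^ n \<le> L" for n by (rule incseq_le)
    with L(2) have "\<bar>g n z - L\<bar> \<le> C / d ^ n" for n
      unfolding abs_le_iff by (simp add: algebra_simps)
    with gL show ?thesis by blast
  qed
  have gr: "green f z = lim (\<lambda>n. g n z)" for z
    by (simp add: green_def g_def log_plus_def d_def)
  have *: "(\<lambda>n. g n z) \<longlonglongrightarrow> green f z \<and> (\<forall>n. \<bar>g n z - green f z\<bar> \<le> C / d ^ n)" for z
    using conv[of z] limI unfolding gr by metis
  have "\<bar>log_plus ((poly f ^^ n) z) - d ^ n * green f z\<bar> \<le> C" for n z
  proof -
    have "log_plus ((poly f ^^ n) z) - d ^ n * green f z = d ^ n * (g n z - green f z)"
      using d by (simp add: g_def right_diff_distrib)
    then have "\<bar>log_plus ((poly f ^^ n) z) - d ^ n * green f z\<bar> = d ^ n * \<bar>g n z - green f z\<bar>"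
      using dn[of n] by (simp add: abs_mult)
    also have "\<dots> \<le> d ^ n * (C / d ^ n)" using * dn[of n] by (intro mult_left_mono) auto
    finally show ?thesis using d by simp
  qed
  with * C(1) show ?thesis using that by blast
qed

lemma green_nonneg: "green f z \<ge> 0"
proof -
  obtain C where "(\<lambda>n. g n z) \<longlonglongrightarrow> green f z" using green_estimate by metis
  then show ?thesis
    by (rule LIMSEQ_le_const) (use d log_plus_nonneg in \<open>auto simp: g_def\<close>)
qed

lemma green_measurable [measurable]: "green f \<in> borel_measurable borel"
proof -
  obtain C where "\<And>z. (\<lambda>n. g n z) \<longlonglongrightarrow> green f z" using green_estimate by metis
  moreover have "g n \<in> borel_measurable borel" for n
    unfolding g_def poly_poly_iterate[symmetric] by measurable
  ultimately show ?thesis by (rule borel_measurable_LIMSEQ_real)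
qed

lemma n_div_bounds:
  "(\<lambda>n. 1 / (d ^ n - 1)) \<longlonglongrightarrow> 0" "(\<lambda>n. real n / (d ^ n - 1)) \<longlonglongrightarrow> 0"
  "n > 0 \<Longrightarrow> d ^ n - 1 > 0" "0 \<le> real n / (d ^ n - 1)" "real n / (d ^ n - 1) \<le> 1"
proof -
  have ge: "d ^ n \<ge> 2 ^ n" for n using d by (intro power_mono) auto
  have n2: "real n + 1 \<le> 2 ^ n" for n
    using Bernoulli_inequality[of "1::real" n] by simp
  have pos: "d ^ n - 1 > 0" if "n > 0" for n
    using ge[of n] n2[of n] that by linarith
  then show "n > 0 \<Longrightarrow> d ^ n - 1 > 0" .
  show "0 \<le> real n / (d ^ n - 1)" using pos[of n] by (cases "n = 0") auto
  show "real n / (d ^ n - 1) \<le> 1"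
    using pos[of n] ge[of n] n2[of n] by (cases "n = 0") auto
  show "(\<lambda>n. 1 / (d ^ n - 1)) \<longlonglongrightarrow> 0" "(\<lambda>n. real n / (d ^ n - 1)) \<longlonglongrightarrow> 0"
    using d by real_asymp+
qed

text \<open>The chain rule contributes (d - 1) d^k times the Green function at step k, which sums to
  d^n - 1. Each step also costs a bounded error, and n such errors are negligible against
  d^n.\<close>

lemma log_plus_df_le:
  obtains C where "C \<ge> 0" "\<And>n z. log_plus (poly (df n) z) \<le> (d ^ n - 1) * green f z + real n * C"
proof -
  obtain C1 where C1: "C1 \<ge> 0" "\<And>n z. \<bar>log_plus ((poly f ^^ n) z) - d ^ n * green f z\<bar> \<le> C1"
    using green_estimate by metis
  obtain C2 where C2: "\<And>w. log_plus (poly (pderiv f) w) \<le> real (degree (pderiv f)) * log_plus w + C2"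
    using log_plus_poly_le by blast
  have deg: "real (degree (pderiv f)) = d - 1" using degree_f by (simp add: degree_pderiv d_def of_nat_diff)
  define C where "C = (d - 1) * C1 + \<bar>C2\<bar>"
  have "log_plus (poly (df n) z) \<le> (d ^ n - 1) * green f z + real n * C" for n z
  proof (induction n)
    case 0
    then show ?case by (simp add: poly_df_0 log_plus_def)
  next
    case (Suc n)
    have "log_plus ((poly f ^^ n) z) \<le> d ^ n * green f z + C1" using C1(2)[of n z] by linarith
    then have "(d - 1) * log_plus ((poly f ^^ n) z) \<le> (d - 1) * (d ^ n * green f z + C1)"
      using d by (intro mult_left_mono) auto
    then have "log_plus (poly (pderiv f) ((poly f ^^ n) z)) \<le> (d - 1) * (d ^ n * green f z) + C"
      using C2[of "(poly f ^^ n) z"] by (simp add: deg C_def algebra_simps)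
    then have "log_plus (poly (df (Suc n)) z) \<le> ((d - 1) * (d ^ n * green f z) + C) + ((d ^ n - 1) * green f z + real n * C)"
      using log_plus_mult[of "poly (pderiv f) ((poly f ^^ n) z)" "poly (df n) z"] Suc unfolding poly_df_Suc by linarith
    then show ?case by (simp add: algebra_simps)
  qed
  moreover have "C \<ge> 0" using C1(1) d by (simp add: C_def)
  ultimately show ?thesis using that by blast
qed

text \<open>If the Green function vanishes, the quotient is squeezed between 0 and the upper bound.
  Otherwise the orbit eventually stays where |f'| is comparable to the power d - 1 of the modulus,
  and the chain rule yields a lower bound from that time on. The hypothesis \<open>nz\<close> lets
  the logarithm of the product split.\<close>

lemma log_plus_df_tendsto:
  assumes nz: "\<And>n. poly (df n) z \<noteq> 0"
  shows "(\<lambda>n. log_plus (poly (df n) z) / (d ^ n - 1)) \<longlonglongrightarrow> green f z"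
proof -
  note lims = n_div_bounds(1,2)
  obtain C where C: "C \<ge> 0" "\<And>n z. log_plus (poly (df n) z) \<le> (d ^ n - 1) * green f z + real n * C"
    using log_plus_df_le by metis
  have up: "\<forall>\<^sub>F n in sequentially. log_plus (poly (df n) z) / (d ^ n - 1) \<le> green f z + C * (real n / (d ^ n - 1))"
    using eventually_gt_at_top[of 0]
  proof eventually_elim
    case (elim n)
    then have p: "d ^ n - 1 > 0" by (rule n_div_bounds(3))
    have "log_plus (poly (df n) z) / (d ^ n - 1) \<le> ((d ^ n - 1) * green f z + real n * C) / (d ^ n - 1)"
      using C(2) p by (intro divide_right_mono) auto
    also have "\<dots> = green f z + C * (real n / (d ^ n - 1))" using p by (simp add: add_divide_distrib)
    finally show ?case .
  qed
  have uplim: "(\<lambda>n. green f z + C * (real n / (d ^ n - 1))) \<longlonglongrightarrow> green f z"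
    using tendsto_add[OF tendsto_const tendsto_mult[OF tendsto_const lims(2)], of "green f z" C] by simp
  show ?thesis
  proof (cases "green f z = 0")
    case True
    have "\<forall>\<^sub>F n in sequentially. 0 \<le> log_plus (poly (df n) z) / (d ^ n - 1)"
      using eventually_gt_at_top[of 0]
    proof eventually_elim
      case (elim n)
      then show ?case using log_plus_nonneg n_div_bounds(3)[of n] by simp
    qed
    from tendsto_sandwich[OF this up] uplim True show ?thesis by simp
  next
    case False
    then have pos: "green f z > 0" using green_nonneg[of z] by linarith
    obtain C1 where C1: "C1 \<ge> 0" "\<And>n z. \<bar>log_plus ((poly f ^^ n) z) - d ^ n * green f z\<bar> \<le> C1"
      using green_estimate by metis
    have "degree (pderiv f) \<noteq> 0" using degree_f by (simp add: degree_pderiv)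
    then have "pderiv f \<noteq> 0" by auto
    then obtain c R where R: "R \<ge> 1" "\<And>w. norm w \<ge> R \<Longrightarrow> poly (pderiv f) w \<noteq> 0 \<and>
        ln (norm (poly (pderiv f) w)) \<ge> real (degree (pderiv f)) * log_plus w - c"
      by (rule ln_norm_poly_ge) blast
    have deg: "real (degree (pderiv f)) = d - 1" using degree_f by (simp add: degree_pderiv d_def of_nat_diff)
    \<comment> \<open>R + 1 rather than R, so that the maximum with 1 in \<open>log_plus\<close> is
      certainly attained by the modulus, even for R = 1.\<close>
    obtain J where "(C1 + ln (R + 1)) / green f z < d ^ J"
      using real_arch_pow[of d] d by auto
    then have J: "d ^ n \<ge> (C1 + ln (R + 1)) / green f z" if "n \<ge> J" for n
      using power_increasing[OF that, of d] d by linarith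
    have large: "norm ((poly f ^^ n) z) \<ge> R" if "n \<ge> J" for n
    proof -
      have "C1 + ln (R + 1) \<le> d ^ n * green f z" using J[OF that] pos by (simp add: field_simps)
      then have "ln (R + 1) \<le> log_plus ((poly f ^^ n) z)" using C1(2)[of n z] by linarith
      then have "R + 1 \<le> max 1 (norm ((poly f ^^ n) z))"
        unfolding log_plus_def using R(1) by (subst (asm) ln_le_cancel_iff) auto
      then show ?thesis using R(1) by linarith
    qed
    define C4 where "C4 = (d - 1) * C1 + c"
    \<comment> \<open>The deficit in the lower bound, with the accumulated errors added back so that
      it cannot decrease after time J.\<close>
    define y where "y n = ln (norm (poly (df n) z)) - d ^ n * green f z + real n * C4" for n
    have step: "y n \<le> y (Suc n)" if "n \<ge> J" for n
    proof -
      let ?w = "(poly f ^^ n) z"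
      have "d ^ n * green f z - C1 \<le> log_plus ?w" using C1(2)[of n z] by linarith
      then have "(d - 1) * (d ^ n * green f z - C1) \<le> (d - 1) * log_plus ?w"
        using d by (intro mult_left_mono) auto
      then have "ln (norm (poly (pderiv f) ?w)) \<ge> (d - 1) * (d ^ n * green f z) - C4"
        using R(2)[OF large[OF that]] by (simp add: deg C4_def algebra_simps)
      moreover have "ln (norm (poly (df (Suc n)) z)) = ln (norm (poly (pderiv f) ?w)) + ln (norm (poly (df n) z))"
        unfolding poly_df_Suc using R(2)[OF large[OF that]] nz[of n] by (simp add: norm_mult ln_mult)
      ultimately show ?thesis unfolding y_def by (simp add: algebra_simps)
    qed
    have ge: "y n \<ge> y J" if "n \<ge> J" for n
      using that by (induction rule: dec_induct) (use step in \<open>auto intro: order_trans\<close>)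
    have low: "\<forall>\<^sub>F n in sequentially. green f z + (green f z + y J) * (1 / (d ^ n - 1)) - C4 * (real n / (d ^ n - 1))
        \<le> log_plus (poly (df n) z) / (d ^ n - 1)"
      using eventually_gt_at_top[of 0] eventually_ge_at_top[of J]
    proof eventually_elim
      case (elim n)
      have p: "d ^ n - 1 > 0" using n_div_bounds(3) elim by simp
      have "d ^ n * green f z - real n * C4 + y J \<le> log_plus (poly (df n) z)"
        using ge[of n] elim ln_norm_eq[of "poly (df n) z"] log_minus_nonneg[of "poly (df n) z"] unfolding y_def by linarith
      then have "(d ^ n * green f z - real n * C4 + y J) / (d ^ n - 1) \<le> log_plus (poly (df n) z) / (d ^ n - 1)"
        using p by (intro divide_right_mono) auto
      moreover have "(d ^ n * green f z - real n * C4 + y J) / (d ^ n - 1)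
          = green f z + (green f z + y J) * (1 / (d ^ n - 1)) - C4 * (real n / (d ^ n - 1))"
      proof -
        have "d ^ n * green f z - real n * C4 + y J = (d ^ n - 1) * green f z + ((green f z + y J) - C4 * real n)"
          by (simp add: algebra_simps)
        then show ?thesis using p by (simp add: add_divide_distrib diff_divide_distrib)
      qed
      ultimately show ?case by simp
    qed
    have "(\<lambda>n. green f z + (green f z + y J) * (1 / (d ^ n - 1)) - C4 * (real n / (d ^ n - 1)))
        \<longlonglongrightarrow> green f z + (green f z + y J) * 0 - C4 * 0"
      by (intro tendsto_intros lims)
    then show ?thesis by (intro tendsto_sandwich[OF low up _ uplim]) simp
  qed
qed

text \<open>The estimate for the zeroth iterate bounds the Green function by \<open>log_plus\<close>
  plus a constant.\<close>

lemma integrable_green: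
  assumes "Cc \<psi>"
  shows "integrable lborel (\<lambda>z. green f z * \<psi> z)"
proof -
  obtain C where C: "\<And>n z. \<bar>log_plus ((poly f ^^ n) z) - d ^ n * green f z\<bar> \<le> C"
    using green_estimate by metis
  note [measurable] = Cc_measurable[OF assms]
  have i: "integrable lborel (\<lambda>z. (log_plus z + C) * \<psi> z)"
    by (intro Cc_integrable Cc_mult assms continuous_intros log_plus_continuous)
  show ?thesis
  proof (rule Bochner_Integration.integrable_bound[OF i])
    have "\<bar>green f z\<bar> \<le> \<bar>log_plus z + C\<bar>" for z
      using C[of 0 z] green_nonneg[of z] by simp
    then show "AE z in lborel. norm (green f z * \<psi> z) \<le> norm ((log_plus z + C) * \<psi> z)"
      by (intro AE_I2) (auto simp: abs_mult intro: mult_right_mono)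
  qed measurable
qed

lemma integral_log_plus_df_tendsto:
  assumes \<psi>: "Cc \<psi>"
  shows "(\<lambda>n. (LBINT z. log_plus (poly (df n) z) * \<psi> z) / (d ^ n - 1)) \<longlonglongrightarrow> (LBINT z. green f z * \<psi> z)"
proof -
  note [measurable] = Cc_measurable[OF \<psi>]
  obtain C where C: "C \<ge> 0" "\<And>n z. log_plus (poly (df n) z) \<le> (d ^ n - 1) * green f z + real n * C"
    using log_plus_df_le by metis
  have "(\<lambda>n. LBINT z. log_plus (poly (df n) z) / (d ^ n - 1) * \<psi> z) \<longlonglongrightarrow> (LBINT z. green f z * \<psi> z)"
  proof (rule integral_dominated_convergence[where w = "\<lambda>z. green f z * \<bar>\<psi> z\<bar> + C * \<bar>\<psi> z\<bar>"])
    show "integrable lborel (\<lambda>z. green f z * \<bar>\<psi> z\<bar> + C * \<bar>\<psi> z\<bar>)"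
      by (intro Bochner_Integration.integrable_add integrable_green Cc_abs \<psi> integrable_mult_right Cc_integrable)
    have "AE z in lborel. \<forall>n. poly (df n) z \<noteq> 0"
      unfolding AE_all_countable using AE_poly_neq_0[OF df_neq_0] by blast
    then show "AE z in lborel. (\<lambda>n. log_plus (poly (df n) z) / (d ^ n - 1) * \<psi> z) \<longlonglongrightarrow> green f z * \<psi> z"
    proof eventually_elim
      case (elim z)
      then show ?case by (intro tendsto_mult log_plus_df_tendsto tendsto_const) auto
    qed
    show "AE z in lborel. norm (log_plus (poly (df n) z) / (d ^ n - 1) * \<psi> z) \<le> green f z * \<bar>\<psi> z\<bar> + C * \<bar>\<psi> z\<bar>" for n
    proof (rule AE_I2)
      fix z
      have "\<bar>log_plus (poly (df n) z) / (d ^ n - 1)\<bar> \<le> green f z + C"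
      proof (cases "n = 0")
        case False
        then have p: "d ^ n - 1 > 0" using n_div_bounds(3) by simp
        have "log_plus (poly (df n) z) / (d ^ n - 1) \<le> ((d ^ n - 1) * green f z + real n * C) / (d ^ n - 1)"
          using C(2) p by (intro divide_right_mono) auto
        also have "\<dots> = green f z + C * (real n / (d ^ n - 1))" using p by (simp add: field_simps)
        also have "\<dots> \<le> green f z + C * 1"
          using C(1) n_div_bounds(5)[of n] by (intro add_left_mono mult_left_mono)
        finally show ?thesis using p log_plus_nonneg[of "poly (df n) z"] by simp
      qed (use C(1) green_nonneg in auto)
      from mult_right_mono[OF this, of "\<bar>\<psi> z\<bar>"]
      show "norm (log_plus (poly (df n) z) / (d ^ n - 1) * \<psi> z) \<le> green f z * \<bar>\<psi> z\<bar> + C * \<bar>\<psi> z\<bar>"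
        by (simp add: abs_mult distrib_right)
    qed
  qed measurable
  then show ?thesis by simp
qed

end


section \<open>Test functions\<close>

lemma smooth_kernel_polynomial: "real_polynomial_function g \<Longrightarrow> smooth_kernel (\<lambda>z a. g a)"
  by (induction rule: real_polynomial_function.induct) (auto intro: smooth_kernel.intros smooth_kernel_const)

lemma flat_1: "flat 1 e x = (if x > 0 then exp (- e / x) else 0)"
  by (simp add: flat_def)

lemma flat_1_bounds: "e > 0 \<Longrightarrow> 0 \<le> flat 1 e x" "e > 0 \<Longrightarrow> flat 1 e x \<le> 1"
  by (auto simp: flat_1 divide_nonneg_pos)

lemma flat_1_tendsto: "(\<lambda>n. flat 1 (1 / real (Suc n)) x) \<longlonglongrightarrow> indicator {0<..} x"
proof (cases "x > 0")
  case True
  have "(\<lambda>n. exp (- (1 / real (Suc n)) / x)) \<longlonglongrightarrow> exp (- 0 / x)"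
    using LIMSEQ_inverse_real_of_nat True
    by (intro tendsto_intros) (auto simp: inverse_eq_divide)
  then show ?thesis using True by (simp add: flat_1)
qed (simp add: flat_1)

text \<open>A product of four one-sided cut-offs, positive exactly on the open box; these test
  functions recover the measure of the box.\<close>

definition box_bump :: "complex \<Rightarrow> complex \<Rightarrow> nat \<Rightarrow> complex \<Rightarrow> real" where
  "box_bump p q n z = flat 1 (1 / real (Suc n)) (Re z - Re p) * flat 1 (1 / real (Suc n)) (Re q - Re z) *
     (flat 1 (1 / real (Suc n)) (Im z - Im p) * flat 1 (1 / real (Suc n)) (Im q - Im z))"

lemma box_bump_eq_0: "z \<notin> box p q \<Longrightarrow> box_bump p q n z = 0"
  by (auto simp: box_bump_def flat_1 in_box_complex_iff)

lemma box_bump_smooth: "smooth (box_bump p q n)"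
proof -
  have "smooth_kernel (\<lambda>z a. box_bump p q n a)" unfolding box_bump_def
    by (intro smooth_kernel_intros smooth_kernel.flat) auto
  then show ?thesis using smooth_kernel_smooth by fastforce
qed

lemma box_bump_Cc: "Cc (box_bump p q n)"
proof -
  obtain R where "\<And>z. z \<in> box p q \<Longrightarrow> norm z \<le> R"
    using bounded_box[of p q] by (auto simp: bounded_iff)
  then have "box_bump p q n z = 0" if "R < norm z" for z
    using that box_bump_eq_0[of z p q n] by force
  then show ?thesis unfolding Cc_def using smooth_continuous[OF box_bump_smooth] by blast
qed

lemma box_bump_bounds: "0 \<le> box_bump p q n z" "box_bump p q n z \<le> 1"
  unfolding box_bump_def by (auto intro!: mult_nonneg_nonneg mult_le_one flat_1_bounds)

lemma box_bump_tendsto: "(\<lambda>n. box_bump p q n z) \<longlonglongrightarrow> indicator (box p q) z"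
proof -
  have "(\<lambda>n. box_bump p q n z) \<longlonglongrightarrow> indicator {0<..} (Re z - Re p) * indicator {0<..} (Re q - Re z) *
      (indicator {0<..} (Im z - Im p) * indicator {0<..} (Im q - Im z))"
    unfolding box_bump_def by (intro tendsto_mult flat_1_tendsto)
  also have "indicator {0<..} (Re z - Re p) * indicator {0<..} (Re q - Re z) *
      (indicator {0<..} (Im z - Im p) * indicator {0<..} (Im q - Im z)) = (indicator (box p q) z :: real)"
    by (auto simp: indicator_def in_box_complex_iff)
  finally show ?thesis .
qed

lemma integral_box_bump_tendsto:
  assumes "prob_space M" "sets M = sets borel"
  shows "(\<lambda>n. \<integral>z. box_bump p q n z \<partial>M) \<longlonglongrightarrow> measure M (box p q)"
proof -
  interpret prob_space M by fact
  have mM: "borel_measurable M = (borel_measurable borel :: (complex \<Rightarrow> real) set)"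
    by (rule measurable_cong_sets[OF assms(2) refl])
  have "(\<lambda>n. \<integral>z. box_bump p q n z \<partial>M) \<longlonglongrightarrow> (\<integral>z. indicator (box p q) z \<partial>M)"
  proof (rule integral_dominated_convergence[where w = "\<lambda>_. 1"])
    show "box_bump p q n \<in> borel_measurable M" for n unfolding mM by (rule Cc_measurable[OF box_bump_Cc])
    show "(indicator (box p q) :: complex \<Rightarrow> real) \<in> borel_measurable M" unfolding mM by simp
  qed (use box_bump_bounds box_bump_tendsto in auto)
  then show ?thesis using assms(2) by simp
qed

lemma sets_borel_box: "sets borel = sigma_sets UNIV (range (\<lambda>(a, b). box a (b :: complex)))"
  unfolding borel_eq_box by simp

lemma Int_stable_box: "Int_stable (range (\<lambda>(a, b). box a (b :: complex)))"
  by (auto simp: Int_stable_def box_Int_box)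

text \<open>Bumps determine the measures of open boxes, and boxes form an intersection-stable
  generator of the Borel sets. This gives the uniqueness of the equilibrium measure.\<close>

lemma prob_measure_eqI:
  fixes M N :: "complex measure"
  assumes M: "prob_space M" "sets M = sets borel" and N: "prob_space N" "sets N = sets borel"
    and eq: "\<And>u. smooth u \<Longrightarrow> Cc u \<Longrightarrow> (\<integral>z. u z \<partial>M) = (\<integral>z. u z \<partial>N)"
  shows "M = N"
proof (rule measure_eqI_generator_eq[OF Int_stable_box, where \<Omega> = UNIV and A = "\<lambda>n. box (- (real n *\<^sub>R One)) (real n *\<^sub>R One)"])
  interpret M: prob_space M by fact
  interpret N: prob_space N by fact
  have "measure M (box p q) = measure N (box p q)" for p q
    using LIMSEQ_unique[OF integral_box_bump_tendsto[OF M, of p q]] integral_box_bump_tendsto[OF N, of p q]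
    by (simp add: eq[OF box_bump_smooth box_bump_Cc])
  then show "emeasure M X = emeasure N X" if "X \<in> range (\<lambda>(a, b). box a b)" for X
    using that by (auto simp: M.emeasure_eq_measure N.emeasure_eq_measure)
  show "emeasure M (box (- (real i *\<^sub>R One)) (real i *\<^sub>R One)) \<noteq> \<infinity>" for i
    by simp
qed (use M N in \<open>auto simp: sets_borel_box UN_box_eq_UNIV\<close>)

text \<open>Weierstrass approximation instead of mollification: divide by a smooth bump b,
  approximate the quotient by a polynomial on a ball, and multiply back. As b is at most 1 the error
  does not grow, and the product has compact support.\<close>

lemma smooth_dense_Cc:
  fixes v :: "complex \<Rightarrow> real"
  assumes "Cc v" "\<epsilon> > 0"
  obtains u where "smooth u" "Cc u" "\<And>z. \<bar>v z - u z\<bar> \<le> \<epsilon>"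
proof -
  obtain R' where R': "\<And>z. R' < norm z \<Longrightarrow> v z = 0" using assms(1) by (auto simp: Cc_def)
  \<comment> \<open>The added 1 makes v vanish on the sphere of radius R itself, where the two
    pieces of \<open>w\<close> meet; the bump lives on radius 2R, so the division stays
    safe.\<close>
  define R where "R = max R' 0 + 1"
  have R: "R > 0" "\<And>z. R \<le> norm z \<Longrightarrow> v z = 0" using R' by (auto simp: R_def)
  have vc: "continuous_on S v" for S using assms(1) by (auto simp: Cc_def intro: continuous_on_subset)
  define b where "b z = flat 1 1 ((2 * R)\<^sup>2 - (norm z)\<^sup>2)" for z :: complex
  have "smooth_kernel (\<lambda>z a. (2 * R)\<^sup>2 - (norm a)\<^sup>2)"
    unfolding cmod_power2 by (intro smooth_kernel_intros)
  then have bj: "smooth_kernel (\<lambda>z a. b a)" unfolding b_def by (rule smooth_kernel.flat) simp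
  then have bs: "smooth b" using smooth_kernel_smooth by fastforce
  have bpos: "b z > 0" if "norm z < 2 * R" for z
    using power_strict_mono[OF that, of 2] by (simp add: b_def flat_1)
  have b0: "b z = 0" if "norm z \<ge> 2 * R" for z
    using power_mono[OF that, of 2] R by (simp add: b_def flat_1)
  have b1: "0 \<le> b z" "b z \<le> 1" for z unfolding b_def by (auto intro: flat_1_bounds)
  define w where "w z = (if norm z \<le> R then v z / b z else 0)" for z
  have "continuous_on (cball 0 (2 * R)) w"
    unfolding w_def
  proof (rule continuous_on_cases_le)
    show "continuous_on {x \<in> cball 0 (2 * R). norm x \<le> R} (\<lambda>z. v z / b z)"
      using bpos R(1) by (intro continuous_on_divide vc continuous_on_subset[OF smooth_continuous[OF bs]])
        (auto simp: less_imp_neq[THEN not_sym] dest!: order.strict_trans1[of _ R "2 * R"])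
  qed (use R in \<open>auto intro!: continuous_intros\<close>)
  from Stone_Weierstrass_real_polynomial_function[OF compact_cball this assms(2)]
  obtain g where g: "real_polynomial_function g" "\<And>z. z \<in> cball 0 (2 * R) \<Longrightarrow> \<bar>w z - g z\<bar> < \<epsilon>"
    by blast
  define u where "u z = b z * g z" for z
  have "smooth_kernel (\<lambda>z a. u a)" unfolding u_def by (intro smooth_kernel.mult bj smooth_kernel_polynomial g)
  then have us: "smooth u" using smooth_kernel_smooth by fastforce
  moreover have "Cc u" unfolding Cc_def
    using smooth_continuous[OF us] b0 by (intro conjI exI[of _ "2 * R"]) (auto simp: u_def)
  moreover have "\<bar>v z - u z\<bar> \<le> \<epsilon>" for z
  proof (cases "norm z < 2 * R")
    case True
    have "v z = b z * w z"
      using bpos[OF True] R(2)[of z] by (auto simp: w_def)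
    then have "\<bar>v z - u z\<bar> = b z * \<bar>w z - g z\<bar>"
      using b1[of z] by (simp add: u_def abs_mult right_diff_distrib[symmetric])
    also have "\<dots> \<le> 1 * \<epsilon>" using b1[of z] g(2)[of z] True by (intro mult_mono) auto
    finally show ?thesis by simp
  next
    case False
    then show ?thesis using b0[of z] R(2)[of z] R(1) assms(2) by (simp add: u_def)
  qed
  ultimately show ?thesis using that by blast
qed


section \<open>Weak compactness via Schoenberg's curve\<close>

text \<open>Schoenberg's even function of period 2, constant 0 on [0, 1/3] and 1 on [2/3, 1]. The
  truncated cosine works because cos(pi/3) = 1/2 and cos(2 pi/3) = -1/2.\<close>

definition plateau :: "real \<Rightarrow> real" where
  "plateau t = max 0 (min 1 (1 / 2 - cos (pi * t)))"

lemma plateau_bounds: "0 \<le> plateau t" "plateau t \<le> 1"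
  by (auto simp: plateau_def)

lemma plateau_continuous:
  fixes g :: "real \<Rightarrow> real"
  assumes "continuous_on S g"
  shows "continuous_on S (\<lambda>x. plateau (g x))"
  unfolding plateau_def by (intro continuous_intros assms)

lemma plateau_periodic: "plateau (2 * real_of_int k + t) = plateau t"
proof -
  have "cos (pi * (2 * real_of_int k + t)) = cos (2 * pi * real_of_int k + pi * t)"
    by (simp add: algebra_simps)
  also have "\<dots> = cos (pi * t)" by (simp add: cos_add cos_int_2pin sin_int_2pin)
  finally show ?thesis by (simp add: plateau_def)
qed

lemma plateau_0:
  assumes "0 \<le> t" "t \<le> 1 / 3"
  shows "plateau t = 0"
proof -
  have "pi * t \<le> pi * (1 / 3)" using assms by (intro mult_left_mono) auto
  then have "cos (pi / 3) \<le> cos (pi * t)"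
    using assms pi_gt_zero by (intro cos_monotone_0_pi_le) auto
  then show ?thesis by (simp add: plateau_def cos_60)
qed

lemma plateau_1:
  assumes "2 / 3 \<le> t" "t \<le> 1"
  shows "plateau t = 1"
proof -
  have "pi * (2 / 3) \<le> pi * t" "pi * t \<le> pi * 1" using assms by (intro mult_left_mono; simp)+
  then have "cos (pi * t) \<le> cos (pi * (2 / 3))"
    using pi_gt_zero by (intro cos_monotone_0_pi_le) auto
  also have "pi * (2 / 3) = pi - pi / 3" by (simp add: field_simps)
  also have "cos (pi - pi / 3) = - (1 / 2)" by (simp only: cos_pi_minus cos_60)
  finally show ?thesis by (simp add: plateau_def)
qed

text \<open>For \<open>a\<close> with values 0 and 1, the point of the Cantor set with ternary
  digits 2a; the missing digit 1 leaves the gap in which \<open>plateau\<close> may rise.\<close>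

definition ternary :: "(nat \<Rightarrow> real) \<Rightarrow> real" where
  "ternary a = (\<Sum>m. 2 * a m / 3 ^ Suc m)"

context
  fixes a :: "nat \<Rightarrow> real"
  assumes a: "\<And>m. a m \<in> {0, 1}"
begin

lemma ternary_bounds: "summable (\<lambda>m. 2 * a m / 3 ^ Suc m)" "0 \<le> ternary a" "ternary a \<le> 1"
proof -
  have g: "(\<lambda>m. 2 / 3 * (1 / 3 :: real) ^ m) sums (2 / 3 * (1 / (1 - 1 / 3)))"
    by (intro sums_mult geometric_sums) simp
  have le: "0 \<le> 2 * a m / 3 ^ Suc m" "2 * a m / 3 ^ Suc m \<le> 2 / 3 * (1 / 3) ^ m" for m
    using a[of m] by (auto simp: power_divide)
  show s: "summable (\<lambda>m. 2 * a m / 3 ^ Suc m)"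
  proof (rule summable_comparison_test'[OF sums_summable[OF g], of 0])
    show "norm (2 * a m / 3 ^ Suc m) \<le> 2 / 3 * (1 / 3) ^ m" for m
      using le[of m] unfolding real_norm_def by linarith
  qed
  show "0 \<le> ternary a" unfolding ternary_def by (intro suminf_nonneg s le)
  have "ternary a \<le> (\<Sum>m. 2 / 3 * (1 / 3 :: real) ^ m)"
    unfolding ternary_def by (intro suminf_le s sums_summable[OF g] le)
  then show "ternary a \<le> 1" using sums_unique[OF g] by simp
qed

lemma ternary_shift: "3 * ternary a = 2 * a 0 + ternary (\<lambda>m. a (Suc m))"
proof -
  have "ternary a = (\<Sum>m. 2 * a (Suc m) / 3 ^ Suc (Suc m)) + 2 * a 0 / 3"
    unfolding ternary_def using suminf_split_head[OF ternary_bounds(1)] by simp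
  also have "(\<lambda>m. 2 * a (Suc m) / 3 ^ Suc (Suc m)) = (\<lambda>m. (2 * a (Suc m) / 3 ^ Suc m) / 3)"
    by simp
  also have "(\<Sum>m. (2 * a (Suc m) / 3 ^ Suc m) / 3) = ternary (\<lambda>m. a (Suc m)) / 3"
    unfolding ternary_def
  proof (rule suminf_divide)
    have "summable (\<lambda>m. 3 * (2 * a (Suc m) / 3 ^ Suc (Suc m)))"
      using ternary_bounds(1) by (intro summable_mult) (subst summable_Suc_iff)
    then show "summable (\<lambda>m. 2 * a (Suc m) / 3 ^ Suc m)" by simp
  qed
  finally show ?thesis by simp
qed

end

text \<open>Multiplying by 3^j shifts the digits. The integer part is even, hence invisible to a
  function of period 2, and the fractional remainder lies in [0, 1/3] or [2/3, 1] according to the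
  digit \<open>a j\<close>.\<close>

lemma plateau_ternary:
  assumes a: "\<And>m. a m \<in> {0, 1}"
  shows "plateau (3 ^ j * ternary a) = a j"
proof -
  have "\<exists>k. 3 ^ j * ternary a = 2 * real_of_int k + ternary (\<lambda>m. a (m + j))"
  proof (induction j)
    case 0
    show ?case by (intro exI[of _ 0]) simp
  next
    case (Suc j)
    then obtain k where k: "3 ^ j * ternary a = 2 * real_of_int k + ternary (\<lambda>m. a (m + j))" by blast
    have "3 ^ Suc j * ternary a = 2 * real_of_int (3 * k) + 3 * ternary (\<lambda>m. a (m + j))"
      using k by simp
    also have "3 * ternary (\<lambda>m. a (m + j)) = 2 * a j + ternary (\<lambda>m. a (m + Suc j))"
      using ternary_shift[of "\<lambda>m. a (m + j)"] a by simp
    also obtain i :: int where "a j = real_of_int i"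
      using a[of j] that[of 0] that[of 1] by auto
    finally show ?case by (intro exI[of _ "3 * k + i"]) simp
  qed
  then obtain k where k: "3 ^ j * ternary a = 2 * real_of_int k + ternary (\<lambda>m. a (m + j))" by blast
  have *: "3 * ternary (\<lambda>m. a (m + j)) = 2 * a j + ternary (\<lambda>m. a (Suc m + j))"
    using ternary_shift[of "\<lambda>m. a (m + j)"] a by simp
  have b: "0 \<le> ternary (\<lambda>m. a (Suc m + j))" "ternary (\<lambda>m. a (Suc m + j)) \<le> 1"
    using ternary_bounds(2,3)[of "\<lambda>m. a (Suc m + j)"] a by auto
  show ?thesis
    using a[of j] b * plateau_0[of "ternary (\<lambda>m. a (m + j))"] plateau_1[of "ternary (\<lambda>m. a (m + j))"]
    by (auto simp: k plateau_periodic)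
qed

definition binary_digit :: "nat \<Rightarrow> real \<Rightarrow> real" where
  "binary_digit k x = real_of_int (\<lfloor>2 ^ Suc k * x\<rfloor> mod 2)"

lemma binary_digit_01: "binary_digit k x \<in> {0, 1}"
  using pos_mod_bound[of 2 "\<lfloor>2 ^ Suc k * x\<rfloor>"] pos_mod_sign[of 2 "\<lfloor>2 ^ Suc k * x\<rfloor>"]
  by (auto simp: binary_digit_def)

lemma binary_digit_measurable [measurable]: "binary_digit k \<in> borel_measurable borel"
proof -
  have [measurable]: "(\<lambda>x::real. \<lfloor>2 ^ Suc k * x\<rfloor>) \<in> borel \<rightarrow>\<^sub>M count_space UNIV" by measurable
  show ?thesis unfolding binary_digit_def[abs_def] by measurable
qed

lemma binary_digit_sums:
  assumes "0 \<le> x" "x < 1"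
  shows "(\<lambda>k. binary_digit k x / 2 ^ Suc k) sums x"
  unfolding sums_def
proof -
  have partial: "(\<Sum>k<n. binary_digit k x / 2 ^ Suc k) = real_of_int \<lfloor>2 ^ n * x\<rfloor> / 2 ^ n" for n
  proof (induction n)
    case 0
    have "\<lfloor>x\<rfloor> = 0" using assms by linarith
    then show ?case by simp
  next
    case (Suc n)
    have "\<lfloor>2 * y\<rfloor> mod 2 = \<lfloor>2 * y\<rfloor> - 2 * \<lfloor>y\<rfloor>" for y :: real
    proof -
      have "\<lfloor>2 * y\<rfloor> = 2 * \<lfloor>y\<rfloor> \<or> \<lfloor>2 * y\<rfloor> = 2 * \<lfloor>y\<rfloor> + 1" by linarith
      then show ?thesis by auto
    qed
    from this[of "2 ^ n * x"] have "binary_digit n x = real_of_int \<lfloor>2 ^ Suc n * x\<rfloor> - 2 * real_of_int \<lfloor>2 ^ n * x\<rfloor>"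
      by (simp add: binary_digit_def mult.assoc)
    with Suc show ?case by (simp add: field_simps)
  qed
  have "(\<lambda>n. real_of_int \<lfloor>2 ^ n * x\<rfloor> / 2 ^ n) \<longlonglongrightarrow> x"
  proof (rule tendsto_sandwich)
    have "(\<lambda>n. x - (1 / 2) ^ n) \<longlonglongrightarrow> x - 0"
      by (intro tendsto_diff tendsto_const LIMSEQ_power_zero) simp
    then show "(\<lambda>n. x - (1 / 2) ^ n) \<longlonglongrightarrow> x" by simp
    show "\<forall>\<^sub>F n in sequentially. x - (1 / 2) ^ n \<le> real_of_int \<lfloor>2 ^ n * x\<rfloor> / 2 ^ n"
    proof (intro always_eventually allI)
      fix n :: nat
      have "2 ^ n * x - 1 \<le> real_of_int \<lfloor>2 ^ n * x\<rfloor>" by linarith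
      then have "(2 ^ n * x - 1) / 2 ^ n \<le> real_of_int \<lfloor>2 ^ n * x\<rfloor> / 2 ^ n" by (intro divide_right_mono) auto
      then show "x - (1 / 2) ^ n \<le> real_of_int \<lfloor>2 ^ n * x\<rfloor> / 2 ^ n"
        by (simp add: diff_divide_distrib power_divide)
    qed
    show "\<forall>\<^sub>F n in sequentially. real_of_int \<lfloor>2 ^ n * x\<rfloor> / 2 ^ n \<le> x"
    proof (intro always_eventually allI)
      fix n :: nat
      have "real_of_int \<lfloor>2 ^ n * x\<rfloor> \<le> x * 2 ^ n" by (simp add: mult.commute)
      then show "real_of_int \<lfloor>2 ^ n * x\<rfloor> / 2 ^ n \<le> x" by (simp add: divide_le_eq)
    qed
  qed (rule tendsto_const)
  then show "(\<lambda>n. \<Sum>k<n. binary_digit k x / 2 ^ Suc k) \<longlonglongrightarrow> x" unfolding partial .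
qed

text \<open>Helly's selection theorem is available on the real line only. A measurable section of
  Schoenberg's space-filling curve transports it to the plane.\<close>

definition schoenberg_coord :: "nat \<Rightarrow> real \<Rightarrow> real" where
  "schoenberg_coord i t = (\<Sum>k. plateau (3 ^ (2 * k + i) * t) / 2 ^ Suc k)"

definition schoenberg_section :: "complex \<Rightarrow> real" where
  "schoenberg_section z = ternary (\<lambda>m. binary_digit (m div 2) (if even m then Re z else Im z))"

lemma schoenberg_coord_continuous: "continuous_on UNIV (schoenberg_coord i)"
proof -
  have ul: "uniform_limit UNIV (\<lambda>n t. \<Sum>k<n. plateau (3 ^ (2 * k + i) * t) / 2 ^ Suc k) (schoenberg_coord i) sequentially"
    unfolding schoenberg_coord_def[abs_def]
  proof (rule Weierstrass_m_test)
    show "norm (plateau (3 ^ (2 * k + i) * t) / 2 ^ Suc k) \<le> 1 / 2 * (1 / 2) ^ k" for k t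
      using plateau_bounds[of "3 ^ (2 * k + i) * t"] by (simp add: power_divide divide_right_mono)
    show "summable (\<lambda>k. 1 / 2 * (1 / 2 :: real) ^ k)" by (intro summable_mult summable_geometric) simp
  qed
  have c: "\<forall>\<^sub>F n in sequentially. continuous_on UNIV (\<lambda>t. \<Sum>k<n. plateau (3 ^ (2 * k + i) * t) / 2 ^ Suc k)"
    by (intro always_eventually allI continuous_on_sum continuous_on_divide plateau_continuous continuous_intros) auto
  show ?thesis by (rule uniform_limit_theorem[OF c ul trivial_limit_sequentially])
qed

lemma schoenberg_section_measurable [measurable]: "schoenberg_section \<in> borel_measurable borel"
proof -
  have "(\<lambda>z. binary_digit (m div 2) (if even m then Re z else Im z)) \<in> borel_measurable borel" for m
    by (cases "even m") (simp_all add: borel_measurable_Re borel_measurable_Im measurable_compose[OF _ binary_digit_measurable])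
  then show ?thesis unfolding schoenberg_section_def[abs_def] ternary_def by measurable
qed

lemma schoenberg_section_bounds: "0 \<le> schoenberg_section z" "schoenberg_section z \<le> 1"
  unfolding schoenberg_section_def by (auto intro!: ternary_bounds binary_digit_01)

text \<open>The section interleaves the binary digits of both coordinates, real part at even places
  and imaginary part at odd ones, and the curve reads them back. Digits jump, so the section is only
  measurable, but the curve is continuous.\<close>

lemma schoenberg_coord_section:
  assumes "0 \<le> Re z" "Re z < 1" "0 \<le> Im z" "Im z < 1"
  shows "Complex (schoenberg_coord 0 (schoenberg_section z)) (schoenberg_coord 1 (schoenberg_section z)) = z"
proof -
  have p: "plateau (3 ^ m * schoenberg_section z) = binary_digit (m div 2) (if even m then Re z else Im z)" for m
    unfolding schoenberg_section_def by (intro plateau_ternary binary_digit_01)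
  have "schoenberg_coord 0 (schoenberg_section z) = (\<Sum>k. binary_digit k (Re z) / 2 ^ Suc k)"
    unfolding schoenberg_coord_def p by simp
  moreover have "schoenberg_coord 1 (schoenberg_section z) = (\<Sum>k. binary_digit k (Im z) / 2 ^ Suc k)"
    unfolding schoenberg_coord_def p by simp
  ultimately show ?thesis
    using binary_digit_sums[of "Re z"] binary_digit_sums[of "Im z"] assms
    by (simp add: sums_unique[symmetric] complex_eq_iff)
qed

text \<open>Push the measures to the interval by the section, extract a limit there, and return by
  the curve. The discontinuity of the section does no harm: curve after section is the identity
  almost everywhere, so only \<phi> composed with the continuous curve is ever tested.\<close>

lemma weak_limit_exists:
  fixes M :: "nat \<Rightarrow> complex measure"
  assumes M: "\<And>n. prob_space (M n)" "\<And>n. sets (M n) = sets borel"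
    and bound: "\<And>n. AE z in M n. norm z < R" and R: "R > 0"
  obtains r \<mu> where "strict_mono r" "prob_space \<mu>" "sets \<mu> = sets borel"
    "\<And>\<phi>. Cc \<phi> \<Longrightarrow> (\<lambda>n. \<integral>z. \<phi> z \<partial>M (r n)) \<longlonglongrightarrow> (\<integral>z. \<phi> z \<partial>\<mu>)"
proof -
  \<comment> \<open>Maps the square around the disc of radius R into the unit square;
    \<open>c\<close> undoes this after the curve.\<close>
  define A where "A z = z / of_real (2 * R) + Complex (1 / 2) (1 / 2)" for z
  define c where "c t = of_real (2 * R) * (Complex (schoenberg_coord 0 t) (schoenberg_coord 1 t) - Complex (1 / 2) (1 / 2))" for t
  define S where "S z = schoenberg_section (A z)" for z
  have Am: "A \<in> borel_measurable borel" unfolding A_def[abs_def] by measurable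
  have Sm [measurable]: "S \<in> borel_measurable borel"
    unfolding S_def[abs_def] using measurable_compose[OF Am schoenberg_section_measurable] .
  have cS: "c (S z) = z" if "norm z < R" for z
  proof -
    have "\<bar>Re z\<bar> < R" "\<bar>Im z\<bar> < R" using that abs_Re_le_cmod[of z] abs_Im_le_cmod[of z] by linarith+
    then have "\<bar>Re z / (2 * R)\<bar> < 1 / 2" "\<bar>Im z / (2 * R)\<bar> < 1 / 2"
      using R by (simp_all add: abs_divide divide_less_eq)
    moreover have "Re (A z) = Re z / (2 * R) + 1 / 2" "Im (A z) = Im z / (2 * R) + 1 / 2"
      by (simp_all add: A_def Re_divide_of_real Im_divide_of_real del: of_real_mult)
    ultimately have "0 \<le> Re (A z)" "Re (A z) < 1" "0 \<le> Im (A z)" "Im (A z) < 1" by linarith+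
    from schoenberg_coord_section[OF this] have "c (S z) = of_real (2 * R) * (A z - Complex (1 / 2) (1 / 2))"
      by (simp add: c_def S_def)
    then show ?thesis using R by (simp add: A_def)
  qed
  have cc: "continuous_on UNIV c"
    unfolding c_def[abs_def] Complex_eq
    by (intro continuous_intros schoenberg_coord_continuous)
  then have cm [measurable]: "c \<in> borel_measurable borel" by (rule borel_measurable_continuous_onI)
  have SmM: "S \<in> borel_measurable (M n)" for n
    using Sm measurable_cong_sets[OF M(2) refl] by blast
  define N where "N n = distr (M n) borel S" for n
  have Nd: "real_distribution (N n)" for n
    unfolding N_def by (rule prob_space.real_distribution_distr[OF M(1) SmM])
  have "tight N"
    unfolding tight_def
  proof (intro conjI allI impI)
    fix \<epsilon> :: real assume "\<epsilon> > 0"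
    \<comment> \<open>The interval is open on the left, so it starts at -1 to contain the possible
      value 0 of the section.\<close>
    have "measure (N n) {-1<..1} = 1" for n
    proof -
      interpret M: prob_space "M n" by (rule M)
      have "S -` {-1<..1} \<inter> space (M n) = space (M n)"
      proof -
        have "-1 < S z" "S z \<le> 1" for z
          using schoenberg_section_bounds[of "A z"] by (simp_all add: S_def)
        then show ?thesis by auto
      qed
      then show ?thesis unfolding N_def using SmM[of n] by (simp add: measure_distr M.prob_space)
    qed
    then show "\<exists>a b. a < b \<and> (\<forall>n. 1 - \<epsilon> < measure (N n) {a<..b})"
      using \<open>\<epsilon> > 0\<close> by (intro exI[of _ "-1"] exI[of _ 1]) auto
  qed (rule Nd)
  from tight_imp_convergent_subsubsequence[OF this strict_mono_id]
  obtain r K where r: "strict_mono r" and K: "real_distribution K" and w: "weak_conv_m (N \<circ> id \<circ> r) K"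
    by blast
  interpret K: real_distribution K by fact
  define \<mu> where "\<mu> = distr K borel c"
  have cK: "c \<in> borel_measurable K" by simp
  have "(\<lambda>n. \<integral>z. \<phi> z \<partial>M (r n)) \<longlonglongrightarrow> (\<integral>z. \<phi> z \<partial>\<mu>)" if \<phi>: "Cc \<phi>" for \<phi>
  proof -
    obtain B where B: "\<And>z. \<bar>\<phi> z\<bar> \<le> B" using Cc_bounded[OF \<phi>] by metis
    note m [measurable] = Cc_measurable[OF \<phi>]
    have "isCont (\<lambda>t. \<phi> (c t)) t" for t
    proof -
      have "continuous_on UNIV (\<lambda>t. \<phi> (c t))"
        using \<phi> cc by (auto simp: Cc_def intro: continuous_on_compose2[of UNIV \<phi> UNIV c])
      then show ?thesis by (simp add: continuous_on_eq_continuous_at)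
    qed
    then have "(\<lambda>n. \<integral>t. \<phi> (c t) \<partial>(N \<circ> id \<circ> r) n) \<longlonglongrightarrow> (\<integral>t. \<phi> (c t) \<partial>K)"
      using B by (intro weak_conv_imp_integral_bdd_continuous_conv[OF _ K w]) (auto simp: Nd)
    moreover have "(\<integral>t. \<phi> (c t) \<partial>(N \<circ> id \<circ> r) n) = (\<integral>z. \<phi> z \<partial>M (r n))" for n
    proof -
      have "(\<integral>t. \<phi> (c t) \<partial>N (r n)) = (\<integral>z. \<phi> (c (S z)) \<partial>M (r n))"
        unfolding N_def using SmM by (subst integral_distr) auto
      also have "\<dots> = (\<integral>z. \<phi> z \<partial>M (r n))"
      proof (rule integral_cong_AE)
        show "AE z in M (r n). \<phi> (c (S z)) = \<phi> z" using bound[of "r n"] by eventually_elim (simp add: cS)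
        show "(\<lambda>z. \<phi> (c (S z))) \<in> borel_measurable (M (r n))"
          using measurable_compose[OF SmM, of "\<lambda>t. \<phi> (c t)"] by simp
        show "\<phi> \<in> borel_measurable (M (r n))" using m measurable_cong_sets[OF M(2) refl] by blast
      qed
      finally show ?thesis by simp
    qed
    moreover have "(\<integral>t. \<phi> (c t) \<partial>K) = (\<integral>z. \<phi> z \<partial>\<mu>)"
      unfolding \<mu>_def by (subst integral_distr) auto
    ultimately show ?thesis by simp
  qed
  moreover have "prob_space \<mu>" unfolding \<mu>_def by (rule K.prob_space_distr[OF cK])
  moreover have "sets \<mu> = sets borel" by (simp add: \<mu>_def)
  ultimately show ?thesis using that r by blast
qed


section \<open>Existence of the equilibrium measure and equidistribution\<close>

text \<open>Normalised counting measure of the fibre with multiplicities; \<open>distr\<close> along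
  the identity only replaces the discrete sigma-algebra by the Borel one.\<close>

definition fiber_measure :: "complex poly \<Rightarrow> complex \<Rightarrow> complex measure" where
  "fiber_measure h a = distr (measure_pmf (pmf_of_multiset (proots (h - [:a:])))) borel (\<lambda>z. z)"

lemma sets_fiber_measure [simp]: "sets (fiber_measure h a) = sets borel"
  by (simp add: fiber_measure_def)

lemma prob_space_fiber_measure: "prob_space (fiber_measure h a)"
  unfolding fiber_measure_def by (intro measure_pmf.prob_space_distr) simp

lemma fiber_measure_roots:
  fixes h :: "complex poly"
  assumes "degree h > 0"
  shows "h - [:a:] \<noteq> 0" "proots (h - [:a:]) \<noteq> {#}" "size (proots (h - [:a:])) = degree h"
proof -
  have deg: "degree (h - [:a:]) = degree h"
    by (rule degree_diff_const[OF assms])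
  then show "h - [:a:] \<noteq> 0" using assms by auto
  show "size (proots (h - [:a:])) = degree h" by (simp add: size_proots_complex deg)
  then show "proots (h - [:a:]) \<noteq> {#}" using assms by auto
qed

lemma integral_fiber_measure:
  assumes "degree h > 0" "u \<in> borel_measurable borel"
  shows "(\<integral>z. u z \<partial>fiber_measure h a) = fiber_sum h (case_option 0 u) (Some a) / real (degree h)"
proof -
  let ?A = "proots (h - [:a:])"
  note A = fiber_measure_roots[OF assms(1), of a]
  have "(\<integral>z. u z \<partial>fiber_measure h a) = (\<integral>z. u z \<partial>measure_pmf (pmf_of_multiset ?A))"
    unfolding fiber_measure_def using assms(2) by (subst integral_distr) auto
  also have "\<dots> = (\<Sum>z\<in>set_mset ?A. u z * pmf (pmf_of_multiset ?A) z)"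
    using A by (intro integral_measure_pmf_real finite_set_mset) simp
  also have "\<dots> = (\<Sum>z\<in>set_mset ?A. real (count ?A z) * u z) / real (degree h)"
    using A by (simp add: sum_divide_distrib mult.commute)
  also have "(\<Sum>z\<in>set_mset ?A. real (count ?A z) * u z) = fiber_sum h (case_option 0 u) (Some a)"
    using A(1) by (simp add: fiber_sum_Some)
  finally show ?thesis .
qed

lemma AE_fiber_measure:
  assumes "degree h > 0" "Measurable.pred borel P" "\<And>z. poly h z = a \<Longrightarrow> P z"
  shows "AE z in fiber_measure h a. P z"
  unfolding fiber_measure_def
  using assms fiber_measure_roots[OF assms(1), of a]
  by (subst AE_distr_iff) (auto simp: AE_measure_pmf_iff pred_def)

text \<open>No continuity of roots is invoked: the integral of a bump over a fibre is a logarithmic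
  potential, visibly measurable in a, and the measure of a box is a limit of such integrals.\<close>

lemma measurable_fiber_measure:
  assumes h: "degree h > 0"
  shows "fiber_measure h \<in> borel \<rightarrow>\<^sub>M prob_algebra borel"
proof (rule measurable_prob_algebra_generated[OF sets_borel_box Int_stable_box])
  fix X :: "complex set" assume "X \<in> range (\<lambda>(a, b). box a b)"
  then obtain p q where X: "X = box p q" by auto
  have "(\<lambda>a. measure (fiber_measure h a) (box p q)) \<in> borel_measurable borel"
  proof (rule borel_measurable_LIMSEQ_real)
    show "(\<lambda>n. \<integral>z. box_bump p q n z \<partial>fiber_measure h a) \<longlonglongrightarrow> measure (fiber_measure h a) (box p q)" for a
      by (rule integral_box_bump_tendsto[OF prob_space_fiber_measure sets_fiber_measure])
    show "(\<lambda>a. \<integral>z. box_bump p q n z \<partial>fiber_measure h a) \<in> borel_measurable borel" for n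
    proof -
      interpret fiber_test h "box_bump p q n"
        using h box_bump_smooth box_bump_Cc by unfold_locales auto
      show ?thesis
        using fiber_sum_u1_measurable by (simp add: integral_fiber_measure[OF h Cc_measurable[OF box_bump_Cc]])
    qed
  qed
  then show "(\<lambda>a. emeasure (fiber_measure h a) X) \<in> borel_measurable borel"
    using prob_space.finite_measure[OF prob_space_fiber_measure]
    by (simp add: X finite_measure.emeasure_eq_measure)
qed (auto intro: prob_space_fiber_measure)

section \<open>Averaging the fibres over the unit disc\<close>

definition disc_density :: "complex \<Rightarrow> real" where
  "disc_density a = indicator (ball 0 1) a / pi"

definition disc_measure :: "complex measure" where
  "disc_measure = density lborel (\<lambda>a. ennreal (disc_density a))"

lemma disc_density_bounds: "0 \<le> disc_density a" "disc_density a \<le> 1"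
  using pi_gt3 by (auto simp: disc_density_def indicator_def)

lemma disc_density_measurable [measurable]: "disc_density \<in> borel_measurable borel"
  unfolding disc_density_def[abs_def] by (intro borel_measurable_divide borel_measurable_indicator) auto

lemma disc_density_integrable: "integrable lborel disc_density"
  and integral_disc_density: "(LBINT a. disc_density a) = 1"
  and integrable_log_plus_disc_density: "integrable lborel (\<lambda>a. log_plus a * disc_density a)"
proof -
  have i: "integrable lborel (indicator (ball 0 1) :: complex \<Rightarrow> real)"
    by (simp add: integrable_indicator_iff emeasure_ball)
  then show "integrable lborel disc_density" unfolding disc_density_def[abs_def] by simp
  show "(LBINT a. disc_density a) = 1"
    by (simp add: disc_density_def content_ball unit_ball_vol_2)
  have "log_plus a * disc_density a = 0" for a
    by (auto simp: disc_density_def log_plus_def indicator_def)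
  then show "integrable lborel (\<lambda>a. log_plus a * disc_density a)" by (simp only: integrable_zero)
qed

lemma sets_disc_measure [simp, measurable_cong]: "sets disc_measure = sets borel"
  by (simp add: disc_measure_def)

lemma space_disc_measure [simp]: "space disc_measure = UNIV"
  by (simp add: disc_measure_def)

lemma prob_space_disc_measure: "prob_space disc_measure"
proof
  have "emeasure disc_measure UNIV = (\<integral>\<^sup>+a. ennreal (disc_density a) \<partial>lborel)"
    by (simp add: disc_measure_def emeasure_density)
  also have "\<dots> = 1"
    using integral_disc_density disc_density_integrable disc_density_bounds(1)
    by (simp add: nn_integral_eq_integral)
  finally show "emeasure disc_measure (space disc_measure) = 1" by simp
qed

text \<open>The disc is preferred to the Fubini-Study measure for its bounded support: by
  \<open>escape_radius\<close> the averages for all iterates then live on one bounded set.\<close>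

definition averaged_fibers :: "complex poly \<Rightarrow> complex measure" where
  "averaged_fibers h = disc_measure \<bind> fiber_measure h"

context
  fixes h :: "complex poly"
  assumes h: "degree h > 0"
begin

lemma fiber_measure_kernel: "fiber_measure h \<in> disc_measure \<rightarrow>\<^sub>M subprob_algebra borel"
  using measurable_prob_algebraD[OF measurable_fiber_measure[OF h]]
  by (subst measurable_cong_sets[OF sets_disc_measure refl])

lemma sets_averaged_fibers: "sets (averaged_fibers h) = sets borel"
  unfolding averaged_fibers_def by (rule sets_bind) auto

lemma prob_space_averaged_fibers: "prob_space (averaged_fibers h)"
  unfolding averaged_fibers_def
  by (rule prob_space.prob_space_bind[OF prob_space_disc_measure _ fiber_measure_kernel])
     (simp add: prob_space_fiber_measure)

lemma AE_averaged_fibers: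
  assumes "\<And>z. norm (poly h z) < 1 \<Longrightarrow> norm z < R"
  shows "AE z in averaged_fibers h. norm z < R"
proof -
  have "AE a in disc_measure. norm a < 1"
    unfolding disc_measure_def by (subst AE_density) (auto simp: disc_density_def indicator_def)
  then have "AE a in disc_measure. AE z in fiber_measure h a. norm z < R"
  proof eventually_elim
    case (elim a)
    then show ?case using assms by (intro AE_fiber_measure[OF h]) auto
  qed
  then show ?thesis
    unfolding averaged_fibers_def by (subst AE_bind[OF fiber_measure_kernel]) auto
qed

text \<open>The counterpart of \<open>PB_integral_fiber_sum\<close>; for a measure with bounded
  density \<open>reg_potential_average\<close> applies directly, without a quasi-potential.\<close>

lemma integral_averaged_fibers:
  assumes u: "smooth u" "Cc u"
  shows "\<bar>real (degree h) * (\<integral>z. u z \<partial>averaged_fibers h) - (LBINT z. log_plus (poly h z) * ddc u z)\<bar>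
    \<le> average_error disc_density * (LBINT z. \<bar>ddc u z\<bar>)"
proof -
  interpret fiber_test h u using h u by unfold_locales
  interpret disc: prob_space disc_measure by (rule prob_space_disc_measure)
  have um: "u \<in> borel_measurable borel" by (rule Cc_measurable[OF u(2)])
  obtain B where B: "\<And>z. \<bar>u z\<bar> \<le> B" using Cc_bounded[OF u(2)] by metis
  have Sm: "Some \<in> disc_measure \<rightarrow>\<^sub>M P1_borel"
    using measurable_Some_P1 by (subst measurable_cong_sets[OF sets_disc_measure refl])
  have "(\<integral>z. u z \<partial>averaged_fibers h) = (\<integral>a. \<integral>z. u z \<partial>fiber_measure h a \<partial>disc_measure)"
    unfolding averaged_fibers_def
    by (rule integral_bind[where B' = 1, OF um B fiber_measure_kernel disc.finite_measure])
       (use prob_space.emeasure_space_1[OF prob_space_fiber_measure] in simp)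
  then have eq: "real (degree h) * (\<integral>z. u z \<partial>averaged_fibers h) = (\<integral>a. fiber_sum h u1 (Some a) \<partial>disc_measure)"
    using h by (simp add: integral_fiber_measure[OF h um])
  also have "\<dots> = (\<integral>w. fiber_sum h u1 w \<partial>distr disc_measure P1_borel Some)"
    using Sm by (subst integral_distr) (auto intro: measurable_P1I)
  finally have eq: "real (degree h) * (\<integral>z. u z \<partial>averaged_fibers h)
    = (\<integral>w. fiber_sum h u1 w \<partial>distr disc_measure P1_borel Some)" .
  show ?thesis
    unfolding eq
  proof (rule integral_fiber_sum_bound)
    show "prob_space (distr disc_measure P1_borel Some)" by (rule disc.prob_space_distr[OF Sm])
    show "P1_potential e \<in> borel_measurable (distr disc_measure P1_borel Some)" for e
      using P1_potential_measurable by simp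
    show "fiber_sum h u1 \<in> borel_measurable (distr disc_measure P1_borel Some)"
      using measurable_P1I[OF fiber_sum_u1_measurable] by simp
    fix e :: real assume e: "0 < e" "e \<le> 1"
    have "(\<integral>w. P1_potential e w \<partial>distr disc_measure P1_borel Some) = (\<integral>a. reg_potential e a \<partial>disc_measure)"
      using Sm P1_potential_measurable by (subst integral_distr) auto
    also have "\<dots> = (LBINT a. reg_potential e a * disc_density a)"
      unfolding disc_measure_def
      by (subst integral_real_density) (auto simp: disc_density_bounds mult.commute)
    finally show "\<bar>(\<integral>w. P1_potential e w \<partial>distr disc_measure P1_borel Some) - mean\<bar>
      \<le> average_error disc_density * mass"
      using reg_potential_average[OF e disc_density_bounds disc_density_integrable integral_disc_density
          integrable_log_plus_disc_density] by simp
  qed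
qed

end

section \<open>The equilibrium measure as a limit along the iterates\<close>

context dynamics
begin

lemma degree_df_pos: "n > 0 \<Longrightarrow> degree (df n) > 0"
proof -
  assume "n > 0"
  then have "2 ^ 1 \<le> (2 :: nat) ^ n" by (intro power_increasing) auto
  also have "\<dots> \<le> degree f ^ n" using degree_f by (intro power_mono) auto
  finally show ?thesis by (simp add: degree_df)
qed

lemma real_degree_df: "real (degree (df n)) = d ^ n - 1"
proof -
  have "1 \<le> degree f ^ n" using degree_f by (intro one_le_power) auto
  then show ?thesis by (simp add: degree_df d_def of_nat_diff)
qed

lemma tendsto_green_integral:
  assumes \<psi>: "Cc \<psi>" and x: "\<And>n. n > 0 \<Longrightarrow> \<bar>x n - (LBINT z. log_plus (poly (df n) z) * \<psi> z)\<bar> \<le> C"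
  shows "(\<lambda>n. x n / (d ^ n - 1)) \<longlonglongrightarrow> (LBINT z. green f z * \<psi> z)"
proof -
  let ?I = "\<lambda>n. LBINT z. log_plus (poly (df n) z) * \<psi> z"
  have "(\<lambda>n. (x n - ?I n) / (d ^ n - 1)) \<longlonglongrightarrow> 0"
  proof (rule Lim_null_comparison)
    show "\<forall>\<^sub>F n in sequentially. norm ((x n - ?I n) / (d ^ n - 1)) \<le> C * (1 / (d ^ n - 1))"
      using eventually_gt_at_top[of 0]
    proof eventually_elim
      case (elim n)
      then show ?case using x[of n] n_div_bounds(3)[of n] by (simp add: abs_divide divide_right_mono)
    qed
    show "(\<lambda>n. C * (1 / (d ^ n - 1))) \<longlonglongrightarrow> 0"
      using tendsto_mult[OF tendsto_const[of C] n_div_bounds(1)] by simp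
  qed
  from tendsto_add[OF this integral_log_plus_df_tendsto[OF \<psi>]] show ?thesis
    by (simp add: diff_divide_distrib)
qed

lemma equilibrium_exists:
  obtains \<mu> where "prob_space \<mu>" "sets \<mu> = sets borel"
    "\<And>u. smooth u \<Longrightarrow> Cc u \<Longrightarrow> (\<integral>z. u z \<partial>\<mu>) = (LBINT z. green f z * ddc u z)"
proof -
  obtain R where R: "\<And>n z. n > 0 \<Longrightarrow> norm z \<ge> R \<Longrightarrow> norm (poly (df n) z) \<ge> 2"
    using escape_radius by metis
  \<comment> \<open>The index is shifted because the zeroth derivative is the constant 1 and has no
    fibres to average.\<close>
  define M where "M n = averaged_fibers (df (Suc n))" for n
  note deg = degree_df_pos[OF zero_less_Suc]
  have bound: "AE z in M n. norm z < max R 1" for n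
    unfolding M_def
  proof (rule AE_averaged_fibers[OF deg])
    fix z assume z: "norm (poly (df (Suc n)) z) < 1"
    show "norm z < max R 1"
    proof (rule ccontr)
      assume "\<not> norm z < max R 1"
      then have "R \<le> norm z" by linarith
      with R[of "Suc n" z] z show False by simp
    qed
  qed
  have M: "prob_space (M n)" "sets (M n) = sets borel" for n
    unfolding M_def by (rule prob_space_averaged_fibers[OF deg] sets_averaged_fibers[OF deg])+
  have pos: "max R 1 > 0" by simp
  show ?thesis
  proof (rule weak_limit_exists[OF M bound pos])
    fix r \<mu>
    assume r: "strict_mono r" and \<mu>: "prob_space \<mu>" "sets \<mu> = sets borel"
      and lim: "\<And>\<phi>. Cc \<phi> \<Longrightarrow> (\<lambda>n. \<integral>z. \<phi> z \<partial>M (r n)) \<longlonglongrightarrow> (\<integral>z. \<phi> z \<partial>\<mu>)"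
    have "(\<integral>z. u z \<partial>\<mu>) = (LBINT z. green f z * ddc u z)" if u: "smooth u" "Cc u" for u
    proof -
      have "(\<lambda>n. real (degree (df n)) * (\<integral>z. u z \<partial>averaged_fibers (df n)) / (d ^ n - 1))
          \<longlonglongrightarrow> (LBINT z. green f z * ddc u z)"
        using integral_averaged_fibers[OF degree_df_pos u]
        by (intro tendsto_green_integral[where x = "\<lambda>n. real (degree (df n)) * (\<integral>z. u z \<partial>averaged_fibers (df n))"]
            Cc_ddc u)
      then have "(\<lambda>n. \<integral>z. u z \<partial>averaged_fibers (df n)) \<longlonglongrightarrow> (LBINT z. green f z * ddc u z)"
      proof (rule Lim_transform_eventually)
        show "\<forall>\<^sub>F n in sequentially. real (degree (df n)) * (\<integral>z. u z \<partial>averaged_fibers (df n)) / (d ^ n - 1)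
            = (\<integral>z. u z \<partial>averaged_fibers (df n))"
          using eventually_gt_at_top[of 0]
        proof eventually_elim
          case (elim n)
          then show ?case using n_div_bounds(3)[of n] by (simp add: real_degree_df)
        qed
      qed
      then have "(\<lambda>n. \<integral>z. u z \<partial>M n) \<longlonglongrightarrow> (LBINT z. green f z * ddc u z)"
        unfolding M_def by (rule LIMSEQ_Suc)
      \<comment> \<open>The integrals of u converge along the whole sequence, so every subsequential
        weak limit has the prescribed integral.\<close>
      from LIMSEQ_subseq_LIMSEQ[OF this r] have "(\<lambda>n. \<integral>z. u z \<partial>M (r n)) \<longlonglongrightarrow> (LBINT z. green f z * ddc u z)"
        by (simp add: o_def)
      with lim[OF u(2)] show ?thesis by (rule LIMSEQ_unique)
    qed
    then show ?thesis by (rule that[OF \<mu>])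
  qed
qed

text \<open>Unfolds the definite description, which takes existence and uniqueness together.\<close>

lemma equilibrium_measure_plane:
  shows "sets (equilibrium_measure_plane f) = sets borel"
    and "prob_space (equilibrium_measure_plane f)"
    and "smooth u \<Longrightarrow> Cc u \<Longrightarrow> (\<integral>z. u z \<partial>equilibrium_measure_plane f) = (LBINT z. green f z * ddc u z)"
proof -
  let ?P = "\<lambda>\<mu>. sets \<mu> = sets borel \<and> prob_space \<mu> \<and>
        (\<forall>u. smooth u \<and> compact (closure {z. u z \<noteq> 0}) \<longrightarrow>
           (\<integral>z. u z \<partial>\<mu>) = (LBINT z. green f z * ddc u z))"
  have iff: "smooth u \<and> compact (closure {z. u z \<noteq> 0}) \<longleftrightarrow> smooth u \<and> Cc u" for u
    using smooth_continuous[of u] by (auto simp: Cc_iff)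
  obtain \<mu> where \<mu>: "prob_space \<mu>" "sets \<mu> = sets borel"
    "\<And>u. smooth u \<Longrightarrow> Cc u \<Longrightarrow> (\<integral>z. u z \<partial>\<mu>) = (LBINT z. green f z * ddc u z)"
    using equilibrium_exists by blast
  have "?P (equilibrium_measure_plane f)"
    unfolding equilibrium_measure_plane_def
  proof (rule theI[of ?P \<mu>])
    show "?P \<mu>" unfolding iff using \<mu> by blast
    fix \<mu>' assume "?P \<mu>'"
    then show "\<mu>' = \<mu>" unfolding iff using \<mu> by (intro prob_measure_eqI) auto
  qed
  then show "sets (equilibrium_measure_plane f) = sets borel" "prob_space (equilibrium_measure_plane f)"
    "smooth u \<Longrightarrow> Cc u \<Longrightarrow> (\<integral>z. u z \<partial>equilibrium_measure_plane f) = (LBINT z. green f z * ddc u z)"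
    unfolding iff by blast+
qed

end

section \<open>Continuous test functions on the projective line\<close>

lemma open_vimage_Some:
  assumes "openin P1 V"
  shows "open (Some -` V)"
  using assms by (auto simp: openin_Alexandroff_compactification inj_vimage_image_eq vimage_def
      image_iff open_closed Collect_neg_eq)

lemma continuous_map_P1:
  fixes \<phi> :: "complex option \<Rightarrow> real"
  assumes "continuous_map P1 euclidean \<phi>"
  shows "continuous_on UNIV (\<lambda>z. \<phi> (Some z))"
    and "\<epsilon> > 0 \<Longrightarrow> \<exists>R. \<forall>z. R < norm z \<longrightarrow> \<bar>\<phi> (Some z) - \<phi> None\<bar> < \<epsilon>"
proof -
  have op: "openin P1 (\<phi> -` U)" if "open U" for U
    using openin_continuous_map_preimage[OF assms, of U] that topspace_P1
    by (simp add: vimage_def del: topspace_Alexandroff_compactification)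
  show "continuous_on UNIV (\<lambda>z. \<phi> (Some z))"
    unfolding continuous_on_open_vimage[OF open_UNIV]
  proof (intro allI impI)
    fix U :: "real set" assume "open U"
    then have "open (Some -` (\<phi> -` U))" by (intro open_vimage_Some op)
    moreover have "(\<lambda>z. \<phi> (Some z)) -` U \<inter> UNIV = Some -` (\<phi> -` U)" by auto
    ultimately show "open ((\<lambda>z. \<phi> (Some z)) -` U \<inter> UNIV)" by simp
  qed
  assume e: "\<epsilon> > 0"
  have "None \<in> \<phi> -` ball (\<phi> None) \<epsilon>" using e by simp
  with op[OF open_ball, of "\<phi> None" \<epsilon>] obtain C where C: "compact C" "\<phi> -` ball (\<phi> None) \<epsilon> = insert None (Some ` (UNIV - C))"
    by (auto simp: openin_Alexandroff_compactification)
  from compact_imp_bounded[OF C(1)] obtain R where "\<And>z. z \<in> C \<Longrightarrow> norm z \<le> R" by (auto simp: bounded_iff)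
  moreover have "\<bar>\<phi> (Some z) - \<phi> None\<bar> < \<epsilon>" if "z \<notin> C" for z
  proof -
    have "Some z \<in> \<phi> -` ball (\<phi> None) \<epsilon>" unfolding C(2) using that by auto
    then show ?thesis by (simp add: dist_real_def abs_minus_commute)
  qed
  ultimately show "\<exists>R. \<forall>z. R < norm z \<longrightarrow> \<bar>\<phi> (Some z) - \<phi> None\<bar> < \<epsilon>"
    by (meson not_le)
qed

lemma P1_approximation:
  fixes \<phi> :: "complex option \<Rightarrow> real"
  assumes "continuous_map P1 euclidean \<phi>" "\<epsilon> > 0"
  obtains u where "smooth u" "Cc u" "\<And>x. \<bar>\<phi> x - (\<phi> None + case_option 0 u x)\<bar> \<le> \<epsilon>"
proof -
  note c = continuous_map_P1(1)[OF assms(1)]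
  define t where "t z = \<phi> (Some z) - \<phi> None" for z
  \<comment> \<open>Soft thresholding: v is continuous, differs from t by at most \<epsilon>/2, and
    vanishes wherever |t| is below \<epsilon>/2, in particular near infinity.\<close>
  define v where "v z = t z - max (- (\<epsilon> / 2)) (min (\<epsilon> / 2) (t z))" for z
  obtain R where R: "\<And>z. R < norm z \<Longrightarrow> \<bar>t z\<bar> < \<epsilon> / 2"
    using continuous_map_P1(2)[OF assms(1), of "\<epsilon> / 2"] assms(2) unfolding t_def by auto
  have "v z = 0" if "R < norm z" for z using R[OF that] by (auto simp: v_def max_def min_def)
  moreover have "continuous_on UNIV v"
    unfolding v_def t_def by (intro continuous_intros c)
  ultimately have "Cc v" unfolding Cc_def by blast
  then obtain u where u: "smooth u" "Cc u" "\<And>z. \<bar>v z - u z\<bar> \<le> \<epsilon> / 2"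
    using smooth_dense_Cc[of v "\<epsilon> / 2"] assms(2) by auto
  have "\<bar>\<phi> x - (\<phi> None + case_option 0 u x)\<bar> \<le> \<epsilon>" for x
  proof (cases x)
    case (Some z)
    have "\<bar>t z - v z\<bar> \<le> \<epsilon> / 2" using assms(2) by (auto simp: v_def max_def min_def)
    then show ?thesis using u(3)[of z] unfolding t_def Some option.case by linarith
  qed (use assms(2) in simp)
  with u(1,2) show ?thesis using that by blast
qed

text \<open>A uniform error \<epsilon> is multiplied by the total multiplicity of the fibre, which
  is the degree, so it is again \<epsilon> after normalisation.\<close>

lemma fiber_sum_close:
  assumes "degree h > 0" "\<And>x. \<bar>\<phi> x - (c + case_option 0 u x)\<bar> \<le> \<epsilon>"
  shows "\<bar>fiber_sum h \<phi> w - (real (degree h) * c + fiber_sum h (case_option 0 u) w)\<bar> \<le> real (degree h) * \<epsilon>"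
proof -
  have "real (degree h) * c + fiber_sum h (case_option 0 u) w = fiber_sum h (\<lambda>x. c + case_option 0 u x) w"
    unfolding fiber_sum_const[OF assms(1), of c w, symmetric]
    by (simp add: fiber_sum_def sum.distrib distrib_left)
  then show ?thesis
    using fiber_sum_abs_le[OF assms(1), of "\<lambda>x. \<phi> x - (c + case_option 0 u x)", OF assms(2), of w]
    by (simp add: fiber_sum_diff)
qed

text \<open>Without measurability the integral in \<open>pullback\<close> would be the default value
  0. Fibre sums of smooth approximants are measurable by the potential formula, and they converge
  uniformly.\<close>

lemma fiber_sum_measurable:
  assumes h: "degree h > 0" and \<phi>: "continuous_map P1 euclidean \<phi>"
  shows "fiber_sum h \<phi> \<in> borel_measurable P1_borel"
proof (rule measurable_P1I)
  have "\<exists>u. smooth u \<and> Cc u \<and> (\<forall>x. \<bar>\<phi> x - (\<phi> None + case_option 0 u x)\<bar> \<le> 1 / real (Suc k))" for k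
    using P1_approximation[OF \<phi>, of "1 / real (Suc k)"] by auto
  then obtain u where u: "\<And>k. smooth (u k)" "\<And>k. Cc (u k)"
    "\<And>k x. \<bar>\<phi> x - (\<phi> None + case_option 0 (u k) x)\<bar> \<le> 1 / real (Suc k)"
    by metis
  let ?g = "\<lambda>k a. real (degree h) * \<phi> None + fiber_sum h (case_option 0 (u k)) (Some a)"
  show "(\<lambda>a. fiber_sum h \<phi> (Some a)) \<in> borel_measurable borel"
  proof (rule borel_measurable_LIMSEQ_real)
    show "?g k \<in> borel_measurable borel" for k
    proof -
      interpret fiber_test h "u k" using h u by unfold_locales
      show ?thesis by measurable
    qed
    fix a
    have le: "\<forall>k. norm (?g k a - fiber_sum h \<phi> (Some a)) \<le> real (degree h) * (1 / real (Suc k))"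
      using fiber_sum_close[OF h u(3)] by (simp add: abs_minus_commute)
    have "(\<lambda>k. real (degree h) * (1 / real (Suc k))) \<longlonglongrightarrow> 0"
      using tendsto_mult[OF tendsto_const LIMSEQ_inverse_real_of_nat, of "real (degree h)"]
      by (simp add: inverse_eq_divide)
    from Lim_null_comparison[OF always_eventually[OF le] this] show "(\<lambda>k. ?g k a) \<longlonglongrightarrow> fiber_sum h \<phi> (Some a)" by (rule LIM_zero_cancel)
  qed
qed

lemma (in prob_space) integral_close:
  fixes X Y :: "'a \<Rightarrow> real"
  assumes "X \<in> borel_measurable M" "integrable M Y" "\<And>w. \<bar>X w - Y w\<bar> \<le> \<epsilon>"
  shows "\<bar>(\<integral>w. X w \<partial>M) - (\<integral>w. Y w \<partial>M)\<bar> \<le> \<epsilon>"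
proof -
  have i: "integrable M (\<lambda>w. X w - Y w)"
    by (rule integrable_const_bound[of _ \<epsilon>]) (use assms in auto)
  from Bochner_Integration.integrable_add[OF this assms(2)] have "integrable M X" by simp
  moreover have "\<bar>\<integral>w. X w - Y w \<partial>M\<bar> \<le> (\<integral>w. \<epsilon> \<partial>M)"
    using i assms(3) by (intro integral_abs_bound_AE) auto
  ultimately show ?thesis using assms(2) by (simp add: prob_space)
qed

theorem proposition1p1:
  fixes f :: "complex poly" and d :: nat and \<nu> :: "complex option measure"
  assumes "degree f = d" and "d \<ge> 2"
    and "sets \<nu> = sets P1_borel" and "prob_space \<nu>" and "PB \<nu>"
  shows "\<forall>\<phi> :: complex option \<Rightarrow> real. continuous_map P1 euclidean \<phi> \<longrightarrow>
    (\<lambda>n. 1 / (real d ^ n - 1) * pullback (pderiv (poly_iterate f n)) \<nu> \<phi>)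
      \<longlonglongrightarrow> (\<integral>x. \<phi> x \<partial>equilibrium_measure f)"
proof (intro allI impI)
  fix \<phi> :: "complex option \<Rightarrow> real" assume \<phi>: "continuous_map P1 euclidean \<phi>"
  interpret dynamics f using assms by unfold_locales simp
  interpret prob_space \<nu> by fact
  interpret eq: prob_space "equilibrium_measure_plane f" by (rule equilibrium_measure_plane)
  have dd: "dynamics.d f = real d" using assms by (simp add: d_def)
  have meas: "borel_measurable \<nu> = (borel_measurable P1_borel :: (complex option \<Rightarrow> real) set)"
    by (rule measurable_cong_sets[OF assms(3) refl])
  have meas_eq: "borel_measurable (equilibrium_measure_plane f) = (borel_measurable borel :: (complex \<Rightarrow> real) set)"
    by (rule measurable_cong_sets[OF equilibrium_measure_plane(1) refl])
  have \<phi>m: "(\<lambda>z. \<phi> (Some z)) \<in> borel_measurable borel"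
    by (rule borel_measurable_continuous_onI[OF continuous_map_P1(1)[OF \<phi>]])
  have eq_int: "(\<integral>x. \<phi> x \<partial>equilibrium_measure f) = (\<integral>z. \<phi> (Some z) \<partial>equilibrium_measure_plane f)"
    unfolding equilibrium_measure_def
    using measurable_Some_P1 measurable_P1I[OF \<phi>m] measurable_cong_sets[OF equilibrium_measure_plane(1) refl]
    by (subst integral_distr) auto
  obtain C where C: "\<And>h u. fiber_test h u \<Longrightarrow>
      \<bar>(\<integral>w. fiber_sum h (case_option 0 u) w \<partial>\<nu>) - (LBINT z. log_plus (poly h z) * ddc u z)\<bar>
        \<le> C * (LBINT z. \<bar>ddc u z\<bar>)"
    using PB_integral_fiber_sum[OF assms(3,4,5)] by blast
  show "(\<lambda>n. 1 / (real d ^ n - 1) * pullback (df n) \<nu> \<phi>) \<longlonglongrightarrow> (\<integral>x. \<phi> x \<partial>equilibrium_measure f)"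
  proof (rule LIMSEQ_I)
    fix \<epsilon> :: real assume "\<epsilon> > 0"
    \<comment> \<open>Three errors of at most \<delta> will be added: replacing \<phi> under the
      pullback, the convergence for u, and replacing \<phi> under the equilibrium measure. A quarter
      keeps the sum strictly below \<epsilon>.\<close>
    define \<delta> where "\<delta> = \<epsilon> / 4"
    have \<delta>: "\<delta> > 0" using \<open>\<epsilon> > 0\<close> by (simp add: \<delta>_def)
    obtain u where u: "smooth u" "Cc u" and u_close: "\<And>x. \<bar>\<phi> x - (\<phi> None + case_option 0 u x)\<bar> \<le> \<delta>"
      using P1_approximation[OF \<phi> \<delta>] by blast
    let ?S = "\<lambda>n. \<integral>w. fiber_sum (df n) (case_option 0 u) w \<partial>\<nu>"
    let ?I = "\<integral>z. u z \<partial>equilibrium_measure_plane f"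
    have ts: "fiber_test (df n) u" if "n > 0" for n
      using degree_df_pos[OF that] u by unfold_locales
    have "(\<lambda>n. ?S n / (real d ^ n - 1)) \<longlonglongrightarrow> ?I"
      unfolding equilibrium_measure_plane(3)[OF u] dd[symmetric]
      using C[OF ts] by (intro tendsto_green_integral[where x = ?S] Cc_ddc u)
    from LIMSEQ_D[OF this \<delta>] obtain n0 where n0: "\<And>n. n \<ge> n0 \<Longrightarrow> \<bar>?S n / (real d ^ n - 1) - ?I\<bar> < \<delta>"
      by auto
    obtain B where B: "\<And>z. \<bar>u z\<bar> \<le> B" "B \<ge> 0" using Cc_bounded[OF u(2)] by metis
    have "integrable (equilibrium_measure_plane f) u"
      by (rule eq.integrable_const_bound[of _ B]) (use B Cc_measurable[OF u(2)] meas_eq in auto)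
    then have "\<bar>(\<integral>z. \<phi> (Some z) \<partial>equilibrium_measure_plane f) - (\<integral>z. \<phi> None + u z \<partial>equilibrium_measure_plane f)\<bar> \<le> \<delta>"
      using u_close[of "Some z" for z] \<phi>m meas_eq by (intro eq.integral_close) auto
    then have eq_close: "\<bar>(\<integral>x. \<phi> x \<partial>equilibrium_measure f) - (\<phi> None + ?I)\<bar> \<le> \<delta>"
      using \<open>integrable (equilibrium_measure_plane f) u\<close> by (simp add: eq_int eq.prob_space)
    \<comment> \<open>The factor d^n - 1 is the degree of the derivative, so the constant
      \<phi>(\<open>None\<close>) contributes exactly itself.\<close>
    have nu_close: "\<bar>1 / (real d ^ n - 1) * pullback (df n) \<nu> \<phi> - (\<phi> None + ?S n / (real d ^ n - 1))\<bar> \<le> \<delta>"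
      if n: "n > 0" for n
    proof -
      let ?D = "real (degree (df n))"
      note deg = degree_df_pos[OF n]
      have D: "?D = real d ^ n - 1" "?D > 0" using real_degree_df[of n] deg by (simp_all add: dd)
      interpret fiber_test "df n" u by (rule ts[OF n])
      have m1: "fiber_sum (df n) u1 \<in> borel_measurable \<nu>"
        unfolding meas by (rule measurable_P1I) measurable
      have m2: "fiber_sum (df n) \<phi> \<in> borel_measurable \<nu>"
        unfolding meas by (rule fiber_sum_measurable[OF deg \<phi>])
      have b1: "\<bar>fiber_sum (df n) u1 w\<bar> \<le> ?D * B" for w
        by (rule fiber_sum_abs_le[OF deg]) (use B in \<open>auto split: option.split\<close>)
      have i1: "integrable \<nu> (fiber_sum (df n) u1)"
        by (rule integrable_const_bound[of _ "?D * B"]) (use b1 m1 in auto)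
      have le: "\<bar>fiber_sum (df n) \<phi> w - (?D * \<phi> None + fiber_sum (df n) u1 w)\<bar> \<le> ?D * \<delta>" for w
        by (rule fiber_sum_close[OF deg u_close])
      have "\<bar>pullback (df n) \<nu> \<phi> - (\<integral>w. ?D * \<phi> None + fiber_sum (df n) u1 w \<partial>\<nu>)\<bar> \<le> ?D * \<delta>"
        unfolding pullback_eq using i1 m2 le by (intro integral_close) auto
      also have "(\<integral>w. ?D * \<phi> None + fiber_sum (df n) u1 w \<partial>\<nu>) = ?D * \<phi> None + ?S n"
        using i1 by (simp add: prob_space)
      finally have "\<bar>pullback (df n) \<nu> \<phi> - (?D * \<phi> None + ?S n)\<bar> / ?D \<le> \<delta>"
        using D(2) by (simp add: divide_le_eq mult.commute)
      moreover have "\<bar>pullback (df n) \<nu> \<phi> - (?D * \<phi> None + ?S n)\<bar> / ?D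
          = \<bar>(pullback (df n) \<nu> \<phi> - (?D * \<phi> None + ?S n)) / ?D\<bar>"
        using D(2) by (simp add: abs_divide)
      moreover have "(pullback (df n) \<nu> \<phi> - (?D * \<phi> None + ?S n)) / ?D
          = 1 / ?D * pullback (df n) \<nu> \<phi> - (\<phi> None + ?S n / ?D)"
        using D(2) by (simp add: diff_divide_distrib add_divide_distrib)
      ultimately show ?thesis unfolding D(1) by simp
    qed
    have "norm (1 / (real d ^ n - 1) * pullback (df n) \<nu> \<phi> - (\<integral>x. \<phi> x \<partial>equilibrium_measure f)) < \<epsilon>"
      if "n \<ge> max n0 1" for n
      using nu_close[of n] n0[of n] eq_close that \<delta> unfolding real_norm_def \<delta>_def by linarith
    then show "\<exists>no. \<forall>n\<ge>no. norm (1 / (real d ^ n - 1) * pullback (df n) \<nu> \<phi> - (\<integral>x. \<phi> x \<partial>equilibrium_measure f)) < \<epsilon>"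
      by blast
  qed
qed


end
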